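(* Let $n\geq 1$, let $X$ be a path-connected topological space and let $x_0\in X$. If $X$ is paracompact, Hausdorff, and $LC^{n-1}$, then $\pi_{n}^{Sp}(X,x_0)=\ker(\Psi_n)$ as subgroups of $\pi_n(X,x_0)$, where $\Psi_n:\pi_n(X,x_0)\to\check{\pi}_n(X,x_0)$ is the canonical homomorphism to the $n$-th shape (Čech) homotopy group.
   Context: $LC^n$ property ($n\in\{0,1,2,\dots\}$): $\Delta_{k+1}$ is the standard $(k+1)$-simplex and $\partial\Delta_{k+1}\cong S^k$ its boundary. $X$ is $LC^n$ if for every $x\in X$ and every neighborhood $U$ of $x$ there is a neighborhood $V$ of $x$ with $V\subseteq U$ such that for all $0\leq k\leq n$ every continuous map $\partial\Delta_{k+1}\to V$ extends to a continuous map $\Delta_{k+1}\to U$. Higher Spanier groups: fix a basepoint $d_0\in S^n$. For a path $\alpha:[0,1]\to X$ with $\alpha(0)=x_0$ and a map $f:(S^n,d_0)\to(X,\alpha(1))$, $[\alpha\ast f]\in\pi_n(X,x_0)$ is the image of $[f]$ under the basepoint-change isomorphism $\pi_n(X,\alpha(1))\to\pi_n(X,x_0)$ determined by $\alpha$ (for $n=1$, $[\alpha\ast f]=[\alpha\cdot f\cdot\alpha^{-}]$). For an open cover $\mathscr{U}$ of $X$, $\pi_n^{Sp}(\mathscr{U},x_0)$ is the subgroup of $\pi_n(X,x_0)$ generated by all $[\alpha\ast f]$ where $\alpha$ is a path starting at $x_0$ and $f:(S^n,d_0)\to (X,\alpha(1))$ satisfies $f(S^n)\subseteq U$ for some $U\in\mathscr{U}$.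 The $n$-th Spanier group is $\pi_n^{Sp}(X,x_0)=\bigcap_{\mathscr{U}}\pi_n^{Sp}(\mathscr{U},x_0)$, the intersection over all open covers of $X$. Shape homotopy groups: let $\Lambda$ be the set of pairs $(\mathscr{U},U_0)$ where $\mathscr{U}$ is an open cover of $X$, $x_0\in U_0\in\mathscr{U}$, and there is a partition of unity $\{\phi_U\}_{U\in\mathscr{U}}$ subordinated to $\mathscr{U}$ with $\phi_{U_0}(x_0)=1$. It is directed by refinement: $(\mathscr{V},V_0)$ refines $(\mathscr{U},U_0)$ if $\mathscr{V}$ refines $\mathscr{U}$ and $V_0\subseteq U_0$. The nerve $N(\mathscr{U})$ is the abstract simplicial complex with vertex set $\mathscr{U}$ in which $A_0,\dots,A_k$ span a simplex iff $\bigcap_i A_i\neq\emptyset$; $|N(\mathscr{U})|$ is its geometric realization (weak topology), based at the vertex $U_0$. If $(\mathscr{V},V_0)$ refines $(\mathscr{U},U_0)$, a projection $p_{\mathscr{U}\mathscr{V}}:|N(\mathscr{V})|\to|N(\mathscr{U})|$ is the simplicial map sending each vertex $V$ to some vertex $U$ with $V\subseteq U$, and $V_0$ to $U_0$; it is unique up to based homotopy. Then $\check{\pi}_n(X,x_0)=\varprojlim(\pi_n(|N(\mathscr{U})|,U_0),p_{\mathscr{U}\mathscr{V}\#},\Lambda)$. A (based) canonical map $p_{\mathscr{U}}:X\to|N(\mathscr{U})|$ is a continuous map with $p_{\mathscr{U}}(x_0)=U_0$ and $p_{\mathscr{U}}^{-1}(\mathrm{st}(U,|N(\mathscr{U})|))\subseteq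 U$ for all $U\in\mathscr{U}$, where $\mathrm{st}$ is the open star of a vertex; it exists for each $(\mathscr{U},U_0)\in\Lambda$ and is unique up to based homotopy. $\Psi_n:\pi_n(X,x_0)\to\check{\pi}_n(X,x_0)$ is $\Psi_n([f])=([p_{\mathscr{U}}\circ f])_{(\mathscr{U},U_0)\in\Lambda}$. *)

theory Defs
  imports "HOL-Homology.Homology"
begin

section \<open>Point-set conditions\<close>

definition open_cover :: "'a topology \<Rightarrow> 'a set set \<Rightarrow> bool" where
  "open_cover X \<U> \<longleftrightarrow> (\<forall>U\<in>\<U>. openin X U) \<and> \<Union>\<U> = topspace X"

definition refines :: "'a set set \<Rightarrow> 'a set set \<Rightarrow> bool" where
  "refines \<V> \<U> \<longleftrightarrow> (\<forall>V\<in>\<V>. \<exists>U\<in>\<U>. V \<subseteq> U)"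

definition paracompact_space :: "'a topology \<Rightarrow> bool" where
  "paracompact_space X \<longleftrightarrow>
     (\<forall>\<U>. open_cover X \<U> \<longrightarrow> (\<exists>\<V>. open_cover X \<V> \<and> refines \<V> \<U> \<and> locally_finite_in X \<V>))"

abbreviation simplex_space :: "nat \<Rightarrow> (nat \<Rightarrow> real) topology" where
  "simplex_space p \<equiv> subtopology (powertop_real UNIV) (standard_simplex p)"

abbreviation simplex_boundary_space :: "nat \<Rightarrow> (nat \<Rightarrow> real) topology" where
  "simplex_boundary_space p \<equiv>
     subtopology (powertop_real UNIV) {x \<in> standard_simplex p. \<exists>i\<le>p. x i = 0}"

definition LC :: "nat \<Rightarrow> 'a topology \<Rightarrow> bool" where
  "LC n X \<longleftrightarrow>
     (\<forall>x U. openin X U \<and> x \<in> U \<longrightarrow>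
        (\<exists>V. openin X V \<and> x \<in> V \<and> V \<subseteq> U \<and>
           (\<forall>k\<le>n. \<forall>f. continuous_map (simplex_boundary_space (Suc k)) (subtopology X V) f \<longrightarrow>
              (\<exists>g. continuous_map (simplex_space (Suc k)) (subtopology X U) g \<and>
                   (\<forall>t\<in>topspace (simplex_boundary_space (Suc k)). g t = f t)))))"


section \<open>Homotopy groups\<close>

text \<open>Elements of \<open>\<pi>\<^sub>n(X,x)\<close>, for \<open>n \<ge> 1\<close>, are homotopy classes of maps
  \<open>(I\<^sup>n, \<partial>I\<^sup>n) \<rightarrow> (X, x)\<close>, with concatenation in the coordinate \<open>0\<close>. Points of \<open>I\<^sup>n\<close> are
  sequences vanishing from index \<open>n\<close> on. Values of a map off the cube are irrelevant: they do
  not affect the relation \<open>sph_homotopic\<close>.\<close>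

definition cube_space :: "nat \<Rightarrow> (nat \<Rightarrow> real) topology" where
  "cube_space n = subtopology (Euclidean_space n) {t. \<forall>i<n. 0 \<le> t i \<and> t i \<le> 1}"

definition cube_boundary :: "nat \<Rightarrow> (nat \<Rightarrow> real) set" where
  "cube_boundary n = {t \<in> topspace (cube_space n). \<exists>i<n. t i = 0 \<or> t i = 1}"

definition spheroids :: "nat \<Rightarrow> 'a topology \<Rightarrow> 'a \<Rightarrow> ((nat \<Rightarrow> real) \<Rightarrow> 'a) set" where
  "spheroids n X x = {f. continuous_map (cube_space n) X f \<and> (\<forall>t\<in>cube_boundary n. f t = x)}"

definition sph_homotopic ::
  "nat \<Rightarrow> 'a topology \<Rightarrow> 'a \<Rightarrow> (((nat \<Rightarrow> real) \<Rightarrow> 'a) \<times> ((nat \<Rightarrow> real) \<Rightarrow> 'a)) set" where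
  "sph_homotopic n X x =
     {(f, g). homotopic_with (\<lambda>h. \<forall>t\<in>cube_boundary n. h t = x) (cube_space n) X f g}"

definition sph_class ::
  "nat \<Rightarrow> 'a topology \<Rightarrow> 'a \<Rightarrow> ((nat \<Rightarrow> real) \<Rightarrow> 'a) \<Rightarrow> ((nat \<Rightarrow> real) \<Rightarrow> 'a) set" where
  "sph_class n X x f = sph_homotopic n X x `` {f}"

definition sph_concat ::
  "((nat \<Rightarrow> real) \<Rightarrow> 'a) \<Rightarrow> ((nat \<Rightarrow> real) \<Rightarrow> 'a) \<Rightarrow> (nat \<Rightarrow> real) \<Rightarrow> 'a" where
  "sph_concat f g t =
     (if t 0 \<le> 1/2 then f (t(0 := 2 * t 0)) else g (t(0 := 2 * t 0 - 1)))"

definition homotopy_group ::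
  "nat \<Rightarrow> 'a topology \<Rightarrow> 'a \<Rightarrow> ((nat \<Rightarrow> real) \<Rightarrow> 'a) set monoid" where
  "homotopy_group n X x =
     \<lparr>carrier = spheroids n X x // sph_homotopic n X x,
      monoid.mult = (\<lambda>A B. \<Union>f\<in>A. \<Union>g\<in>B. sph_class n X x (sph_concat f g)),
      one = sph_class n X x (\<lambda>_. x)\<rparr>"

definition induced_map ::
  "nat \<Rightarrow> 'b topology \<Rightarrow> 'b \<Rightarrow> ('a \<Rightarrow> 'b) \<Rightarrow> ((nat \<Rightarrow> real) \<Rightarrow> 'a) set \<Rightarrow> ((nat \<Rightarrow> real) \<Rightarrow> 'b) set"
  where "induced_map n Y y p A = (\<Union>f\<in>A. sph_class n Y y (p \<circ> f))"

lemma equiv_sph_homotopic: "equiv (spheroids n X x) (sph_homotopic n X x)"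
proof -
  let ?P = "\<lambda>h. \<forall>t\<in>cube_boundary n. h t = x"
  have P_cong: "?P h \<longleftrightarrow> ?P k" if "\<And>t. t \<in> topspace (cube_space n) \<Longrightarrow> h t = k t" for h k :: "_ \<Rightarrow> 'a"
    using that by (auto simp: cube_boundary_def)
  have mem: "f \<in> spheroids n X x \<and> g \<in> spheroids n X x"
    if "homotopic_with ?P (cube_space n) X f g" for f g
    using homotopic_with_imp_continuous_maps[OF that] homotopic_with_imp_property[OF that]
    by (auto simp: spheroids_def)
  have "refl_on (spheroids n X x) (sph_homotopic n X x)"
    by (auto simp: refl_on_def sph_homotopic_def spheroids_def)
  moreover have "sph_homotopic n X x \<subseteq> spheroids n X x \<times> spheroids n X x"
    using mem by (auto simp: sph_homotopic_def)
  moreover have "sym (sph_homotopic n X x)"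
    by (auto simp: sym_def sph_homotopic_def intro: homotopic_with_symD)
  moreover have "trans (sph_homotopic n X x)"
    by (auto simp: trans_def sph_homotopic_def intro: homotopic_with_trans)
  ultimately show ?thesis
    by (auto simp: equiv_def)
qed


section \<open>Spanier groups\<close>

definition sphere_base :: "nat \<Rightarrow> real" where
  "sphere_base = (\<lambda>i. if i = 0 then 1 else 0)"

text \<open>The identification \<open>I\<^sup>n/\<partial>I\<^sup>n \<cong> S\<^sup>n\<close>, under which a based map \<open>f\<close> of the sphere represents
  the class of \<open>f \<circ> cube_collapse n\<close>. With \<open>u = 2t - 1 \<in> [-1,1]\<^sup>n\<close> and \<open>b = \<Prod>\<^sub>i (1 - u\<^sub>i\<^sup>2)\<close>, which
  vanishes exactly on \<open>\<partial>I\<^sup>n\<close>, the map \<open>w = u/b\<close> is a homeomorphism from the open cube to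
  \<open>\<real>\<^sup>n\<close>; inverse stereographic projection sends it to \<open>(|w|\<^sup>2 - 1, 2w) / (|w|\<^sup>2 + 1)\<close>. Clearing
  \<open>b\<^sup>2\<close> extends the composite to \<open>\<partial>I\<^sup>n\<close>, which goes to \<open>sphere_base\<close>.\<close>

definition cube_collapse :: "nat \<Rightarrow> (nat \<Rightarrow> real) \<Rightarrow> nat \<Rightarrow> real" where
  "cube_collapse n t =
     (let u = (\<lambda>i. 2 * t i - 1);
          b = (\<Prod>i<n. 1 - (u i)\<^sup>2);
          s = (\<Sum>i<n. (u i)\<^sup>2)
      in (\<lambda>j. case j of 0 \<Rightarrow> (s - b\<^sup>2) / (s + b\<^sup>2)
              | Suc i \<Rightarrow> if i < n then 2 * b * u i / (s + b\<^sup>2) else 0))"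

text \<open>The basepoint change along \<open>\<alpha>\<close>: a copy of \<open>f\<close> on the concentric cube of side
  \<open>1/2\<close>, and \<open>\<alpha>\<close>, from \<open>\<alpha> 0\<close> on \<open>\<partial>I\<^sup>n\<close> to \<open>\<alpha> 1\<close> on the inner cube, along the radial
  segments of the shell.\<close>

definition path_act :: "nat \<Rightarrow> (real \<Rightarrow> 'a) \<Rightarrow> ((nat \<Rightarrow> real) \<Rightarrow> 'a) \<Rightarrow> (nat \<Rightarrow> real) \<Rightarrow> 'a" where
  "path_act n \<alpha> f t =
     (let r = Max ((\<lambda>i. \<bar>2 * t i - 1\<bar>) ` {..<n})
      in if r \<le> 1/2 then f (\<lambda>i. if i < n then 2 * t i - 1/2 else 0) else \<alpha> (2 - 2 * r))"

definition spanier_generators ::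
  "nat \<Rightarrow> 'a topology \<Rightarrow> 'a set set \<Rightarrow> 'a \<Rightarrow> ((nat \<Rightarrow> real) \<Rightarrow> 'a) set set" where
  "spanier_generators n X \<U> x0 =
     {sph_class n X x0 (path_act n \<alpha> (f \<circ> cube_collapse n)) | \<alpha> f.
        pathin X \<alpha> \<and> \<alpha> 0 = x0 \<and>
        continuous_map (nsphere n) X f \<and> f sphere_base = \<alpha> 1 \<and>
        (\<exists>U\<in>\<U>. f ` topspace (nsphere n) \<subseteq> U)}"

definition spanier_group_cover ::
  "nat \<Rightarrow> 'a topology \<Rightarrow> 'a set set \<Rightarrow> 'a \<Rightarrow> ((nat \<Rightarrow> real) \<Rightarrow> 'a) set set" where
  "spanier_group_cover n X \<U> x0 =
     generate (homotopy_group n X x0) (spanier_generators n X \<U> x0)"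

definition spanier_group ::
  "nat \<Rightarrow> 'a topology \<Rightarrow> 'a \<Rightarrow> ((nat \<Rightarrow> real) \<Rightarrow> 'a) set set" where
  "spanier_group n X x0 = (\<Inter>\<U>\<in>{\<U>. open_cover X \<U>}. spanier_group_cover n X \<U> x0)"

lemma
  assumes n: "n \<ge> 1" and t: "t \<in> topspace (cube_space n)"
  shows cube_collapse_denom_pos:
      "0 < (\<Sum>i<n. (2 * t i - 1)\<^sup>2) + (\<Prod>i<n. 1 - (2 * t i - 1)\<^sup>2)\<^sup>2"
    and cube_collapse_in_nsphere: "cube_collapse n t \<in> topspace (nsphere n)"
    and cube_collapse_eq_base: "cube_collapse n t = sphere_base \<longleftrightarrow> t \<in> cube_boundary n"
proof -
  define u where "u = (\<lambda>i. 2 * t i - 1)"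
  define b where "b = (\<Prod>i<n. 1 - (u i)\<^sup>2)"
  define s where "s = (\<Sum>i<n. (u i)\<^sup>2)"
  have s0: "s \<ge> 0"
    unfolding s_def by (intro sum_nonneg) auto
  have b1: "b = 1" if "s = 0"
  proof -
    have "\<forall>i\<in>{..<n}. (u i)\<^sup>2 = 0"
      using that unfolding s_def by (subst (asm) sum_nonneg_eq_0_iff) auto
    then show ?thesis
      by (simp add: b_def)
  qed
  have pos: "0 < s + b\<^sup>2"
    using s0 b1 by (cases "s = 0") (auto simp: add_pos_nonneg)
  then show "0 < (\<Sum>i<n. (2 * t i - 1)\<^sup>2) + (\<Prod>i<n. 1 - (2 * t i - 1)\<^sup>2)\<^sup>2"
    by (simp add: s_def b_def u_def)
  have c0: "cube_collapse n t 0 = (s - b\<^sup>2) / (s + b\<^sup>2)"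
    and cS: "cube_collapse n t (Suc i) = (if i < n then 2 * b * u i / (s + b\<^sup>2) else 0)" for i
    by (simp_all add: cube_collapse_def s_def b_def u_def Let_def)
  have "(\<Sum>i\<le>n. (cube_collapse n t i)\<^sup>2)
      = ((s - b\<^sup>2) / (s + b\<^sup>2))\<^sup>2 + (\<Sum>i<n. (2 * b * u i / (s + b\<^sup>2))\<^sup>2)"
    by (simp add: lessThan_Suc_atMost [symmetric] sum.lessThan_Suc_shift c0 cS del: sum.lessThan_Suc)
  also have "(\<Sum>i<n. (2 * b * u i / (s + b\<^sup>2))\<^sup>2) = 4 * b\<^sup>2 * s / (s + b\<^sup>2)\<^sup>2"
    by (simp add: s_def power_divide power_mult_distrib sum_distrib_left sum_divide_distrib)
  also have "((s - b\<^sup>2) / (s + b\<^sup>2))\<^sup>2 + 4 * b\<^sup>2 * s / (s + b\<^sup>2)\<^sup>2 = (s + b\<^sup>2)\<^sup>2 / (s + b\<^sup>2)\<^sup>2"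
    by (simp add: power_divide add_divide_distrib [symmetric] power2_eq_square algebra_simps)
  also have "\<dots> = 1"
    using pos by simp
  finally have "(\<Sum>i\<le>n. (cube_collapse n t i)\<^sup>2) = 1" .
  moreover have "cube_collapse n t i = 0" if "i > n" for i
    using that by (cases i) (auto simp: cS)
  ultimately show "cube_collapse n t \<in> topspace (nsphere n)"
    by (simp add: nsphere)
  have "cube_collapse n t = sphere_base \<longleftrightarrow> b = 0"
  proof
    assume "cube_collapse n t = sphere_base"
    then have "(s - b\<^sup>2) / (s + b\<^sup>2) = 1"
      using c0 by (metis sphere_base_def)
    then show "b = 0"
    proof -
      have "s - b\<^sup>2 = s + b\<^sup>2"
        using pos \<open>(s - b\<^sup>2) / (s + b\<^sup>2) = 1\<close> by simp
      then show ?thesis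
        by simp
    qed
  next
    assume "b = 0"
    then show "cube_collapse n t = sphere_base"
      using pos by (auto simp: fun_eq_iff sphere_base_def c0 cS gr0_conv_Suc)
  qed
  also have "b = 0 \<longleftrightarrow> (\<exists>i<n. t i = 0 \<or> t i = 1)"
  proof -
    have "1 - (u i)\<^sup>2 = 0 \<longleftrightarrow> t i = 0 \<or> t i = 1" for i
    proof -
      have "1 - (u i)\<^sup>2 = 4 * t i * (1 - t i)"
        by (simp add: u_def power2_eq_square algebra_simps)
      then show ?thesis
        by auto
    qed
    then show ?thesis
      unfolding b_def by (auto simp del: right_minus_eq)
  qed
  finally show "cube_collapse n t = sphere_base \<longleftrightarrow> t \<in> cube_boundary n"
    using t by (simp add: cube_boundary_def)
qed


section \<open>Nerves and their geometric realizations\<close>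

definition nerve :: "'a set set \<Rightarrow> 'a set set set" where
  "nerve \<U> = {\<sigma>. \<sigma> \<subseteq> \<U> \<and> finite \<sigma> \<and> \<sigma> \<noteq> {} \<and> \<Inter>\<sigma> \<noteq> {}}"

text \<open>For an abstract simplicial complex \<open>K\<close>, given as its set of simplices, points of \<open>|K|\<close> are
  encoded by their barycentric coordinates.\<close>

definition closed_simplex :: "'v set \<Rightarrow> ('v \<Rightarrow> real) set" where
  "closed_simplex \<sigma> = {b. (\<forall>v. 0 \<le> b v) \<and> (\<forall>v. v \<notin> \<sigma> \<longrightarrow> b v = 0) \<and> (\<Sum>v\<in>\<sigma>. b v) = 1}"

definition weak_open :: "'v set set \<Rightarrow> ('v \<Rightarrow> real) set \<Rightarrow> bool" where
  "weak_open K W \<longleftrightarrow> W \<subseteq> (\<Union>\<sigma>\<in>K. closed_simplex \<sigma>) \<and>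
     (\<forall>\<sigma>\<in>K. openin (subtopology (powertop_real UNIV) (closed_simplex \<sigma>)) (W \<inter> closed_simplex \<sigma>))"

definition realization :: "'v set set \<Rightarrow> ('v \<Rightarrow> real) topology" where
  "realization K = topology (weak_open K)"

lemma istopology_weak_open: "istopology (weak_open K)"
  unfolding istopology_def
proof (intro conjI allI impI)
  fix S T assume S: "weak_open K S" and T: "weak_open K T"
  have "openin (subtopology (powertop_real UNIV) (closed_simplex \<sigma>)) ((S \<inter> T) \<inter> closed_simplex \<sigma>)"
    if "\<sigma> \<in> K" for \<sigma>
  proof -
    have "openin (subtopology (powertop_real UNIV) (closed_simplex \<sigma>))
            ((S \<inter> closed_simplex \<sigma>) \<inter> (T \<inter> closed_simplex \<sigma>))"
      using S T that unfolding weak_open_def by (metis openin_Int)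
    moreover have "(S \<inter> closed_simplex \<sigma>) \<inter> (T \<inter> closed_simplex \<sigma>) = (S \<inter> T) \<inter> closed_simplex \<sigma>"
      by blast
    ultimately show ?thesis
      by metis
  qed
  then show "weak_open K (S \<inter> T)"
    using S unfolding weak_open_def by blast
next
  fix \<W> assume W: "\<forall>W\<in>\<W>. weak_open K W"
  have "openin (subtopology (powertop_real UNIV) (closed_simplex \<sigma>)) (\<Union>\<W> \<inter> closed_simplex \<sigma>)"
    if "\<sigma> \<in> K" for \<sigma>
  proof -
    have "openin (subtopology (powertop_real UNIV) (closed_simplex \<sigma>))
            (\<Union>((\<lambda>W. W \<inter> closed_simplex \<sigma>) ` \<W>))"
      using W that unfolding weak_open_def by (intro openin_Union) blast
    moreover have "\<Union>((\<lambda>W. W \<inter> closed_simplex \<sigma>) ` \<W>) = \<Union>\<W> \<inter> closed_simplex \<sigma>"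
      by blast
    ultimately show ?thesis
      by metis
  qed
  moreover have "\<Union>\<W> \<subseteq> (\<Union>\<sigma>\<in>K. closed_simplex \<sigma>)"
    using W unfolding weak_open_def by blast
  ultimately show "weak_open K (\<Union>\<W>)"
    unfolding weak_open_def by blast
qed

lemma openin_realization: "openin (realization K) W \<longleftrightarrow> weak_open K W"
  by (simp add: realization_def istopology_weak_open)

lemma topspace_realization: "topspace (realization K) = (\<Union>\<sigma>\<in>K. closed_simplex \<sigma>)"
proof
  have "weak_open K (topspace (realization K))"
    by (simp flip: openin_realization)
  then show "topspace (realization K) \<subseteq> (\<Union>\<sigma>\<in>K. closed_simplex \<sigma>)"
    by (simp add: weak_open_def)
  have "openin (subtopology (powertop_real UNIV) (closed_simplex \<sigma>))
          ((\<Union>\<tau>\<in>K. closed_simplex \<tau>) \<inter> closed_simplex \<sigma>)" if "\<sigma> \<in> K" for \<sigma>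
  proof -
    have "(\<Union>\<tau>\<in>K. closed_simplex \<tau>) \<inter> closed_simplex \<sigma> = closed_simplex \<sigma>"
      using that by blast
    then show ?thesis
      using openin_topspace [of "subtopology (powertop_real UNIV) (closed_simplex \<sigma>)"] by simp
  qed
  then have "weak_open K (\<Union>\<sigma>\<in>K. closed_simplex \<sigma>)"
    unfolding weak_open_def by blast
  then show "(\<Union>\<sigma>\<in>K. closed_simplex \<sigma>) \<subseteq> topspace (realization K)"
    by (simp add: openin_subset flip: openin_realization)
qed

definition vertex :: "'v \<Rightarrow> 'v \<Rightarrow> real" where
  "vertex v = (\<lambda>w. if w = v then 1 else 0)"

definition open_star :: "'v set set \<Rightarrow> 'v \<Rightarrow> ('v \<Rightarrow> real) set" where
  "open_star K v = {b \<in> topspace (realization K). b v > 0}"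

text \<open>The affine extension to realizations of a map of vertices.\<close>

definition simplicial_ext :: "('v \<Rightarrow> 'w) \<Rightarrow> ('v \<Rightarrow> real) \<Rightarrow> 'w \<Rightarrow> real" where
  "simplicial_ext p b = (\<lambda>w. \<Sum>v\<in>{v. b v \<noteq> 0 \<and> p v = w}. b v)"


section \<open>Shape homotopy groups\<close>

definition support_in :: "'a topology \<Rightarrow> ('a \<Rightarrow> real) \<Rightarrow> 'a set" where
  "support_in X f = Abstract_Topology.closure_of X {x \<in> topspace X. f x \<noteq> 0}"

definition subordinated_partition_of_unity ::
  "'a topology \<Rightarrow> 'a set set \<Rightarrow> ('a set \<Rightarrow> 'a \<Rightarrow> real) \<Rightarrow> bool" where
  "subordinated_partition_of_unity X \<U> \<phi> \<longleftrightarrow>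
     (\<forall>U\<in>\<U>. continuous_map X (top_of_set {0..1}) (\<phi> U) \<and> support_in X (\<phi> U) \<subseteq> U) \<and>
     (\<forall>x\<in>topspace X. \<exists>W. openin X W \<and> x \<in> W \<and> finite {U\<in>\<U>. support_in X (\<phi> U) \<inter> W \<noteq> {}}) \<and>
     (\<forall>x\<in>topspace X. (\<Sum>U\<in>{U\<in>\<U>. \<phi> U x \<noteq> 0}. \<phi> U x) = 1)"

definition pointed_covers :: "'a topology \<Rightarrow> 'a \<Rightarrow> ('a set set \<times> 'a set) set" where
  "pointed_covers X x0 =
     {(\<U>, U0). open_cover X \<U> \<and> U0 \<in> \<U> \<and> x0 \<in> U0 \<and>
        (\<exists>\<phi>. subordinated_partition_of_unity X \<U> \<phi> \<and> \<phi> U0 x0 = 1)}"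

definition pointed_refines :: "'a set set \<times> 'a set \<Rightarrow> 'a set set \<times> 'a set \<Rightarrow> bool" where
  "pointed_refines = (\<lambda>(\<V>, V0) (\<U>, U0). refines \<V> \<U> \<and> V0 \<subseteq> U0)"

definition nerve_projection ::
  "'a set set \<times> 'a set \<Rightarrow> 'a set set \<times> 'a set \<Rightarrow> ('a set \<Rightarrow> 'a set) \<Rightarrow> bool" where
  "nerve_projection = (\<lambda>(\<V>, V0) (\<U>, U0) p.
     (\<forall>V\<in>\<V>. p V \<in> \<U> \<and> V \<subseteq> p V) \<and> p V0 = U0)"

lemma nerve_projection_exists:
  assumes "pointed_refines (\<V>, V0) (\<U>, U0)" "U0 \<in> \<U>"
  shows "\<exists>p. nerve_projection (\<V>, V0) (\<U>, U0) p"
proof -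
  obtain q where "\<forall>V\<in>\<V>. q V \<in> \<U> \<and> V \<subseteq> q V"
    using assms(1) by (auto simp: pointed_refines_def refines_def) metis
  then have "nerve_projection (\<V>, V0) (\<U>, U0) (q(V0 := U0))"
    using assms by (auto simp: nerve_projection_def pointed_refines_def)
  then show ?thesis
    by blast
qed

definition nerve_homotopy_group ::
  "nat \<Rightarrow> 'a set set \<times> 'a set \<Rightarrow> ((nat \<Rightarrow> real) \<Rightarrow> 'a set \<Rightarrow> real) set monoid" where
  "nerve_homotopy_group n = (\<lambda>(\<U>, U0). homotopy_group n (realization (nerve \<U>)) (vertex U0))"

definition nerve_induced ::
  "nat \<Rightarrow> 'a set set \<times> 'a set \<Rightarrow> ('b \<Rightarrow> 'a set \<Rightarrow> real)
    \<Rightarrow> ((nat \<Rightarrow> real) \<Rightarrow> 'b) set \<Rightarrow> ((nat \<Rightarrow> real) \<Rightarrow> 'a set \<Rightarrow> real) set" where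
  "nerve_induced n = (\<lambda>(\<U>, U0). induced_map n (realization (nerve \<U>)) (vertex U0))"

text \<open>The inverse limit, as a subgroup of the product. Since any two projections are based
  homotopic, compatibility is required for every projection instead of a selected one.\<close>

definition shape_group ::
  "nat \<Rightarrow> 'a topology \<Rightarrow> 'a
    \<Rightarrow> ('a set set \<times> 'a set \<Rightarrow> ((nat \<Rightarrow> real) \<Rightarrow> 'a set \<Rightarrow> real) set) monoid" where
  "shape_group n X x0 =
     (product_group (pointed_covers X x0) (nerve_homotopy_group n))
       \<lparr>carrier :=
         {c \<in> \<Pi>\<^sub>E i \<in> pointed_covers X x0. carrier (nerve_homotopy_group n i).
            \<forall>i\<in>pointed_covers X x0. \<forall>j\<in>pointed_covers X x0. \<forall>p.
              pointed_refines j i \<and> nerve_projection j i p \<longrightarrow>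
                nerve_induced n i (simplicial_ext p) (c j) = c i}\<rparr>"

definition canonical_map ::
  "'a topology \<Rightarrow> 'a \<Rightarrow> 'a set set \<times> 'a set \<Rightarrow> ('a \<Rightarrow> 'a set \<Rightarrow> real) \<Rightarrow> bool" where
  "canonical_map X x0 = (\<lambda>(\<U>, U0) p.
     continuous_map X (realization (nerve \<U>)) p \<and> p x0 = vertex U0 \<and>
     (\<forall>U\<in>\<U>. {x \<in> topspace X. p x \<in> open_star (nerve \<U>) U} \<subseteq> U))"

definition shape_hom ::
  "nat \<Rightarrow> 'a topology \<Rightarrow> 'a \<Rightarrow> ((nat \<Rightarrow> real) \<Rightarrow> 'a) set
    \<Rightarrow> ('a set set \<times> 'a set \<Rightarrow> ((nat \<Rightarrow> real) \<Rightarrow> 'a set \<Rightarrow> real) set)" where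
  "shape_hom n X x0 A =
     (\<lambda>i\<in>pointed_covers X x0. nerve_induced n i (SOME p. canonical_map X x0 i p) A)"

end

theory Submission
  imports Defs "HOL-Analysis.Analysis"
begin

text \<open>A canonical map \<open>p\<close> into the nerve of \<open>\<U>\<close> sends a sphere lying in some \<open>p\<^sup>-\<^sup>1(st(U))\<close> into a
  contractible open star, so the Spanier group of the cover by these sets dies in the nerve.

  Conversely, let \<open>f : I\<^sup>n \<rightarrow> X\<close> be a spheroid that becomes null-homotopic in the nerve of a fine cover.
  Divide \<open>I\<^sup>n\<^sup>+\<^sup>1\<close>, the domain of the null-homotopy, into cubes so small that each goes into
  the open star of a vertex. These vertices label the cubes by members of the cover, the labels
  of neighbouring cubes meet, and \<open>f\<close> respects them; by the \<open>LC\<^sup>n\<^sup>-\<^sup>1\<close> property, \<open>f\<close> extends over the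
  \<open>n\<close>-skeleton of the grid with the boundary of every small cube going into a single member of a given
  coarse cover. Sweeping an \<open>n\<close>-dimensional sheet across the grid from \<open>f\<close> to the constant map, each
  passage over a small cube changes the class by a Spanier generator of that coarse cover. Only
  cosets of the subgroup are compared, so its normality plays no role.\<close>

text \<open>The hypothesis stops at \<open>LC\<close> in degree n-1, so the (n+1)-cells of the grid
  need not be fillable; the sheet can only slide along their boundaries, and such a boundary, mapped
  into one member of the coarse cover, is exactly what a Spanier generator measures. Two features of
  the labelling need care. A small cell belongs to several labelled top cells, and its filling is
  produced inside the enlarged set of just one of them; so the cover is star-refined once per
  dimension to bring the filling into the sets assigned to all the others. And the constant part of
  the null-homotopy has to be matched by the constant map at \<open>x0\<close>: it sits at the
  vertex \<open>W0\<close>, and a vertex lies in no open star but its own, so every label there is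
  \<open>W0\<close>, a neighbourhood of \<open>x0\<close>. The weak topology is handled through
  compactness: a compact set lies in finitely many closed simplices, where continuity can be tested
  on coordinates.\<close>

no_notation eq_closure_of (\<open>closure'_of\<index>\<close>) (* it clashes with the topological closure *)

section \<open>Paracompact spaces\<close>

text \<open>Local finiteness turns separation at each point into separation of all of
  \<open>C\<close>: the closure of a locally finite union is the union of the closures. Taking
  \<open>A\<close> to be a point gives regularity, taking it closed gives normality.\<close>

lemma paracompact_open_neighbourhood:
  assumes P: "paracompact_space X" and C: "closedin X C" and A: "A \<subseteq> topspace X"
    and sep: "\<And>y. y \<in> C \<Longrightarrow> \<exists>O'. openin X O' \<and> y \<in> O' \<and> X closure_of O' \<inter> A = {}"
  shows "\<exists>G. openin X G \<and> C \<subseteq> G \<and> X closure_of G \<inter> A = {}"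
proof -
  obtain Q where Q: "\<And>y. y \<in> C \<Longrightarrow> openin X (Q y) \<and> y \<in> Q y \<and> X closure_of (Q y) \<inter> A = {}"
    using sep by metis
  have "open_cover X (insert (topspace X - C) (Q ` C))"
    unfolding open_cover_def
  proof (intro conjI ballI equalityI)
    show "openin X U" if "U \<in> insert (topspace X - C) (Q ` C)" for U
      using that C Q by auto
    then show "\<Union> (insert (topspace X - C) (Q ` C)) \<subseteq> topspace X"
      by (meson Sup_least openin_subset)
    show "topspace X \<subseteq> \<Union> (insert (topspace X - C) (Q ` C))"
      using Q by auto
  qed
  then obtain \<V> where V: "open_cover X \<V>" "refines \<V> (insert (topspace X - C) (Q ` C))"
     "locally_finite_in X \<V>"
    using P unfolding paracompact_space_def by blast
  \<comment> \<open>A member that meets \<open>C\<close> cannot lie in the complement of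
    \<open>C\<close>, so it lies in some \<open>Q y\<close> and inherits the separation from
    \<open>A\<close>.\<close>
  define \<V>' where "\<V>' = {V \<in> \<V>. V \<inter> C \<noteq> {}}"
  have lf: "locally_finite_in X \<V>'"
    using V(3) by (rule locally_finite_in_subset) (auto simp: \<V>'_def)
  have "X closure_of V \<inter> A = {}" if "V \<in> \<V>'" for V
  proof -
    from that have "V \<in> \<V>" "V \<inter> C \<noteq> {}" by (simp_all add: \<V>'_def)
    then obtain U where "U \<in> insert (topspace X - C) (Q ` C)" "V \<subseteq> U"
      using V(2) unfolding refines_def by meson
    then obtain y where "y \<in> C" "V \<subseteq> Q y"
      using \<open>V \<inter> C \<noteq> {}\<close> by auto
    then show ?thesis using Q[of y] closure_of_mono[of V "Q y" X] by blast
  qed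
  then have "X closure_of (\<Union>\<V>') \<inter> A = {}"
    by (subst closure_of_locally_finite_Union[OF lf]) auto
  moreover have "openin X (\<Union>\<V>')"
    using V(1) by (auto simp: \<V>'_def open_cover_def)
  moreover have "C \<subseteq> \<Union>\<V>'"
  proof
    fix x assume x: "x \<in> C"
    then have "x \<in> \<Union>\<V>" using V(1) closedin_subset[OF C] by (auto simp: open_cover_def)
    then show "x \<in> \<Union>\<V>'" using x by (auto simp: \<V>'_def)
  qed
  ultimately show ?thesis by blast
qed

lemma paracompact_Hausdorff_imp_regular_space:
  assumes "paracompact_space X" "Hausdorff_space X"
  shows "regular_space X"
  unfolding regular_space_def
proof (intro allI impI; elim conjE)
  fix C a assume C: "closedin X C" and a: "a \<in> topspace X - C"
  have "\<exists>G. openin X G \<and> C \<subseteq> G \<and> X closure_of G \<inter> {a} = {}"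
  proof (rule paracompact_open_neighbourhood[OF assms(1) C])
    fix y assume "y \<in> C"
    then obtain U V where "openin X U" "openin X V" "a \<in> U" "y \<in> V" "disjnt U V"
      using assms(2) a closedin_subset[OF C] unfolding Hausdorff_space_def
          by (metis DiffD1 DiffD2 subsetD)
    then have "U \<inter> X closure_of V = {}"
      using openin_Int_closure_of_eq_empty[of X U V] by (simp add: disjnt_def)
    then show "\<exists>O'. openin X O' \<and> y \<in> O' \<and> X closure_of O' \<inter> {a} = {}"
      using \<open>openin X V\<close> \<open>y \<in> V\<close> \<open>a \<in> U\<close> by blast
  qed (use a in auto)
  then obtain G where G: "openin X G" "C \<subseteq> G" "X closure_of G \<inter> {a} = {}" by blast
  have "openin X (topspace X - X closure_of G)" "a \<in> topspace X - X closure_of G"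
    "disjnt (topspace X - X closure_of G) G"
    using a G closure_of_subset[of G X] openin_subset[OF G(1)] by (auto simp: disjnt_def)
  then show "\<exists>U V. openin X U \<and> openin X V \<and> a \<in> U \<and> C \<subseteq> V \<and> disjnt U V"
    using G by blast
qed

lemma paracompact_regular_imp_normal_space:
  assumes "paracompact_space X" "regular_space X"
  shows "normal_space X"
  unfolding normal_space_def
proof (intro allI impI; elim conjE)
  fix S T assume S: "closedin X S" and T: "closedin X T" and d: "disjnt S T"
  have "\<exists>G. openin X G \<and> S \<subseteq> G \<and> X closure_of G \<inter> T = {}"
  proof (rule paracompact_open_neighbourhood[OF assms(1) S])
    fix y assume "y \<in> S"
    then obtain U V where "openin X U" "openin X V" "y \<in> U" "T \<subseteq> V" "disjnt U V"
    proof -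
      have "y \<in> topspace X - T" using d closedin_subset[OF S] \<open>y \<in> S\<close> by (auto simp: disjnt_def)
      then show thesis using assms(2) T that unfolding regular_space_def by meson
    qed
    moreover from this have "V \<inter> X closure_of U = {}"
      using openin_Int_closure_of_eq_empty[of X V U] by (auto simp: disjnt_def)
    ultimately show "\<exists>O'. openin X O' \<and> y \<in> O' \<and> X closure_of O' \<inter> T = {}"
      by blast
  qed (use T closedin_subset in blast)
  then obtain G where G: "openin X G" "S \<subseteq> G" "X closure_of G \<inter> T = {}" by blast
  have "openin X (topspace X - X closure_of G)" "T \<subseteq> topspace X - X closure_of G"
    "disjnt G (topspace X - X closure_of G)"
    using G closedin_subset[OF T] closure_of_subset[of G X] openin_subset[OF G(1)]
        by (auto simp: disjnt_def)
  then show "\<exists>U V. openin X U \<and> openin X V \<and> S \<subseteq> U \<and> T \<subseteq> V \<and> disjnt U V"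
    using G by blast
qed

text \<open>Regularity gives a locally finite refinement whose members have closures inside members
  of the cover. Each is allotted to one such \<open>U\<close>, and \<open>G U\<close> is the union
  of those allotted to it. Local finiteness is stated for the indices \<open>U\<close>, not for the
  sets \<open>G U\<close>: different indices may give the same set, and sums over \<open>U\<close>
  need finitely many indices.\<close>

lemma paracompact_regular_shrinking:
  assumes P: "paracompact_space X" and R: "regular_space X" and \<U>: "open_cover X \<U>"
  obtains G where "\<And>U. U \<in> \<U> \<Longrightarrow> openin X (G U)" "\<And>U. U \<in> \<U> \<Longrightarrow> X closure_of (G U) \<subseteq> U"
    "(\<Union>U\<in>\<U>. G U) = topspace X"
    "\<And>x. x \<in> topspace X \<Longrightarrow> \<exists>W. openin X W \<and> x \<in> W \<and> finite {U\<in>\<U>. G U \<inter> W \<noteq> {}}"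
proof -
  define \<O> where "\<O> = {Q. openin X Q \<and> (\<exists>U\<in>\<U>. X closure_of Q \<subseteq> U)}"
  have "open_cover X \<O>"
    unfolding open_cover_def
  proof (intro conjI equalityI subsetI ballI)
    fix x assume x: "x \<in> topspace X"
    then obtain U where U: "U \<in> \<U>" "x \<in> U" using \<U> by (auto simp: open_cover_def)
    then have "openin X U" using \<U> by (auto simp: open_cover_def)
    then have "closedin X (topspace X - U) \<and> x \<in> topspace X - (topspace X - U)"
      using U x by auto
    then obtain Q where Q: "openin X Q" "x \<in> Q" "disjnt (topspace X - U) (X closure_of Q)"
      using R unfolding regular_space by blast
    then have "X closure_of Q \<subseteq> U"
      using closure_of_subset_topspace[of X Q] by (auto simp: disjnt_def)
    then have "Q \<in> \<O>" using U(1) Q(1) by (auto simp: \<O>_def)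
    then show "x \<in> \<Union>\<O>" using \<open>x \<in> Q\<close> by blast
  qed (auto simp: \<O>_def dest: openin_subset)
  then obtain \<V> where V: "open_cover X \<V>" "refines \<V> \<O>" "locally_finite_in X \<V>"
    using P unfolding paracompact_space_def by blast
  have "\<forall>V\<in>\<V>. \<exists>U\<in>\<U>. X closure_of V \<subseteq> U"
    
  proof
    fix V assume "V \<in> \<V>"
    then obtain Q where "Q \<in> \<O>" "V \<subseteq> Q" using V(2) by (auto simp: refines_def)
    then show "\<exists>U\<in>\<U>. X closure_of V \<subseteq> U"
      using closure_of_mono[of V Q X] by (auto simp: \<O>_def)
  qed
  then obtain u where u: "\<And>V. V \<in> \<V> \<Longrightarrow> u V \<in> \<U> \<and> X closure_of V \<subseteq> u V" by metis
  define G where "G U = \<Union>{V\<in>\<V>. u V = U}" for U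
  show thesis
  proof
    show "openin X (G U)" if "U \<in> \<U>" for U
      using V(1) by (auto simp: G_def open_cover_def)
    show "X closure_of (G U) \<subseteq> U" if "U \<in> \<U>" for U
    proof -
      have "locally_finite_in X {V\<in>\<V>. u V = U}"
        using V(3) by (rule locally_finite_in_subset) auto
      then show ?thesis
        using u by (auto simp: G_def closure_of_locally_finite_Union)
    qed
    show "(\<Union>U\<in>\<U>. G U) = topspace X"
    proof -
      have "(\<Union>U\<in>\<U>. G U) = \<Union>\<V>"
        using u by (auto simp: G_def)
      then show ?thesis using V(1) by (simp add: open_cover_def)
    qed
    fix x assume "x \<in> topspace X"
    then obtain W where W: "openin X W" "x \<in> W" "finite {V\<in>\<V>. V \<inter> W \<noteq> {}}"
      using V(3) unfolding locally_finite_in_def by blast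
    have "{U\<in>\<U>. G U \<inter> W \<noteq> {}} \<subseteq> u ` {V\<in>\<V>. V \<inter> W \<noteq> {}}"
      by (auto simp: G_def)
    then show "\<exists>W. openin X W \<and> x \<in> W \<and> finite {U\<in>\<U>. G U \<inter> W \<noteq> {}}"
      using W finite_surj[OF W(3)] by blast
  qed
qed

text \<open>Two successive shrinkings leave room for Urysohn functions: \<open>h U\<close> is 1 on
  the closure of \<open>D (G U)\<close> and 0 off \<open>G U\<close>. The innermost sets still
  cover, so the locally finite sum \<open>s\<close> is at least 1 and may be divided by. Supports
  lie in the closure of \<open>G U\<close>, hence in \<open>U\<close>.\<close>

lemma paracompact_Hausdorff_partition_of_unity:
  assumes P: "paracompact_space X" and H: "Hausdorff_space X" and \<U>: "open_cover X \<U>"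
  shows "\<exists>\<phi>. subordinated_partition_of_unity X \<U> \<phi>"
proof -
  note R = paracompact_Hausdorff_imp_regular_space[OF P H]
  note N = paracompact_regular_imp_normal_space[OF P R]
  obtain G where G: "\<And>U. U \<in> \<U> \<Longrightarrow> openin X (G U)" "\<And>U. U \<in> \<U> \<Longrightarrow> X closure_of (G U) \<subseteq> U"
    "(\<Union>U\<in>\<U>. G U) = topspace X"
    "\<And>x. x \<in> topspace X \<Longrightarrow> \<exists>W. openin X W \<and> x \<in> W \<and> finite {U\<in>\<U>. G U \<inter> W \<noteq> {}}"
    by (rule paracompact_regular_shrinking[OF P R \<U>], rule that, auto)
  have Goc: "open_cover X (G ` \<U>)" using G by (auto simp: open_cover_def)
  obtain D where D: "\<And>U. U \<in> G ` \<U> \<Longrightarrow> openin X (D U)"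
    "\<And>U. U \<in> G ` \<U> \<Longrightarrow> X closure_of (D U) \<subseteq> U" "(\<Union>U\<in>G ` \<U>. D U) = topspace X"
    "\<And>x. x \<in> topspace X \<Longrightarrow> \<exists>W. openin X W \<and> x \<in> W \<and> finite {U\<in>G ` \<U>. D U \<inter> W \<noteq> {}}"
    by (rule paracompact_regular_shrinking[OF P R Goc], rule that, auto)
  have "\<exists>h. continuous_map X (top_of_set {0..1::real}) h \<and>
     h ` (topspace X - G U) \<subseteq> {0} \<and> h ` (X closure_of (D (G U))) \<subseteq> {1}" if "U \<in> \<U>" for U
  proof (rule Urysohn_lemma[OF N, of "topspace X - G U" "X closure_of (D (G U))" 0 1])
    show "disjnt (topspace X - G U) (X closure_of D (G U))"
      using D(2)[of "G U"] that by (auto simp: disjnt_def)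
  qed (use G that in auto)
  then obtain h where h: "\<And>U. U \<in> \<U> \<Longrightarrow> continuous_map X (top_of_set {0..1::real}) (h U) \<and>
     h U ` (topspace X - G U) \<subseteq> {0} \<and> h U ` (X closure_of (D (G U))) \<subseteq> {1}" by metis
  have hc: "continuous_map X euclideanreal (h U)" and h01: "\<And>x. x \<in> topspace X \<Longrightarrow>
      0 \<le> h U x \<and> h U x \<le> 1"
    and h0: "\<And>x. x \<in> topspace X \<Longrightarrow> h U x \<noteq> 0 \<Longrightarrow> x \<in> G U" if "U \<in> \<U>" for U
    using h[OF that] by (auto simp: continuous_map_in_subtopology)
  define s where "s x = (\<Sum>U\<in>{U\<in>\<U>. h U x \<noteq> 0}. h U x)" for x
  have "\<forall>x\<in>topspace X. \<exists>W. openin X W \<and> x \<in> W \<and> finite {U\<in>\<U>. G U \<inter> W \<noteq> {}}"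
    using G(4) by blast
  then obtain W where W: "\<forall>x\<in>topspace X. openin X (W x) \<and> x \<in> W x \<and> finite {U\<in>\<U>. G U \<inter> W x \<noteq> {}}"
    by (rule bchoice[elim_format]) blast
  define F where "F x = {U\<in>\<U>. G U \<inter> W x \<noteq> {}}" for x
  have WF: "openin X (W x)" "x \<in> W x" "finite (F x)" "F x \<subseteq> \<U>" if "x \<in> topspace X" for x
    using W that by (auto simp: F_def)
  have inF: "U \<in> F x" if "U \<in> \<U>" "h U y \<noteq> 0" "x \<in> topspace X" "y \<in> W x" for U x y
    using h0[OF that(1) _ that(2)] openin_subset[OF WF(1)[OF that(3)]] that by (auto simp: F_def)
  have sF: "s y = (\<Sum>U\<in>F x. h U y)" if "x \<in> topspace X" "y \<in> W x" for x y
    unfolding s_def using inF that WF[OF that(1)] by (intro sum.mono_neutral_left) auto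
  have scont: "continuous_map X euclideanreal s"
  proof (rule pasting_lemma[where I = "topspace X" and T = W and f = "\<lambda>x y. \<Sum>U\<in>F x. h U y"])
    fix x assume x: "x \<in> topspace X"
    have "continuous_map X euclideanreal (\<lambda>y. \<Sum>U\<in>F x. h U y)"
      using WF[OF x] hc by (intro continuous_map_sum) auto
    then show "continuous_map (subtopology X (W x)) euclideanreal (\<lambda>y. \<Sum>U\<in>F x. h U y)"
      by (rule continuous_map_from_subtopology)
  next
    fix i j x assume "i \<in> topspace X" "j \<in> topspace X" "x \<in> topspace X \<inter> W i \<inter> W j"
    then show "(\<Sum>U\<in>F i. h U x) = (\<Sum>U\<in>F j. h U x)" using sF[of i x] sF[of j x] by simp
  next
    fix x assume "x \<in> topspace X"
    then show "\<exists>j. j \<in> topspace X \<and> x \<in> W j \<and> s x = (\<Sum>U\<in>F j. h U x)"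
      using WF(2) sF by blast
  qed (rule WF(1))
  have hle: "h U x \<le> s x" if "U \<in> \<U>" "x \<in> topspace X" for U x
  proof (cases "h U x = 0")
    case True
    then show ?thesis unfolding s_def using h01 that by (auto intro!: sum_nonneg)
  next
    case False
    then have "U \<in> F x" using inF[OF that(1) _ that(2)] WF(2)[OF that(2)] by blast
    then have "h U x \<le> (\<Sum>U\<in>F x. h U x)"
      using WF[OF that(2)] h01 that by (intro member_le_sum) auto
    then show ?thesis using sF[OF that(2)] WF(2)[OF that(2)] by simp
  qed
  have s1: "s x \<ge> 1" if "x \<in> topspace X" for x
  proof -
    have "x \<in> (\<Union>U\<in>G ` \<U>. D U)" using that D(3) by simp
    then obtain U where U: "U \<in> \<U>" "x \<in> D (G U)" by auto
    then have "openin X (D (G U))" using D(1) by simp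
    then have "D (G U) \<subseteq> X closure_of (D (G U))" by (intro closure_of_subset openin_subset)
    then have "x \<in> X closure_of (D (G U))" using U(2) by (rule subsetD)
    then have "h U x = 1" using h[OF U(1)] by blast
    then show ?thesis using hle[OF U(1) that] by simp
  qed
  define \<phi> where "\<phi> U x = h U x / s x" for U x
  have sup: "support_in X (\<phi> U) \<subseteq> X closure_of (G U)" if "U \<in> \<U>" for U
    unfolding support_in_def using h0[OF that] by (intro closure_of_mono) (auto simp: \<phi>_def)
  have "subordinated_partition_of_unity X \<U> \<phi>"
    unfolding subordinated_partition_of_unity_def
  proof (intro conjI ballI)
    fix U assume U: "U \<in> \<U>"
    have "s x \<noteq> 0" if "x \<in> topspace X" for x using s1[OF that] by simp
    then have "continuous_map X euclideanreal (\<phi> U)"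
      unfolding \<phi>_def using hc[OF U] scont by (intro continuous_map_real_divide) auto
    moreover have "0 \<le> \<phi> U x \<and> \<phi> U x \<le> 1" if "x \<in> topspace X" for x
      using h01[OF U that] s1[OF that] hle[OF U that] by (simp add: \<phi>_def)
    ultimately show "continuous_map X (top_of_set {0..1}) (\<phi> U)"
      by (auto simp: continuous_map_in_subtopology)
    show "support_in X (\<phi> U) \<subseteq> U" using sup[OF U] G(2)[OF U] by blast
  next
    fix x assume x: "x \<in> topspace X"
    obtain W where W: "openin X W" "x \<in> W" "finite {U\<in>\<U>. G U \<inter> W \<noteq> {}}" using G(4)[OF x] by blast
    have "{U\<in>\<U>. support_in X (\<phi> U) \<inter> W \<noteq> {}} \<subseteq> {U\<in>\<U>. G U \<inter> W \<noteq> {}}"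
      using sup W(1) openin_Int_closure_of_eq_empty by blast
    then show "\<exists>W. openin X W \<and> x \<in> W \<and> finite {U\<in>\<U>. support_in X (\<phi> U) \<inter> W \<noteq> {}}"
      using W finite_subset[OF _ W(3)] by blast
    have "{U\<in>\<U>. \<phi> U x \<noteq> 0} = {U\<in>\<U>. h U x \<noteq> 0}" using s1[OF x] by (auto simp: \<phi>_def)
    then have "(\<Sum>U\<in>{U\<in>\<U>. \<phi> U x \<noteq> 0}. \<phi> U x) = s x / s x"
      by (simp add: \<phi>_def sum_divide_distrib[symmetric]) (simp add: s_def)
    then show "(\<Sum>U\<in>{U\<in>\<U>. \<phi> U x \<noteq> 0}. \<phi> U x) = 1" using s1[OF x] by simp
  qed
  then show ?thesis by blast
qed

text \<open>If y lies in \<open>G U\<close> and in \<open>Q x\<close>, then x lies in the closure of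
  \<open>G U\<close>, since \<open>Q x\<close> omits every closure that misses x; hence
  \<open>Q x\<close> is contained in \<open>U\<close>. So one \<open>U\<close> with y in
  \<open>G U\<close> serves all members containing y. Local finiteness makes the intersection in
  \<open>Q x\<close> finite and the removed union closed.\<close>

lemma paracompact_Hausdorff_barycentric_refinement:
  assumes P: "paracompact_space X" and H: "Hausdorff_space X" and \<U>: "open_cover X \<U>"
  obtains \<V> where "open_cover X \<V>"
    "\<And>y. y \<in> topspace X \<Longrightarrow> \<exists>U\<in>\<U>. \<forall>V\<in>\<V>. y \<in> V \<longrightarrow> V \<subseteq> U"
proof -
  note R = paracompact_Hausdorff_imp_regular_space[OF P H]
  obtain G where G: "\<And>U. U \<in> \<U> \<Longrightarrow> openin X (G U)" "\<And>U. U \<in> \<U> \<Longrightarrow> X closure_of (G U) \<subseteq> U"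
    "(\<Union>U\<in>\<U>. G U) = topspace X"
    "\<And>x. x \<in> topspace X \<Longrightarrow> \<exists>W. openin X W \<and> x \<in> W \<and> finite {U\<in>\<U>. G U \<inter> W \<noteq> {}}"
    by (rule paracompact_regular_shrinking[OF P R \<U>], rule that, auto)
  have Uo: "openin X U" if "U \<in> \<U>" for U using \<U> that by (auto simp: open_cover_def)
  have lf: "locally_finite_in X (G ` \<U>)"
    unfolding locally_finite_in_def
  proof (intro conjI ballI)
    show "\<Union> (G ` \<U>) \<subseteq> topspace X" using G(3) by simp
    fix x assume "x \<in> topspace X"
    then obtain W where W: "openin X W" "x \<in> W" "finite {U\<in>\<U>. G U \<inter> W \<noteq> {}}" using G(4) by blast
    have "{V \<in> G ` \<U>. V \<inter> W \<noteq> {}} \<subseteq> G ` {U\<in>\<U>. G U \<inter> W \<noteq> {}}" by auto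
    then show "\<exists>W. openin X W \<and> x \<in> W \<and> finite {V \<in> G ` \<U>. V \<inter> W \<noteq> {}}"
      using W finite_surj[OF W(3)] by blast
  qed
  define Q where "Q x = (topspace X \<inter> (\<Inter>U\<in>{U\<in>\<U>. x \<in> X closure_of (G U)}. U)) -
     (\<Union>U\<in>{U\<in>\<U>. x \<notin> X closure_of (G U)}. X closure_of (G U))" for x
  have Qx: "x \<in> Q x" if "x \<in> topspace X" for x
    using that G(2) by (auto simp: Q_def)
  have Qo: "openin X (Q x)" if x: "x \<in> topspace X" for x
  proof -
    obtain W where W: "openin X W" "x \<in> W" "finite {U\<in>\<U>. G U \<inter> W \<noteq> {}}" using G(4)[OF x] by blast
    have "{U\<in>\<U>. x \<in> X closure_of (G U)} \<subseteq> {U\<in>\<U>. G U \<inter> W \<noteq> {}}"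
      using W openin_Int_closure_of_eq_empty by blast
    then have fin: "finite {U\<in>\<U>. x \<in> X closure_of (G U)}" using finite_subset[OF _ W(3)] by blast
    obtain U0 where U0: "U0 \<in> \<U>" "x \<in> G U0" using x G(3) by blast
    then have "U0 \<in> {U\<in>\<U>. x \<in> X closure_of (G U)}"
      using closure_of_subset[of "G U0" X] openin_subset[OF G(1)[OF U0(1)]] by blast
    then have "openin X (\<Inter>U\<in>{U\<in>\<U>. x \<in> X closure_of (G U)}. U)"
      using fin Uo by (intro openin_Inter) auto
    then have 1: "openin X (topspace X \<inter> (\<Inter>U\<in>{U\<in>\<U>. x \<in> X closure_of (G U)}. U))" by blast
    have "locally_finite_in X (G ` {U\<in>\<U>. x \<notin> X closure_of (G U)})"
      using lf by (rule locally_finite_in_subset) auto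
    from closedin_Union_locally_finite_closure[OF this]
    have "closedin X (\<Union>U\<in>{U\<in>\<U>. x \<notin> X closure_of (G U)}. X closure_of (G U))"
      by (simp add: image_image)
    with 1 show ?thesis unfolding Q_def by (rule openin_diff)
  qed
  show thesis
  proof
    show "open_cover X (Q ` topspace X)"
      using Qx Qo by (auto simp: open_cover_def dest: openin_subset)
    fix y assume y: "y \<in> topspace X"
    obtain U where U: "U \<in> \<U>" "y \<in> G U" using y G(3) by blast
    then have yc: "y \<in> X closure_of (G U)"
      using closure_of_subset[of "G U" X] openin_subset[OF G(1)[OF U(1)]] by blast
    show "\<exists>U\<in>\<U>. \<forall>V\<in>Q ` topspace X. y \<in> V \<longrightarrow> V \<subseteq> U"
    proof (intro bexI[OF _ U(1)] ballI impI)
      fix V assume "V \<in> Q ` topspace X" "y \<in> V"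
      then obtain x where x: "x \<in> topspace X" "V = Q x" "y \<in> Q x" by blast
      then have "x \<in> X closure_of (G U)" using yc U(1) by (auto simp: Q_def)
      then show "V \<subseteq> U" using x U(1) by (auto simp: Q_def)
    qed
  qed
qed

text \<open>Two barycentric refinements in a row: if V' meets V at z, both lie in a single member of
  \<B> determined by z. That member contains the point y of V fixed beforehand, so the
  \<open>U\<close> belonging to y contains it.\<close>

lemma paracompact_Hausdorff_star_refinement:
  assumes P: "paracompact_space X" and H: "Hausdorff_space X" and \<U>: "open_cover X \<U>"
  obtains \<V> where "open_cover X \<V>"
    "\<And>V. V \<in> \<V> \<Longrightarrow> V \<noteq> {} \<Longrightarrow> \<exists>U\<in>\<U>. \<forall>V'\<in>\<V>. V' \<inter> V \<noteq> {} \<longrightarrow> V' \<subseteq> U"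
proof -
  obtain \<B> where B: "open_cover X \<B>"
    "\<And>y. y \<in> topspace X \<Longrightarrow> \<exists>U\<in>\<U>. \<forall>V\<in>\<B>. y \<in> V \<longrightarrow> V \<subseteq> U"
    by (rule paracompact_Hausdorff_barycentric_refinement[OF P H \<U>], rule that, auto)
  obtain \<V> where V: "open_cover X \<V>"
    "\<And>y. y \<in> topspace X \<Longrightarrow> \<exists>U\<in>\<B>. \<forall>V\<in>\<V>. y \<in> V \<longrightarrow> V \<subseteq> U"
    by (rule paracompact_Hausdorff_barycentric_refinement[OF P H B(1)], rule that, auto)
  show thesis
  proof (rule that[OF V(1)])
    fix V assume "V \<in> \<V>" "V \<noteq> {}"
    then obtain y where y: "y \<in> V" "y \<in> topspace X" using V(1) by (auto simp: open_cover_def)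
    obtain U where U: "U \<in> \<U>" "\<forall>B\<in>\<B>. y \<in> B \<longrightarrow> B \<subseteq> U" using B(2) y by blast
    have "V' \<subseteq> U" if V': "V' \<in> \<V>" "V' \<inter> V \<noteq> {}" for V'
    proof -
      obtain z where z: "z \<in> V'" "z \<in> V" "z \<in> topspace X" using V' V(1)
          by (auto simp: open_cover_def)
      obtain B' where B': "B' \<in> \<B>" "\<forall>V\<in>\<V>. z \<in> V \<longrightarrow> V \<subseteq> B'" using V(2)[OF z(3)] by blast
      then have "V' \<subseteq> B'" "V \<subseteq> B'" using V' \<open>V \<in> \<V>\<close> z by auto
      then show ?thesis using U B'(1) y by auto
    qed
    then show "\<exists>U\<in>\<U>. \<forall>V'\<in>\<V>. V' \<inter> V \<noteq> {} \<longrightarrow> V' \<subseteq> U" using U by blast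
  qed
qed

text \<open>The extension clause of \<open>LC\<close> in one dimension, with the two sets as
  parameters, so that it can be carried over from simplices to cubes and grid cells.\<close>

definition simplex_fill :: "nat \<Rightarrow> 'a topology \<Rightarrow> 'a set \<Rightarrow> 'a set \<Rightarrow> bool" where
  "simplex_fill d X A B \<longleftrightarrow>
     (\<forall>f. continuous_map (simplex_boundary_space d) (subtopology X A) f \<longrightarrow>
        (\<exists>g. continuous_map (simplex_space d) (subtopology X B) g \<and>
             (\<forall>t\<in>topspace (simplex_boundary_space d). g t = f t)))"

text \<open>The star-refining cover is chosen first, and the \<open>LC\<close> neighbourhoods inside
  its members afterwards. Fillings of maps into \<open>A\<close> only land in the larger
  \<open>B A\<close>, so it is the sets \<open>B A\<close> that must have small stars; they are
  members of the star-refining cover.\<close>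

lemma LC_star_refinement:
  assumes P: "paracompact_space X" and H: "Hausdorff_space X" and L: "LC n X" and k: "k \<le> n"
    and \<U>: "open_cover X \<U>"
  obtains \<V> B where "open_cover X \<V>" "\<And>A. A \<in> \<V> \<Longrightarrow> A \<subseteq> B A"
    "\<And>A. A \<in> \<V> \<Longrightarrow> simplex_fill (Suc k) X A (B A)"
    "\<And>A. A \<in> \<V> \<Longrightarrow> A \<noteq> {} \<Longrightarrow> \<exists>U\<in>\<U>. \<forall>A'\<in>\<V>. B A' \<inter> B A \<noteq> {} \<longrightarrow> B A' \<subseteq> U"
proof -
  obtain \<S> where S: "open_cover X \<S>"
    "\<And>V. V \<in> \<S> \<Longrightarrow> V \<noteq> {} \<Longrightarrow> \<exists>U\<in>\<U>. \<forall>V'\<in>\<S>. V' \<inter> V \<noteq> {} \<longrightarrow> V' \<subseteq> U"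
    by (rule paracompact_Hausdorff_star_refinement[OF P H \<U>], rule that, auto)
  have "\<exists>V. openin X V \<and> x \<in> V \<and> (\<exists>B\<in>\<S>. V \<subseteq> B \<and> simplex_fill (Suc k) X V B)" if x: "x \<in>
      topspace X" for x
  proof -
    obtain U where U: "U \<in> \<S>" "x \<in> U" "openin X U" using x S(1) by (auto simp: open_cover_def)
    then obtain V where "openin X V" "x \<in> V" "V \<subseteq> U" "\<forall>k\<le>n. simplex_fill (Suc k) X V U"
      using L unfolding LC_def simplex_fill_def by meson
    then show ?thesis using k U(1) by blast
  qed
  then obtain V where V: "\<And>x. x \<in> topspace X \<Longrightarrow> openin X (V x) \<and> x \<in> V x \<and>
      (\<exists>B\<in>\<S>. V x \<subseteq> B \<and> simplex_fill (Suc k) X (V x) B)" by metis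
  then have "\<forall>A\<in>V ` topspace X. \<exists>B\<in>\<S>. A \<subseteq> B \<and> simplex_fill (Suc k) X A B" by blast
  then obtain B where B: "\<And>A. A \<in> V ` topspace X \<Longrightarrow>
      B A \<in> \<S> \<and> A \<subseteq> B A \<and> simplex_fill (Suc k) X A (B A)"
    by metis
  show thesis
  proof (rule that[of "V ` topspace X" B])
    show "open_cover X (V ` topspace X)" using V by (auto simp: open_cover_def dest: openin_subset)
    fix A assume A: "A \<in> V ` topspace X"
    show "A \<subseteq> B A" "simplex_fill (Suc k) X A (B A)" using B[OF A] by auto
    assume "A \<noteq> {}"
    then have "B A \<in> \<S>" "B A \<noteq> {}" using B[OF A] by auto
    from S(2)[OF this] show "\<exists>U\<in>\<U>. \<forall>A'\<in>V ` topspace X. B A' \<inter> B A \<noteq> {} \<longrightarrow> B A' \<subseteq> U"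
      using B by meson
  qed
qed

text \<open>Deleting \<open>x0\<close> from the members of the cover while keeping one of them,
  \<open>W0\<close>, intact makes \<open>W0\<close> the only member around \<open>x0\<close>; any
  subordinated partition of unity then gives \<open>W0\<close> the value 1 there. The deletion keeps
  sets open because points of a Hausdorff space are closed.\<close>

lemma pointed_refinement:
  assumes P: "paracompact_space X" and H: "Hausdorff_space X" and \<U>: "open_cover X \<U>"
      and x0: "x0 \<in> topspace X"
  obtains \<W> W0 where "(\<W>, W0) \<in> pointed_covers X x0" "refines \<W> \<U>"
proof -
  obtain W0 where W0: "W0 \<in> \<U>" "x0 \<in> W0" "openin X W0" using x0 \<U> by (auto simp: open_cover_def)
  define \<W> where "\<W> = insert W0 ((\<lambda>U. U - {x0}) ` \<U>)"
  have oc: "open_cover X \<W>"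
    unfolding open_cover_def
  proof (intro conjI ballI equalityI subsetI)
    fix W assume "W \<in> \<W>"
    moreover have "openin X (U - {x0})" if "U \<in> \<U>" for U
      using that \<U> H x0 by (auto simp: open_cover_def Hausdorff_imp_t1_space closedin_t1_singleton)
    ultimately show "openin X W" using W0 by (auto simp: \<W>_def)
  next
    fix x assume "x \<in> \<Union>\<W>"
    then show "x \<in> topspace X" using \<U> W0 by (auto simp: \<W>_def open_cover_def)
  next
    fix x assume "x \<in> topspace X"
    then show "x \<in> \<Union>\<W>" using \<U> W0 by (cases "x = x0") (auto simp: \<W>_def open_cover_def)
  qed
  have uniq: "W = W0" if "W \<in> \<W>" "x0 \<in> W" for W using that by (auto simp: \<W>_def)
  obtain \<phi> where \<phi>: "subordinated_partition_of_unity X \<W> \<phi>"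
    using paracompact_Hausdorff_partition_of_unity[OF P H oc] by blast
  have "W = W0" if "W \<in> \<W>" "\<phi> W x0 \<noteq> 0" for W
  proof (rule uniq[OF that(1)])
    have "{x \<in> topspace X. \<phi> W x \<noteq> 0} \<subseteq> support_in X (\<phi> W)"
      unfolding support_in_def by (rule closure_of_subset) auto
    then show "x0 \<in> W" using \<phi> that x0 unfolding subordinated_partition_of_unity_def by blast
  qed
  moreover have "(\<Sum>U\<in>{U\<in>\<W>. \<phi> U x0 \<noteq> 0}. \<phi> U x0) = 1"
    using \<phi> x0 unfolding subordinated_partition_of_unity_def by blast
  moreover have "W0 \<in> \<W>" by (simp add: \<W>_def)
  ultimately have "\<phi> W0 x0 = 1"
  proof -
    assume a: "\<And>W. W \<in> \<W> \<Longrightarrow> \<phi> W x0 \<noteq> 0 \<Longrightarrow> W = W0" "(\<Sum>U\<in>{U\<in>\<W>. \<phi> U x0 \<noteq> 0}. \<phi> U x0) = 1"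
    have "{U\<in>\<W>. \<phi> U x0 \<noteq> 0} \<subseteq> {W0}" using a(1) by blast
    then have "{U\<in>\<W>. \<phi> U x0 \<noteq> 0} = {} \<or> {U\<in>\<W>. \<phi> U x0 \<noteq> 0} = {W0}" by blast
    then show ?thesis using a(2) by fastforce
  qed
  then have "(\<W>, W0) \<in> pointed_covers X x0"
    using oc \<phi> W0 by (auto simp: pointed_covers_def \<W>_def)
  moreover have "refines \<W> \<U>" using W0 by (auto simp: refines_def \<W>_def)
  ultimately show thesis by (rule that)
qed

section \<open>Realizations of nerves\<close>

lemma closedin_closed_simplex:
  assumes "finite \<sigma>"
  shows "closedin (powertop_real UNIV) (closed_simplex \<sigma>)"
proof -
  have c: "continuous_map (powertop_real UNIV) euclideanreal (\<lambda>b. b v)" for v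
    by (rule continuous_map_product_projection) simp
  have 1: "closedin (powertop_real UNIV) {b. 0 \<le> b v}" for v
    using closedin_continuous_map_preimage[OF c[of v], of "{0..}"] by simp
  have 2: "closedin (powertop_real UNIV) {b. b v = 0}" for v
    using closedin_continuous_map_preimage[OF c[of v], of "{0}"] by simp
  have "continuous_map (powertop_real UNIV) euclideanreal (\<lambda>b. \<Sum>v\<in>\<sigma>. b v)"
    using assms by (intro continuous_map_sum c) auto
  from closedin_continuous_map_preimage[OF this, of "{1}"]
  have 3: "closedin (powertop_real UNIV) {b. (\<Sum>v\<in>\<sigma>. b v) = 1}" by simp
  have "closed_simplex \<sigma> = {b. (\<Sum>v\<in>\<sigma>. b v) = 1} \<inter> \<Inter>(insert UNIV (range (\<lambda>v. {b. 0 \<le>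
      b v}) \<union> (\<lambda>v. {b. b v = 0}) ` (- \<sigma>)))"
    by (auto simp: closed_simplex_def)
  moreover have "closedin (powertop_real UNIV) (\<Inter>(insert UNIV (range (\<lambda>v. {b. 0 \<le>
      b v}) \<union> (\<lambda>v. {b. b v = 0}) ` (- \<sigma>))))"
    using 1 2 closedin_topspace[of "powertop_real UNIV"]
    by (intro closedin_Inter) (auto simp del: closedin_topspace)
  ultimately show ?thesis using 3 closedin_Int by metis
qed

lemma closedin_realizationD:
  assumes "closedin (realization K) C" "\<sigma> \<in> K" "finite \<sigma>"
  shows "closedin (powertop_real UNIV) (C \<inter> closed_simplex \<sigma>)"
proof -
  let ?S = "subtopology (powertop_real UNIV) (closed_simplex \<sigma>)"
  have "openin (realization K) (topspace (realization K) - C)"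
    using assms(1) by (rule openin_diff[OF openin_topspace])
  then have "openin ?S ((topspace (realization K) - C) \<inter> closed_simplex \<sigma>)"
    using assms(2) by (simp add: openin_realization weak_open_def)
  then have "closedin ?S (topspace ?S - (topspace (realization K) - C) \<inter> closed_simplex \<sigma>)"
    by (rule closedin_diff[OF closedin_topspace])
  moreover have "topspace ?S - (topspace (realization K) - C) \<inter> closed_simplex \<sigma> =
      C \<inter> closed_simplex \<sigma>"
    using assms(2) by (auto simp: topspace_realization)
  ultimately show ?thesis
    using closedin_trans_full closedin_closed_simplex[OF assms(3)] by metis
qed

lemma closedin_realizationI:
  assumes "C \<subseteq> topspace (realization K)" "\<And>\<sigma>. \<sigma> \<in> K \<Longrightarrow>
      closedin (powertop_real UNIV) (C \<inter> closed_simplex \<sigma>)"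
  shows "closedin (realization K) C"
proof -
  have "openin (subtopology (powertop_real UNIV) (closed_simplex \<sigma>))
      ((topspace (realization K) - C) \<inter> closed_simplex \<sigma>)" if "\<sigma> \<in> K" for \<sigma>
  proof -
    have "openin (powertop_real UNIV) (topspace (powertop_real UNIV) - (C \<inter> closed_simplex \<sigma>))"
      using assms(2)[OF that] by blast
    moreover have "(topspace (realization K) - C) \<inter> closed_simplex \<sigma> =
        (topspace (powertop_real UNIV) - (C \<inter> closed_simplex \<sigma>)) \<inter> closed_simplex \<sigma>"
      using that by (auto simp: topspace_realization)
    ultimately show ?thesis
      by (metis openin_subtopology)
  qed
  then have "openin (realization K) (topspace (realization K) - C)"
    by (auto simp: openin_realization weak_open_def topspace_realization)
  with assms(1) show ?thesis by (simp add: closedin_def)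
qed

text \<open>On finitely many simplices the weak topology is that of the coordinates.\<close>

lemma continuous_map_into_realization:
  assumes f: "continuous_map Z (powertop_real UNIV) f" and T: "finite T" "T \<subseteq> K" "\<And>\<sigma>. \<sigma> \<in> T \<Longrightarrow>
      finite \<sigma>"
    and im: "f ` topspace Z \<subseteq> (\<Union>\<sigma>\<in>T. closed_simplex \<sigma>)"
  shows "continuous_map Z (realization K) f"
  unfolding continuous_map_closedin
proof (intro conjI allI impI ballI)
  show "f \<in> topspace Z \<rightarrow> topspace (realization K)"
  proof
    fix x assume "x \<in> topspace Z"
    then obtain \<sigma> where "\<sigma> \<in> T" "f x \<in> closed_simplex \<sigma>" using im by auto
    then show "f x \<in> topspace (realization K)" using T(2) by (auto simp: topspace_realization)
  qed
  fix C assume C: "closedin (realization K) C"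
  have "closedin Z {x \<in> topspace Z. f x \<in> C \<inter> closed_simplex \<sigma>}" if "\<sigma> \<in> T" for \<sigma>
    using closedin_continuous_map_preimage[OF f closedin_realizationD[OF C]] T that by auto
  then have "closedin Z (\<Union>\<sigma>\<in>T. {x \<in> topspace Z. f x \<in> C \<inter> closed_simplex \<sigma>})"
    using T(1) by (intro closedin_Union) auto
  moreover have "(\<Union>\<sigma>\<in>T. {x \<in> topspace Z. f x \<in> C \<inter> closed_simplex \<sigma>}) = {x \<in> topspace Z. f x \<in> C}"
    using im by auto
  ultimately show "closedin Z {x \<in> topspace Z. f x \<in> C}" by simp
qed

text \<open>One direction holds on the whole complex: the weak topology is finer than that of the
  coordinates.\<close>

lemma continuous_map_realization_coordinates:
  "continuous_map (realization K) (powertop_real UNIV) (\<lambda>b. b)"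
  unfolding continuous_map_def
proof (intro conjI allI impI)
  fix W :: "('a \<Rightarrow> real) set" assume W: "openin (powertop_real UNIV) W"
  have "openin (subtopology (powertop_real UNIV) (closed_simplex \<sigma>))
      ({x \<in> topspace (realization K). x \<in> W} \<inter> closed_simplex \<sigma>)" if "\<sigma> \<in> K" for \<sigma>
  proof -
    have "{x \<in> topspace (realization K). x \<in> W} \<inter> closed_simplex \<sigma> = W \<inter> closed_simplex \<sigma>"
      using that by (auto simp: topspace_realization)
    then show ?thesis using W by (metis openin_subtopology)
  qed
  then show "openin (realization K) {x \<in> topspace (realization K). x \<in> W}"
    by (auto simp: openin_realization weak_open_def topspace_realization)
qed auto

lemma openin_open_star: "openin (realization K) (open_star K v)"
proof -
  have "continuous_map (realization K) euclideanreal (\<lambda>b. b v)"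
    using continuous_map_compose[OF continuous_map_realization_coordinates
        continuous_map_product_projection[of v UNIV "\<lambda>_. euclideanreal"]]
    by (simp add: o_def)
  from openin_continuous_map_preimage[OF this, of "{0<..}"]
  show ?thesis by (simp add: open_star_def)
qed

lemma closed_simplex_supportD:
  assumes "b \<in> closed_simplex \<sigma>" shows "{v. b v \<noteq> 0} \<subseteq> \<sigma>"
  using assms by (auto simp: closed_simplex_def)

lemma closed_simplex_same_support:
  assumes b: "b \<in> closed_simplex \<sigma>" and b': "b' \<in> closed_simplex \<sigma>'" and fin: "finite \<sigma>" "finite \<sigma>'"
    and eq: "{v. b v \<noteq> 0} = {v. b' v \<noteq> 0}"
  shows "b' \<in> closed_simplex \<sigma>"
proof -
  have sub: "{v. b' v \<noteq> 0} \<subseteq> \<sigma>" "{v. b' v \<noteq> 0} \<subseteq> \<sigma>'"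
    using closed_simplex_supportD[OF b] closed_simplex_supportD[OF b'] eq by auto
  have "(\<Sum>v\<in>\<sigma>. b' v) = (\<Sum>v | b' v \<noteq> 0. b' v)"
    using sub fin by (intro sum.mono_neutral_right) auto
  also have "\<dots> = (\<Sum>v\<in>\<sigma>'. b' v)"
    using sub fin by (intro sum.mono_neutral_left) auto
  finally show ?thesis using b' sub by (auto simp: closed_simplex_def)
qed

text \<open>One point is chosen for each support occurring in \<open>C\<close>. A finite simplex has
  finitely many faces, so every subset of the chosen set \<open>D\<close> meets each closed simplex
  in finitely many points and is closed. Thus \<open>D\<close> is a closed discrete subset of a
  compact set, hence finite, and finitely many supports are caught by finitely many
  simplices.\<close>

lemma compactin_realization_finite_simplices:
  assumes C: "compactin (realization K) C" and K: "\<And>\<sigma>. \<sigma> \<in> K \<Longrightarrow> finite \<sigma>"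
  obtains T where "finite T" "T \<subseteq> K" "C \<subseteq> (\<Union>\<sigma>\<in>T. closed_simplex \<sigma>)"
proof -
  define supp where "supp b = {v. b v \<noteq> (0::real)}" for b :: "'a \<Rightarrow> real"
  have CK: "C \<subseteq> (\<Union>\<sigma>\<in>K. closed_simplex \<sigma>)"
    using compactin_subset_topspace[OF C] by (simp add: topspace_realization)
  define D where "D = (\<lambda>s. SOME b. b \<in> C \<and> supp b = s) ` (supp ` C)"
  have D: "D \<subseteq> C" "inj_on supp D" "supp ` D = supp ` C"
  proof -
    have *: "(SOME b. b \<in> C \<and> supp b = s) \<in> C \<and> supp (SOME b. b \<in> C \<and> supp b = s) = s"
      if "s \<in> supp ` C" for s
      using that by (intro someI_ex[of "\<lambda>b. b \<in> C \<and> supp b = s"]) auto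
    show "D \<subseteq> C" using * by (auto simp: D_def)
    show "inj_on supp D"
    proof (rule inj_onI)
      fix x y assume "x \<in> D" "y \<in> D" "supp x = supp y"
      then show "x = y" using * by (auto simp: D_def)
    qed
    have "(\<lambda>s. supp (SOME b. b \<in> C \<and> supp b = s)) ` (supp ` C) = (\<lambda>s. s) ` (supp ` C)"
      using * by (intro image_cong) auto
    then show "supp ` D = supp ` C" by (simp add: D_def image_image)
  qed
  have clo: "closedin (realization K) E" if "E \<subseteq> D" for E
  proof (rule closedin_realizationI)
    show "E \<subseteq> topspace (realization K)" using that D CK by (auto simp: topspace_realization)
    fix \<sigma> assume \<sigma>: "\<sigma> \<in> K"
    have "supp ` (E \<inter> closed_simplex \<sigma>) \<subseteq> Pow \<sigma>"
      using closed_simplex_supportD by (auto simp: supp_def)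
    then have "finite (supp ` (E \<inter> closed_simplex \<sigma>))"
      using K[OF \<sigma>] by (meson finite_Pow_iff finite_subset)
    moreover have "inj_on supp (E \<inter> closed_simplex \<sigma>)"
      using D(2) that by (meson inf.coboundedI1 inj_on_subset)
    ultimately have "finite (E \<inter> closed_simplex \<sigma>)" by (rule finite_imageD)
    moreover have "Hausdorff_space (powertop_real (UNIV :: 'a set))"
      by (simp add: Hausdorff_space_product_topology)
    ultimately show "closedin (powertop_real UNIV) (E \<inter> closed_simplex \<sigma>)"
      by (intro closedin_Hausdorff_finite) auto
  qed
  have "finite D"
  proof (cases "D = {}")
    case False
    \<comment> \<open>Each of these open sets contains exactly one point of \<open>D\<close>, so a
      finite subfamily covering \<open>C\<close> leaves only finitely many points in
      \<open>D\<close>.\<close>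
    define \<O> where "\<O> = (\<lambda>d. topspace (realization K) - (D - {d})) ` D"
    have "\<forall>W\<in>\<O>. openin (realization K) W"
      using clo by (auto simp: \<O>_def)
    moreover have "C \<subseteq> \<Union>\<O>"
      using False CK by (auto simp: \<O>_def topspace_realization)
    ultimately have "\<exists>\<F>. finite \<F> \<and> \<F> \<subseteq> \<O> \<and> C \<subseteq> \<Union>\<F>"
      using C unfolding compactin_def by simp
    then obtain \<F> where F: "finite \<F>" "\<F> \<subseteq> \<O>" "C \<subseteq> \<Union>\<F>" by blast
    obtain D' where D': "finite D'" "D' \<subseteq> D" "\<F> = (\<lambda>d. topspace (realization K) - (D - {d})) ` D'"
      using finite_subset_image[OF F(1) F(2)[unfolded \<O>_def]] by auto
    have "D \<subseteq> D'"
    proof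
      fix d assume "d \<in> D"
      then have "d \<in> \<Union>\<F>" using D(1) F(3) by auto
      then obtain e where "e \<in> D'" "d \<in> topspace (realization K) - (D - {e})" unfolding D'(3)
          by blast
      then show "d \<in> D'" using \<open>d \<in> D\<close> by auto
    qed
    then show ?thesis using D'(1) finite_subset by auto
  qed auto
  moreover have "\<forall>d\<in>D. \<exists>\<sigma>\<in>K. d \<in> closed_simplex \<sigma>" using CK D(1) by auto
  then obtain \<tau> where \<tau>: "\<forall>d\<in>D. \<tau> d \<in> K \<and> d \<in> closed_simplex (\<tau> d)" by metis
  show thesis
  proof (rule that[of "\<tau> ` D"])
    show "finite (\<tau> ` D)" "\<tau> ` D \<subseteq> K" using \<open>finite D\<close> \<tau> by auto
    show "C \<subseteq> (\<Union>\<sigma>\<in>\<tau> ` D. closed_simplex \<sigma>)"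
    proof
      fix b assume b: "b \<in> C"
      then obtain \<sigma> where \<sigma>: "\<sigma> \<in> K" "b \<in> closed_simplex \<sigma>" using CK by auto
      have "supp b \<in> supp ` D" using b D(3) by auto
      then obtain d where d: "d \<in> D" "supp d = supp b" by auto
      then have "b \<in> closed_simplex (\<tau> d)"
        using closed_simplex_same_support[of d "\<tau> d" b \<sigma>] \<tau> \<sigma> K by (auto simp: supp_def)
      then show "b \<in> (\<Union>\<sigma>\<in>\<tau> ` D. closed_simplex \<sigma>)" using d by auto
    qed
  qed
qed

lemma nerve_finite: "\<sigma> \<in> nerve \<U> \<Longrightarrow> finite \<sigma>"
  by (simp add: nerve_def)

text \<open>The values of the partition of unity at a point serve as its barycentric coordinates.
  The members with nonzero value all contain the point, so they span a simplex of the nerve; near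
  any point only finitely many members, hence finitely many simplices, occur. The value 1 at
  \<open>U0\<close> leaves 0 for the other coordinates of the image of \<open>x0\<close>.\<close>

lemma canonical_map_exists:
  assumes x0: "x0 \<in> topspace X" and i: "i \<in> pointed_covers X x0"
  shows "\<exists>p. canonical_map X x0 i p"
proof -
  obtain \<U> U0 \<phi> where iU: "i = (\<U>, U0)" and oc: "open_cover X \<U>" and U0: "U0 \<in> \<U>" "x0 \<in> U0"
    and \<phi>: "subordinated_partition_of_unity X \<U> \<phi>" and \<phi>1: "\<phi> U0 x0 = 1"
    using i by (auto simp: pointed_covers_def)
  have \<phi>c: "continuous_map X euclideanreal (\<phi> U)" and \<phi>01: "\<And>x. x \<in> topspace X \<Longrightarrow>
      0 \<le> \<phi> U x \<and> \<phi> U x \<le> 1"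
    and \<phi>s: "support_in X (\<phi> U) \<subseteq> U" if "U \<in> \<U>" for U
  proof -
    have "continuous_map X (top_of_set {0..1}) (\<phi> U)" "support_in X (\<phi> U) \<subseteq> U"
      using \<phi> that unfolding subordinated_partition_of_unity_def by auto
    then show "continuous_map X euclideanreal (\<phi> U)" "support_in X (\<phi> U) \<subseteq> U"
      "\<And>x. x \<in> topspace X \<Longrightarrow> 0 \<le> \<phi> U x \<and> \<phi> U x \<le> 1"
      by (auto simp: continuous_map_in_subtopology Pi_iff)
  qed
  have sup: "x \<in> support_in X (\<phi> U)" if "x \<in> topspace X" "\<phi> U x \<noteq> 0" for x U
  proof -
    have "{x \<in> topspace X. \<phi> U x \<noteq> 0} \<subseteq> support_in X (\<phi> U)"
      unfolding support_in_def by (rule closure_of_subset) auto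
    then show ?thesis using that by auto
  qed
  define S where "S x = {U\<in>\<U>. \<phi> U x \<noteq> 0}" for x
  define p where "p x = (\<lambda>U. if U \<in> \<U> then \<phi> U x else 0)" for x
  have "\<forall>x\<in>topspace X. \<exists>W. openin X W \<and> x \<in> W \<and> finite {U\<in>\<U>. support_in X (\<phi> U) \<inter> W \<noteq> {}}"
    using \<phi> by (simp add: subordinated_partition_of_unity_def)
  then obtain W where W: "\<forall>x\<in>topspace X. openin X (W x) \<and> x \<in> W x \<and>
      finite {U\<in>\<U>. support_in X (\<phi> U) \<inter> W x \<noteq> {}}"
    by (rule bchoice[elim_format]) blast
  define F where "F x = {U\<in>\<U>. support_in X (\<phi> U) \<inter> W x \<noteq> {}}" for x
  have SF: "S y \<subseteq> F x" if "x \<in> topspace X" "y \<in> W x" for x y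
  proof -
    have "y \<in> topspace X" using that W openin_subset by blast
    then show ?thesis using sup that by (auto simp: S_def F_def)
  qed
  have Sfin: "finite (S x)" and sum1: "(\<Sum>U\<in>S x. \<phi> U x) = 1" and Snerve: "S x \<in> nerve \<U>"
    and pS: "p x \<in> closed_simplex (S x)" if x: "x \<in> topspace X" for x
  proof -
    show fin: "finite (S x)" using SF[OF x] W x by (metis F_def finite_subset)
    show 1: "(\<Sum>U\<in>S x. \<phi> U x) = 1"
      using \<phi> x by (simp add: S_def subordinated_partition_of_unity_def)
    then have "S x \<noteq> {}" by auto
    moreover have "x \<in> \<Inter>(S x)" using \<phi>s sup x by (auto simp: S_def)
    ultimately show "S x \<in> nerve \<U>" using fin by (auto simp: nerve_def S_def)
    have "(\<Sum>U\<in>S x. p x U) = 1" using 1 by (simp add: p_def S_def)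
    then show "p x \<in> closed_simplex (S x)"
      using \<phi>01 x by (auto simp: closed_simplex_def p_def S_def)
  qed
  have pc: "continuous_map X (powertop_real UNIV) p"
    unfolding continuous_map_componentwise_UNIV
  proof
    fix U show "continuous_map X euclideanreal (\<lambda>x. p x U)"
      using \<phi>c by (cases "U \<in> \<U>") (auto simp: p_def)
  qed
  have cont: "continuous_map X (realization (nerve \<U>)) p"
  proof (rule pasting_lemma[where I = "topspace X" and T = W and f = "\<lambda>_. p"])
    fix x assume x: "x \<in> topspace X"
    show "continuous_map (subtopology X (W x)) (realization (nerve \<U>)) p"
    proof (rule continuous_map_into_realization[where T = "nerve \<U> \<inter> Pow (F x)"])
      show "continuous_map (subtopology X (W x)) (powertop_real UNIV) p"
        using pc by (rule continuous_map_from_subtopology)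
      show "finite (nerve \<U> \<inter> Pow (F x))" using W x by (simp add: F_def)
      show "p ` topspace (subtopology X (W x)) \<subseteq> \<Union> (closed_simplex ` (nerve \<U> \<inter> Pow (F x)))"
      proof
        fix b assume "b \<in> p ` topspace (subtopology X (W x))"
        then obtain y where "y \<in> topspace X" "y \<in> W x" "b = p y" by auto
        then show "b \<in> \<Union> (closed_simplex ` (nerve \<U> \<inter> Pow (F x)))"
          using pS[of y] Snerve[of y] SF[OF x, of y] by auto
      qed
    qed (auto dest: nerve_finite)
  next
    fix x assume "x \<in> topspace X"
    then show "\<exists>j. j \<in> topspace X \<and> x \<in> W j \<and> p x = p x" using W by blast
  qed (use W in auto)
  have "p x0 = vertex U0"
  proof -
    have U0S: "U0 \<in> S x0" using U0 \<phi>1 by (simp add: S_def)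
    have nn: "0 \<le> \<phi> U x0" if "U \<in> S x0 - {U0}" for U using \<phi>01[OF _ x0] that by (auto simp: S_def)
    have "(\<Sum>U\<in>S x0 - {U0}. \<phi> U x0) = 0"
      using sum1[OF x0] \<phi>1 by (simp add: sum.remove[OF Sfin[OF x0] U0S])
    then have "\<forall>U\<in>S x0 - {U0}. \<phi> U x0 = 0"
      using nn Sfin[OF x0] by (subst (asm) sum_nonneg_eq_0_iff) auto
    then show ?thesis using U0 \<phi>1 by (auto simp: p_def vertex_def S_def fun_eq_iff)
  qed
  moreover have "{x \<in> topspace X. p x \<in> open_star (nerve \<U>) U} \<subseteq> U" if "U \<in> \<U>" for U
  proof
    fix x assume "x \<in> {x \<in> topspace X. p x \<in> open_star (nerve \<U>) U}"
    then have "x \<in> topspace X" "\<phi> U x \<noteq> 0" using that by (auto simp: open_star_def p_def)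
    then show "x \<in> U" using sup \<phi>s that by blast
  qed
  ultimately have "canonical_map X x0 i p" using cont by (simp add: canonical_map_def iU)
  then show ?thesis by blast
qed

lemma open_star_cover:
  assumes "b \<in> topspace (realization (nerve \<U>))"
  obtains U where "U \<in> \<U>" "b \<in> open_star (nerve \<U>) U"
proof -
  obtain \<sigma> where \<sigma>: "\<sigma> \<in> nerve \<U>" "b \<in> closed_simplex \<sigma>" using assms
      by (auto simp: topspace_realization)
  have "\<exists>U\<in>\<sigma>. b U > 0"
  proof (rule ccontr)
    assume "\<not> (\<exists>U\<in>\<sigma>. b U > 0)"
    moreover have "0 \<le> b U" for U using \<sigma>(2) by (simp add: closed_simplex_def)
    ultimately have "\<forall>U\<in>\<sigma>. b U = 0" by (meson order_antisym_conv not_less)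
    then show False using \<sigma>(2) by (simp add: closed_simplex_def)
  qed
  then show thesis using that assms \<sigma>(1) by (auto simp: open_star_def nerve_def)
qed

text \<open>All vertices whose open stars contain b belong to one simplex of the nerve, and such a
  simplex is a family with a common point. Applied to the value of the null-homotopy at a grid
  vertex, this yields a point lying in all the labels around that vertex.\<close>

lemma open_stars_Inter_nonempty:
  assumes "b \<in> topspace (realization (nerve \<U>))"
  obtains x where "\<And>U. b \<in> open_star (nerve \<U>) U \<Longrightarrow> x \<in> U" "\<exists>U\<in>\<U>. x \<in> U"
proof -
  obtain \<sigma> where \<sigma>: "\<sigma> \<in> nerve \<U>" "b \<in> closed_simplex \<sigma>" using assms
      by (auto simp: topspace_realization)
  then obtain x where x: "x \<in> \<Inter>\<sigma>" by (auto simp: nerve_def)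
  have "U \<in> \<sigma>" if "b \<in> open_star (nerve \<U>) U" for U
    using closed_simplex_supportD[OF \<sigma>(2)] that by (auto simp: open_star_def)
  moreover have "\<sigma> \<subseteq> \<U>" "\<sigma> \<noteq> {}" using \<sigma>(1) by (auto simp: nerve_def)
  ultimately show thesis using that[of x] x by blast
qed

text \<open>Where the null-homotopy is constant at the base vertex, this pins down the label. A
  non-empty \<open>U\<close> is a vertex of the nerve.\<close>

lemma vertex_in_open_star_iff:
  assumes "U \<in> \<U>" "U \<noteq> {}"
  shows "vertex U \<in> open_star (nerve \<U>) V \<longleftrightarrow> V = U"
proof -
  have "vertex U \<in> closed_simplex {U}" "{U} \<in> nerve \<U>"
    using assms by (auto simp: vertex_def closed_simplex_def nerve_def)
  then show ?thesis by (auto simp: open_star_def topspace_realization vertex_def)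
qed

text \<open>The segment from \<open>f z\<close> to the vertex stays in any closed simplex containing
  \<open>f z\<close>, because v is one of its vertices. Compactness of \<open>Z\<close> confines the
  image to finitely many simplices, and there joint continuity can be read off the
  coordinates.\<close>

lemma open_star_contraction:
  assumes Z: "compact_space Z" and f: "continuous_map Z (realization K) f"
    and st: "\<And>z. z \<in> topspace Z \<Longrightarrow> f z \<in> open_star K v" and K: "\<And>\<sigma>. \<sigma> \<in> K \<Longrightarrow> finite \<sigma>"
  shows "continuous_map (prod_topology (top_of_set {0..1}) Z) (realization K)
     (\<lambda>(s, z) w. (1 - s) * f z w + s * vertex v w)"
proof -
  have "compactin (realization K) (f ` topspace Z)"
    using Z f image_compactin compact_space_def by blast
  then obtain T where T: "finite T" "T \<subseteq> K" "f ` topspace Z \<subseteq> (\<Union>\<sigma>\<in>T. closed_simplex \<sigma>)"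
    using compactin_realization_finite_simplices K by metis
  have fc: "continuous_map Z euclideanreal (\<lambda>z. f z w)" for w
    using continuous_map_compose[OF f continuous_map_realization_coordinates]
    by (simp add: o_def continuous_map_componentwise_UNIV)
  have fc': "continuous_map (prod_topology (top_of_set {0..1::real}) Z) euclideanreal (\<lambda>z. f (snd
      z) w)" for w
    using continuous_map_compose[OF continuous_map_snd fc] by (simp add: o_def)
  have sc: "continuous_map (prod_topology (top_of_set {0..1::real}) Z) euclideanreal fst"
    using continuous_map_fst[of "top_of_set {0..1::real}" Z]
        by (simp add: continuous_map_in_subtopology)
  show ?thesis
  proof (rule continuous_map_into_realization[OF _ T(1,2)])
    show "continuous_map (prod_topology (top_of_set {0..1}) Z) (powertop_real UNIV)
       (\<lambda>(s, z) w. (1 - s) * f z w + s * vertex v w)"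
      unfolding continuous_map_componentwise_UNIV case_prod_unfold
      by (intro allI continuous_intros fc' sc) auto
    show "finite \<sigma>" if "\<sigma> \<in> T" for \<sigma> using that T K by auto
    show "(\<lambda>(s, z) w. (1 - s) * f z w + s * vertex v w) ` topspace (prod_topology (top_of_set
        {0..1}) Z)
      \<subseteq> \<Union> (closed_simplex ` T)"
    proof clarsimp
      fix s :: real and z assume s: "0 \<le> s" "s \<le> 1" and z: "z \<in> topspace Z"
      then obtain \<sigma> where \<sigma>: "\<sigma> \<in> T" "f z \<in> closed_simplex \<sigma>" using T by auto
      have fin: "finite \<sigma>" using \<sigma>(1) T K by auto
      have v: "v \<in> \<sigma>" using closed_simplex_supportD[OF \<sigma>(2)] st[OF z] by (auto simp: open_star_def)
      have "(\<Sum>w\<in>\<sigma>. (1 - s) * f z w + s * vertex v w) =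
          (1 - s) * (\<Sum>w\<in>\<sigma>. f z w) + s * (\<Sum>w\<in>\<sigma>. vertex v w)"
        by (simp add: sum.distrib sum_distrib_left)
      also have "\<dots> = 1" using \<sigma>(2) v fin by (simp add: closed_simplex_def vertex_def)
      finally have "(\<lambda>w. (1 - s) * f z w + s * vertex v w) \<in> closed_simplex \<sigma>"
        using \<sigma>(2) s v by (auto simp: closed_simplex_def vertex_def)
      then show "\<exists>\<sigma>\<in>T. (\<lambda>w. (1 - s) * f z w + s * vertex v w) \<in> closed_simplex \<sigma>"
        using \<sigma>(1) by blast
    qed
  qed
qed

section \<open>Continuity of coordinate formulas and of maps glued along an inequality\<close>

lemma continuous_on_coordinate [continuous_intros]: "continuous_on S (\<lambda>t. t i)"
  for S :: "('i \<Rightarrow> 'b::topological_space) set"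
  using continuous_on_subset[OF continuous_on_product_coordinates subset_UNIV] .

lemma continuous_on_If_const [continuous_intros]:
  "continuous_on S f \<Longrightarrow> continuous_on S g \<Longrightarrow> continuous_on S (\<lambda>x. if P then f x else g x)"
  by (cases P) auto

lemma continuous_on_snd_coordinate [continuous_intros]: "continuous_on S (\<lambda>p. snd p i)"
  for S :: "('a::topological_space \<times> ('i \<Rightarrow> 'b::topological_space)) set"
  using continuous_on_snd[OF continuous_on_id] by (rule continuous_on_product_then_coordinatewise)

lemma continuous_on_fun_upd [continuous_intros]:
  fixes f :: "'a::topological_space \<Rightarrow> 'i \<Rightarrow> 'b::topological_space"
  assumes "continuous_on S f" "continuous_on S a"
  shows "continuous_on S (\<lambda>x. (f x)(i := a x))"
  unfolding fun_upd_def using assms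
  by (intro continuous_on_coordinatewise_then_product continuous_on_If_const)
    (auto intro: continuous_on_product_then_coordinatewise)

lemma continuous_map_top_of_set_compose:
  assumes "continuous_map (top_of_set T) X f" "continuous_on S p" "p ` S \<subseteq> T"
  shows "continuous_map (top_of_set S) X (\<lambda>x. f (p x))"
proof -
  have "continuous_map (top_of_set S) (top_of_set T) p"
    using assms(2,3) by (auto simp: continuous_map_in_subtopology continuous_map_iff_continuous)
  from continuous_map_compose[OF this assms(1)] show ?thesis by (simp add: o_def)
qed

lemma continuous_map_top_of_set_If_le:
  fixes u v :: "'a::topological_space \<Rightarrow> real"
  assumes f: "continuous_map (top_of_set {x \<in> S. u x \<le> v x}) X f"
    and g: "continuous_map (top_of_set {x \<in> S. v x \<le> u x}) X g"
    and u: "continuous_on S u" and v: "continuous_on S v"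
    and eq: "\<And>x. x \<in> S \<Longrightarrow> u x = v x \<Longrightarrow> f x = g x"
  shows "continuous_map (top_of_set S) X (\<lambda>x. if u x \<le> v x then f x else g x)"
proof (rule continuous_map_cases_le)
  show "continuous_map (top_of_set S) euclideanreal u" "continuous_map (top_of_set S)
      euclideanreal v"
    using u v by (simp_all add: continuous_map_iff_continuous)
  have "S \<inter> {x \<in> S. u x \<le> v x} = {x \<in> S. u x \<le> v x}" "S \<inter> {x \<in> S. v x \<le> u x} = {x \<in> S. v x \<le> u x}"
    by auto
  then show "continuous_map (subtopology (top_of_set S) {x \<in> topspace (top_of_set S). u x \<le>
      v x}) X f"
    "continuous_map (subtopology (top_of_set S) {x \<in> topspace (top_of_set S). v x \<le> u x}) X g"
    using f g by (simp_all add: subtopology_subtopology)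
qed (use eq in auto)

section \<open>Spheroids\<close>

definition cube :: "nat \<Rightarrow> (nat \<Rightarrow> real) set" where
  "cube n = {t. (\<forall>i<n. 0 \<le> t i \<and> t i \<le> 1) \<and> (\<forall>i\<ge>n. t i = 0)}"

lemma cube_space_eq: "cube_space n = top_of_set (cube n)"
proof -
  have "{t. \<forall>i\<ge>n. t i = 0} \<inter> {t. \<forall>i<n. 0 \<le> t i \<and> t i \<le> 1} = cube n"
    by (auto simp: cube_def)
  then show ?thesis
    by (simp add: cube_space_def Euclidean_space_def subtopology_subtopology
        euclidean_product_topology)
qed

lemma cube_boundary_eq: "cube_boundary n = {t \<in> cube n. \<exists>i<n. t i = 0 \<or> t i = 1}"
  by (simp add: cube_boundary_def cube_space_eq)

lemma cube_boundary_subset: "cube_boundary n \<subseteq> cube n"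
  by (auto simp: cube_boundary_eq)

lemma spheroids_iff:
  "f \<in> spheroids n X x \<longleftrightarrow> continuous_map (top_of_set (cube n)) X f \<and> (\<forall>t\<in>cube_boundary n. f t = x)"
  by (simp add: spheroids_def cube_space_eq)

lemma sph_homotopicI:
  assumes h: "continuous_map (top_of_set ({0..1::real} \<times> cube n)) X h"
    and "\<And>t. t \<in> cube n \<Longrightarrow> h (0, t) = f t" "\<And>t. t \<in> cube n \<Longrightarrow> h (1, t) = g t"
    and "\<And>s t. 0 \<le> s \<Longrightarrow> s \<le> 1 \<Longrightarrow> t \<in> cube_boundary n \<Longrightarrow> h (s, t) = x"
  shows "(f, g) \<in> sph_homotopic n X x"
proof -
  have "homotopic_with (\<lambda>h. \<forall>t\<in>cube_boundary n. h t = x) (top_of_set (cube n)) X f g"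
  proof (subst homotopic_with)
    show "\<exists>h. continuous_map (prod_topology (top_of_set {0..1::real}) (top_of_set (cube n))) X h \<and>
      (\<forall>x\<in>topspace (top_of_set (cube n)). h (0, x) = f x) \<and>
      (\<forall>x\<in>topspace (top_of_set (cube n)). h (1, x) = g x) \<and>
      (\<forall>t\<in>{0..1::real}. \<forall>ta\<in>cube_boundary n. h (t, ta) = x)"
      using assms by (intro exI[of _ h]) auto
    show "(\<forall>t\<in>cube_boundary n. h t = x) = (\<forall>t\<in>cube_boundary n. k t = x)"
      if "\<And>x. x \<in> topspace (top_of_set (cube n)) \<Longrightarrow> h x = k x" for h k
      using that cube_boundary_subset[of n] by (metis subsetD topspace_euclidean_subtopology)
  qed
  then show ?thesis by (simp add: sph_homotopic_def cube_space_eq)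
qed

lemma sph_homotopicD:
  assumes "(f, g) \<in> sph_homotopic n X x"
  shows "\<exists>h. continuous_map (top_of_set ({0..1::real} \<times> cube n)) X h \<and>
    (\<forall>t. h (0, t) = f t) \<and> (\<forall>t. h (1, t) = g t) \<and>
        (\<forall>s\<in>{0..1::real}. \<forall>t\<in>cube_boundary n. h (s, t) = x)"
  using assms by (simp add: sph_homotopic_def cube_space_eq homotopic_with_def)

lemma sph_homotopic_spheroids:
  assumes "(f, g) \<in> sph_homotopic n X x" shows "f \<in> spheroids n X x" "g \<in> spheroids n X x"
  using equiv_sph_homotopic[of n X x] assms by (auto simp: equiv_def)

lemma sph_homotopic_trans:
  "(f, g) \<in> sph_homotopic n X x \<Longrightarrow> (g, h) \<in> sph_homotopic n X x \<Longrightarrow> (f, h) \<in> sph_homotopic n X x"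
  using equiv_sph_homotopic[of n X x] by (auto simp: equiv_def dest: transD)

lemma sph_homotopic_eq_on_cube:
  assumes f: "f \<in> spheroids n X x" and eq: "\<And>t. t \<in> cube n \<Longrightarrow> f t = g t"
  shows "(f, g) \<in> sph_homotopic n X x"
proof (rule sph_homotopicI[where h = "\<lambda>p. f (snd p)"])
  show "continuous_map (top_of_set ({0..1::real} \<times> cube n)) X (\<lambda>p. f (snd p))"
    using f by (intro continuous_map_top_of_set_compose[of "cube n" X f _ snd])
      (auto simp: spheroids_iff intro!: continuous_intros)
qed (use eq f in \<open>auto simp: spheroids_iff\<close>)

lemma sph_class_eq_iff:
  assumes "f \<in> spheroids n X x" "g \<in> spheroids n X x"
  shows "sph_class n X x f = sph_class n X x g \<longleftrightarrow> (f, g) \<in> sph_homotopic n X x"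
  using eq_equiv_class_iff[OF equiv_sph_homotopic assms] by (simp add: sph_class_def)

lemma sph_class_eqI:
  assumes "(f, g) \<in> sph_homotopic n X x"
  shows "sph_class n X x f = sph_class n X x g"
  using sph_class_eq_iff[of f n X x g] sph_homotopic_spheroids[OF assms] assms by simp

definition clamp :: "nat \<Rightarrow> (nat \<Rightarrow> real) \<Rightarrow> nat \<Rightarrow> real" where
  "clamp n t = (\<lambda>i. if i < n then max 0 (min 1 (t i)) else 0)"

lemma clamp_in_cube: "clamp n t \<in> cube n"
  by (auto simp: clamp_def cube_def)

lemma clamp_id: "t \<in> cube n \<Longrightarrow> clamp n t = t"
  by (auto simp: clamp_def cube_def fun_eq_iff not_less)

lemma clamp_boundary: "i < n \<Longrightarrow> t i \<le> 0 \<or> 1 \<le> t i \<Longrightarrow> clamp n t \<in> cube_boundary n"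
  using clamp_in_cube[of n t] by (auto simp: cube_boundary_eq clamp_def intro!: exI[of _ i])

lemma continuous_on_clamp: "continuous_on S (clamp n)"
  unfolding clamp_def
proof (intro continuous_on_coordinatewise_then_product)
  fix i show "continuous_on S (\<lambda>t. if i < n then max 0 (min 1 (t i)) else (0::real))"
    by (cases "i < n") (auto intro!: continuous_intros)
qed

text \<open>Composition with \<open>clamp\<close> extends a spheroid to all of space, with the base point as value off
  the open cube. Homotopies of spheroids then reduce to straight-line homotopies of maps into
  \<open>\<real>\<^sup>n\<close>, subject only to a condition on \<open>\<partial>I\<^sup>n\<close>.\<close>

lemma spheroid_clamp_continuous:
  "f \<in> spheroids n X x \<Longrightarrow> continuous_map euclidean X (\<lambda>t. f (clamp n t))"
  using continuous_map_top_of_set_compose[of "cube n" X f UNIV "clamp n"]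
  by (simp add: spheroids_iff clamp_in_cube continuous_on_clamp image_subset_iff)

lemma spheroid_clamp_base:
  "f \<in> spheroids n X x \<Longrightarrow> i < n \<Longrightarrow> t i \<le> 0 \<or> 1 \<le> t i \<Longrightarrow> f (clamp n t) = x"
  using clamp_boundary by (auto simp: spheroids_iff)

text \<open>After \<open>clamp\<close>, a single coordinate outside the open unit interval is enough
  to give the base point. So P and Q may leave the cube, and at each boundary point only one
  coordinate of the segment has to be watched.\<close>

lemma sph_homotopic_straight_line:
  assumes f: "f \<in> spheroids n X x" and P: "continuous_on (cube n) P"
      and Q: "continuous_on (cube n) Q"
    and bd: "\<And>s t. 0 \<le> s \<Longrightarrow> s \<le> 1 \<Longrightarrow> t \<in> cube_boundary n \<Longrightarrow>
      \<exists>i<n. (1 - s) * P t i + s * Q t i \<le> 0 \<or> 1 \<le> (1 - s) * P t i + s * Q t i"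
    and g: "\<And>t. t \<in> cube n \<Longrightarrow> g t = f (clamp n (P t))"
    and h: "\<And>t. t \<in> cube n \<Longrightarrow> h t = f (clamp n (Q t))"
  shows "(g, h) \<in> sph_homotopic n X x"
proof (rule sph_homotopicI[where h = "\<lambda>p. f (clamp n (\<lambda>i. (1 - fst p) * P (snd p) i + fst p * Q
    (snd p) i))"])
  have c: "continuous_on ({0..1::real} \<times> cube n) (\<lambda>p. R (snd p) i)" if "continuous_on (cube n) R"
      for R :: "_ \<Rightarrow> nat \<Rightarrow> real" and i
    using that by (intro continuous_on_compose2[OF continuous_on_product_then_coordinatewise[OF
        that]])
      (auto intro!: continuous_intros)
  have "continuous_on ({0..1::real} \<times> cube n) (\<lambda>p i. (1 - fst p) * P (snd p) i + fst p * Q (snd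
      p) i)"
    by (intro continuous_intros c P Q)
  from continuous_map_top_of_set_compose[OF _ this, of UNIV X "\<lambda>t. f (clamp n t)"]
  show "continuous_map (top_of_set ({0..1::real} \<times> cube n)) X
      (\<lambda>p. f (clamp n (\<lambda>i. (1 - fst p) * P (snd p) i + fst p * Q (snd p) i)))"
    using spheroid_clamp_continuous[OF f] by simp
next
  fix s t assume "0 \<le> s" "s \<le> (1::real)" "t \<in> cube_boundary n"
  then obtain i where "i < n" "(1 - s) * P t i + s * Q t i \<le> 0 \<or> 1 \<le> (1 - s) * P t i + s * Q t i"
    using bd by meson
  then show "f (clamp n (\<lambda>i. (1 - fst (s, t)) * P (snd (s, t)) i + fst (s, t) * Q (snd (s, t))
      i)) = x"
    by (intro spheroid_clamp_base[OF f]) auto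
qed (use g h in auto)

section \<open>The group structure\<close>

lemma cube_upd: "t \<in> cube n \<Longrightarrow> 0 \<le> a \<Longrightarrow> a \<le> 1 \<Longrightarrow> 0 < n \<Longrightarrow> t(0 := a) \<in> cube n"
  by (auto simp: cube_def)

lemma cube_boundary_upd:
  assumes t: "t \<in> cube_boundary n" and a: "0 \<le> a" "a \<le> 1" and n: "0 < n"
    and "t 0 = 0 \<Longrightarrow> a = 0 \<or> a = 1" "t 0 = 1 \<Longrightarrow> a = 0 \<or> a = 1"
  shows "t(0 := a) \<in> cube_boundary n"
proof -
  obtain i where "i < n" "t i = 0 \<or> t i = 1" "t \<in> cube n" using t by (auto simp: cube_boundary_eq)
  then show ?thesis
    using assms cube_upd[of t n a] by (auto simp: cube_boundary_eq intro!: exI[of _ i])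
qed

lemma sph_concat_homotopic:
  assumes n: "n \<ge> 1" and f: "(f, f') \<in> sph_homotopic n X x" and g: "(g, g') \<in> sph_homotopic n X x"
  shows "(sph_concat f g, sph_concat f' g') \<in> sph_homotopic n X x"
proof -
  obtain F where F': "continuous_map (top_of_set ({0..1::real} \<times> cube n)) X F \<and>
    (\<forall>t. F (0, t) = f t) \<and> (\<forall>t. F (1, t) = f' t) \<and>
        (\<forall>s\<in>{0..1::real}. \<forall>t\<in>cube_boundary n. F (s, t) = x)"
    using sph_homotopicD[OF f] by meson
  then have F: "continuous_map (top_of_set ({0..1::real} \<times> cube n)) X F"
    "\<And>t. F (0, t) = f t" "\<And>t. F (1, t) = f' t"
    "\<And>s t. 0 \<le> s \<Longrightarrow> s \<le> 1 \<Longrightarrow> t \<in> cube_boundary n \<Longrightarrow> F (s, t) = x" by simp_all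
  obtain G where G': "continuous_map (top_of_set ({0..1::real} \<times> cube n)) X G \<and>
    (\<forall>t. G (0, t) = g t) \<and> (\<forall>t. G (1, t) = g' t) \<and>
        (\<forall>s\<in>{0..1::real}. \<forall>t\<in>cube_boundary n. G (s, t) = x)"
    using sph_homotopicD[OF g] by meson
  then have G: "continuous_map (top_of_set ({0..1::real} \<times> cube n)) X G"
    "\<And>t. G (0, t) = g t" "\<And>t. G (1, t) = g' t"
    "\<And>s t. 0 \<le> s \<Longrightarrow> s \<le> 1 \<Longrightarrow> t \<in> cube_boundary n \<Longrightarrow> G (s, t) = x" by simp_all
  let ?H = "\<lambda>p. if snd p 0 \<le> 1/2 then F (fst p, (snd p)(0 := 2 * snd p 0))
                  else G (fst p, (snd p)(0 := 2 * snd p 0 - 1))"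
  show ?thesis
  proof (rule sph_homotopicI[where h = ?H])
    show "continuous_map (top_of_set ({0..1::real} \<times> cube n)) X ?H"
    proof (rule continuous_map_top_of_set_If_le)
      show "continuous_map (top_of_set {p \<in> {0..1::real} \<times> cube n. snd p 0 \<le> 1/2}) X
          (\<lambda>p. F (fst p, (snd p)(0 := 2 * snd p 0)))"
        by (rule continuous_map_top_of_set_compose[OF F(1)])
          (use n in \<open>auto intro!: continuous_intros cube_upd simp: cube_def\<close>)
      show "continuous_map (top_of_set {p \<in> {0..1::real} \<times> cube n. 1/2 \<le> snd p 0}) X
          (\<lambda>p. G (fst p, (snd p)(0 := 2 * snd p 0 - 1)))"
        by (rule continuous_map_top_of_set_compose[OF G(1)])
          (use n in \<open>auto intro!: continuous_intros cube_upd simp: cube_def\<close>)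
      fix p assume p: "p \<in> {0..1::real} \<times> cube n" "snd p 0 = 1/2"
      then have "(snd p)(0 := 1) \<in> cube_boundary n" "(snd p)(0 := 0) \<in> cube_boundary n"
        using n by (auto simp: cube_boundary_eq intro!: cube_upd exI[of _ 0])
      moreover have "2 * snd p 0 = 1" "2 * snd p 0 - 1 = 0" using p by auto
      moreover have "0 \<le> fst p" "fst p \<le> 1" using p by auto
      ultimately show "F (fst p, (snd p)(0 := 2 * snd p 0)) =
          G (fst p, (snd p)(0 := 2 * snd p 0 - 1))"
        using F(4) G(4) by simp
    qed (auto intro!: continuous_intros)
  next
    fix s :: real and t assume s: "0 \<le> s" "s \<le> 1" and t: "t \<in> cube_boundary n"
    have tc: "t \<in> cube n" "0 \<le> t 0" "t 0 \<le> 1" using t n by (auto simp: cube_boundary_eq cube_def)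
    show "?H (s, t) = x"
    proof (cases "t 0 \<le> 1/2")
      case True
      have "t(0 := 2 * t 0) \<in> cube_boundary n"
        using True t tc n by (intro cube_boundary_upd) auto
      then show ?thesis using True F(4) s by simp
    next
      case False
      have "t(0 := 2 * t 0 - 1) \<in> cube_boundary n"
        using False t tc n by (intro cube_boundary_upd) auto
      then show ?thesis using False G(4) s by simp
    qed
  qed (auto simp: sph_concat_def F G)
qed

lemma sph_homotopic_refl: "f \<in> spheroids n X x \<Longrightarrow> (f, f) \<in> sph_homotopic n X x"
  by (rule sph_homotopic_eq_on_cube) auto

lemma sph_concat_spheroids:
  assumes "n \<ge> 1" "f \<in> spheroids n X x" "g \<in> spheroids n X x"
  shows "sph_concat f g \<in> spheroids n X x"
  using sph_concat_homotopic[OF assms(1) sph_homotopic_refl[OF assms(2)] sph_homotopic_refl[OF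
      assms(3)]]
    by (rule sph_homotopic_spheroids)

lemma spheroid_const: "x \<in> topspace X \<Longrightarrow> (\<lambda>_. x) \<in> spheroids n X x"
  by (simp add: spheroids_iff)

lemma sph_class_in_carrier:
  "f \<in> spheroids n X x \<Longrightarrow> sph_class n X x f \<in> carrier (homotopy_group n X x)"
  by (simp add: homotopy_group_def sph_class_def quotientI)

lemma homotopy_group_carrierE:
  assumes "A \<in> carrier (homotopy_group n X x)"
  obtains f where "f \<in> spheroids n X x" "A = sph_class n X x f"
  using assms by (auto simp: homotopy_group_def sph_class_def quotient_def)

lemma one_homotopy_group: "\<one>\<^bsub>homotopy_group n X x\<^esub> = sph_class n X x (\<lambda>_. x)"
  by (simp add: homotopy_group_def)

lemma sph_class_self: "f \<in> spheroids n X x \<Longrightarrow> f \<in> sph_class n X x f"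
  by (simp add: sph_class_def sph_homotopic_refl)

lemma mult_homotopy_group:
  assumes n: "n \<ge> 1" and f: "f \<in> spheroids n X x" and g: "g \<in> spheroids n X x"
  shows "sph_class n X x f \<otimes>\<^bsub>homotopy_group n X x\<^esub> sph_class n X x g =
      sph_class n X x (sph_concat f g)"
proof -
  have "sph_class n X x (sph_concat f' g') = sph_class n X x (sph_concat f g)"
    if "f' \<in> sph_class n X x f" "g' \<in> sph_class n X x g" for f' g'
    using that sph_class_eqI[OF sph_concat_homotopic[OF n, of f f' X x g g']]
        by (simp add: sph_class_def)
  then have "(\<Union>f'\<in>sph_class n X x f. \<Union>g'\<in>sph_class n X x g. sph_class n X x (sph_concat f' g')) =
      (\<Union>f'\<in>sph_class n X x f. \<Union>g'\<in>sph_class n X x g. sph_class n X x (sph_concat f g))"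
    by (intro SUP_cong refl)
  moreover have "sph_class n X x f \<noteq> {}" "sph_class n X x g \<noteq> {}"
    using sph_class_self[OF f] sph_class_self[OF g] by blast+
  ultimately show ?thesis by (simp add: homotopy_group_def)
qed

definition sph_reverse :: "((nat \<Rightarrow> real) \<Rightarrow> 'a) \<Rightarrow> (nat \<Rightarrow> real) \<Rightarrow> 'a" where
  "sph_reverse f t = f (t(0 := 1 - t 0))"

lemma sph_reverse_spheroids:
  assumes n: "n \<ge> 1" and f: "f \<in> spheroids n X x"
  shows "sph_reverse f \<in> spheroids n X x"
  unfolding spheroids_iff
proof (intro conjI ballI)
  show "continuous_map (top_of_set (cube n)) X (sph_reverse f)"
    unfolding sph_reverse_def using f n
    by (intro continuous_map_top_of_set_compose[of "cube n" X f _ "\<lambda>t. t(0 := 1 - t 0)"])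
      (auto simp: spheroids_iff cube_def intro!: continuous_intros)
  fix t assume t: "t \<in> cube_boundary n"
  then have "0 \<le> t 0" "t 0 \<le> 1" using n by (auto simp: cube_boundary_eq cube_def)
  then have "t(0 := 1 - t 0) \<in> cube_boundary n"
    using t n by (intro cube_boundary_upd) auto
  then show "sph_reverse f t = x" using f by (simp add: sph_reverse_def spheroids_iff)
qed

lemma cube_boundaryE:
  assumes "t \<in> cube_boundary n"
  obtains i where "i < n" "t i = 0 \<or> t i = 1"
  using assms by (auto simp: cube_boundary_eq)

text \<open>The concatenation is f after the fold |2t - 1| in coordinate 0. The fold is pushed to
  the face where this coordinate is 1, on which f is constant.\<close>

lemma sph_concat_reverse:
  assumes n: "n \<ge> 1" and f: "f \<in> spheroids n X x"
  shows "(sph_concat (sph_reverse f) f, \<lambda>_. x) \<in> sph_homotopic n X x"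
proof (rule sph_homotopic_straight_line[OF f, where P = "\<lambda>t. t(0 := \<bar>2 * t 0 - 1\<bar>)"
    and Q = "\<lambda>t. t(0 := 1)"])
  fix s :: real and t assume "0 \<le> s" "s \<le> 1" "t \<in> cube_boundary n"
  then obtain i where "i < n" "t i = 0 \<or> t i = 1" by (auto elim: cube_boundaryE)
  then show "\<exists>i<n. (1 - s) * (t(0 := \<bar>2 * t 0 - 1\<bar>)) i + s * (t(0 := 1)) i \<le> 0 \<or>
      1 \<le> (1 - s) * (t(0 := \<bar>2 * t 0 - 1\<bar>)) i + s * (t(0 := 1)) i"
    by (intro exI[of _ i]) (auto simp: algebra_simps)
next
  fix t assume t: "t \<in> cube n"
  then have "0 \<le> t 0" "t 0 \<le> 1" using n by (auto simp: cube_def)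
  then have "clamp n (t(0 := \<bar>2 * t 0 - 1\<bar>)) = t(0 := \<bar>2 * t 0 - 1\<bar>)"
    using n t by (intro clamp_id cube_upd) auto
  then show "sph_concat (sph_reverse f) f t = f (clamp n (t(0 := \<bar>2 * t 0 - 1\<bar>)))"
    by (auto simp: sph_concat_def sph_reverse_def)
  show "x = f (clamp n (t(0 := 1)))"
    using spheroid_clamp_base[OF f, of 0 "t(0 := 1)"] n by simp
qed (auto intro!: continuous_intros)

text \<open>The constant half is absorbed by \<open>clamp\<close>: both halves are f after the one
  affine map 2t - 1 in coordinate 0, which is at most 0 on the first half.\<close>

lemma sph_concat_const_left:
  assumes n: "n \<ge> 1" and f: "f \<in> spheroids n X x"
  shows "(sph_concat (\<lambda>_. x) f, f) \<in> sph_homotopic n X x"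
proof (rule sph_homotopic_straight_line[OF f, where P = "\<lambda>t. t(0 := 2 * t 0 - 1)" and Q = "\<lambda>t. t"])
  fix s :: real and t assume s: "0 \<le> s" "s \<le> 1" "t \<in> cube_boundary n"
  then obtain i where i: "i < n" "t i = 0 \<or> t i = 1" by (auto elim: cube_boundaryE)
  then show "\<exists>i<n. (1 - s) * (t(0 := 2 * t 0 - 1)) i + s * t i \<le> 0 \<or>
      1 \<le> (1 - s) * (t(0 := 2 * t 0 - 1)) i + s * t i"
    using s by (intro exI[of _ i]) (auto simp: algebra_simps)
next
  fix t assume t: "t \<in> cube n"
  then have t0: "0 \<le> t 0" "t 0 \<le> 1" using n by (auto simp: cube_def)
  show "sph_concat (\<lambda>_. x) f t = f (clamp n (t(0 := 2 * t 0 - 1)))"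
  proof (cases "t 0 \<le> 1/2")
    case True
    then show ?thesis using spheroid_clamp_base[OF f, of 0 "t(0 := 2 * t 0 - 1)"] n
        by (simp add: sph_concat_def)
  next
    case False
    then have "clamp n (t(0 := 2 * t 0 - 1)) = t(0 := 2 * t 0 - 1)"
      using n t t0 by (intro clamp_id cube_upd) auto
    then show ?thesis using False by (simp add: sph_concat_def)
  qed
  show "f t = f (clamp n t)" using clamp_id[OF t] by simp
qed (auto intro!: continuous_intros)

lemma sph_concat_assoc:
  assumes n: "n \<ge> 1" and f: "f \<in> spheroids n X x" and g: "g \<in> spheroids n X x"
      and h: "h \<in> spheroids n X x"
  shows "(sph_concat (sph_concat f g) h, sph_concat f (sph_concat g h)) \<in> sph_homotopic n X x"
proof -
  \<comment> \<open>The reparametrisation relating the two bracketings has slopes 2, 1 and 1/2 on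
    [0, 1/4], [1/4, 1/2] and [1/2, 1]. Being concave, it is the minimum of its three affine
    pieces.\<close>
  define \<phi> where "\<phi> a = min (2 * a) (min (a + 1/4) ((a + 1) / 2))" for a :: real
  have \<phi>01: "0 \<le> \<phi> a" "\<phi> a \<le> 1" if "0 \<le> a" "a \<le> 1" for a using that
      by (auto simp: \<phi>_def min_le_iff_disj)
  have k: "sph_concat f (sph_concat g h) \<in> spheroids n X x"
    using n f g h by (intro sph_concat_spheroids)
  show ?thesis
  proof (rule sph_homotopic_straight_line[OF k, where P = "\<lambda>t. t(0 := \<phi> (t 0))" and Q = "\<lambda>t. t"])
    fix s :: real and t assume s: "0 \<le> s" "s \<le> 1" "t \<in> cube_boundary n"
    then obtain i where i: "i < n" "t i = 0 \<or> t i = 1" by (auto elim: cube_boundaryE)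
    have "\<phi> 0 = 0" "\<phi> 1 = 1" by (auto simp: \<phi>_def)
    with i show "\<exists>i<n. (1 - s) * (t(0 := \<phi> (t 0))) i + s * t i \<le> 0 \<or>
        1 \<le> (1 - s) * (t(0 := \<phi> (t 0))) i + s * t i"
      by (intro exI[of _ i]) (auto simp: algebra_simps)
  next
    fix t assume t: "t \<in> cube n"
    then have t0: "0 \<le> t 0" "t 0 \<le> 1" using n by (auto simp: cube_def)
    then have "clamp n (t(0 := \<phi> (t 0))) = t(0 := \<phi> (t 0))"
      using n t \<phi>01 by (intro clamp_id cube_upd) auto
    moreover have "sph_concat (sph_concat f g) h t =
        sph_concat f (sph_concat g h) (t(0 := \<phi> (t 0)))"
    proof -
      consider "t 0 \<le> 1/4" | "1/4 < t 0" "t 0 \<le> 1/2" | "1/2 < t 0" by linarith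
      then show ?thesis
      proof cases
        case 1
        then have "\<phi> (t 0) = 2 * t 0" by (auto simp: \<phi>_def)
        then show ?thesis using 1 by (simp add: sph_concat_def)
      next
        case 2
        then have "\<phi> (t 0) = t 0 + 1/4" by (auto simp: \<phi>_def)
        then show ?thesis using 2 by (simp add: sph_concat_def algebra_simps)
      next
        case 3
        then have "\<phi> (t 0) = (t 0 + 1) / 2" by (auto simp: \<phi>_def)
        then show ?thesis using 3 by (simp add: sph_concat_def field_simps)
      qed
    qed
    ultimately show "sph_concat (sph_concat f g) h t =
        sph_concat f (sph_concat g h) (clamp n (t(0 := \<phi> (t 0))))" by simp
    show "sph_concat f (sph_concat g h) t = sph_concat f (sph_concat g h) (clamp n t)"
      using clamp_id[OF t] by simp
  qed (auto intro!: continuous_intros simp: \<phi>_def)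
qed

lemma group_homotopy_group:
  assumes n: "n \<ge> 1" and x: "x \<in> topspace X"
  shows "group (homotopy_group n X x)"
proof (rule groupI)
  let ?G = "homotopy_group n X x"
  show "A \<otimes>\<^bsub>?G\<^esub> B \<in> carrier ?G" if A: "A \<in> carrier ?G" and B: "B \<in> carrier ?G" for A B
  proof -
    obtain f where f: "f \<in> spheroids n X x" "A = sph_class n X x f"
        using homotopy_group_carrierE[OF A] .
    obtain g where g: "g \<in> spheroids n X x" "B = sph_class n X x g"
        using homotopy_group_carrierE[OF B] .
    show ?thesis using f g by (simp add: mult_homotopy_group[OF n] sph_class_in_carrier
        sph_concat_spheroids[OF n])
  qed
  show "\<one>\<^bsub>?G\<^esub> \<in> carrier ?G"
    by (simp add: one_homotopy_group sph_class_in_carrier spheroid_const x)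
  show "A \<otimes>\<^bsub>?G\<^esub> B \<otimes>\<^bsub>?G\<^esub> C = A \<otimes>\<^bsub>?G\<^esub> (B \<otimes>\<^bsub>?G\<^esub> C)"
    if A: "A \<in> carrier ?G" and B: "B \<in> carrier ?G" and C: "C \<in> carrier ?G" for A B C
  proof -
    obtain f where f: "f \<in> spheroids n X x" "A = sph_class n X x f"
        using homotopy_group_carrierE[OF A] .
    obtain g where g: "g \<in> spheroids n X x" "B = sph_class n X x g"
        using homotopy_group_carrierE[OF B] .
    obtain h where h: "h \<in> spheroids n X x" "C = sph_class n X x h"
        using homotopy_group_carrierE[OF C] .
    show ?thesis
      using sph_class_eqI[OF sph_concat_assoc[OF n f(1) g(1) h(1)]] f g h
      by (simp add: mult_homotopy_group[OF n] sph_concat_spheroids[OF n])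
  qed
  show "\<one>\<^bsub>?G\<^esub> \<otimes>\<^bsub>?G\<^esub> A = A" if A: "A \<in> carrier ?G" for A
  proof -
    obtain f where f: "f \<in> spheroids n X x" "A = sph_class n X x f"
        using homotopy_group_carrierE[OF A] .
    show ?thesis
      using sph_class_eqI[OF sph_concat_const_left[OF n f(1)]] f
      by (simp add: one_homotopy_group mult_homotopy_group[OF n] spheroid_const[OF x])
  qed
  show "\<exists>B\<in>carrier ?G. B \<otimes>\<^bsub>?G\<^esub> A = \<one>\<^bsub>?G\<^esub>" if A: "A \<in> carrier ?G" for A
  proof -
    obtain f where f: "f \<in> spheroids n X x" "A = sph_class n X x f"
        using homotopy_group_carrierE[OF A] .
    have "sph_class n X x (sph_reverse f) \<otimes>\<^bsub>?G\<^esub> A = \<one>\<^bsub>?G\<^esub>"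
      using sph_class_eqI[OF sph_concat_reverse[OF n f(1)]] f sph_reverse_spheroids[OF n f(1)]
      by (simp add: one_homotopy_group mult_homotopy_group[OF n])
    then show ?thesis using sph_class_in_carrier[OF sph_reverse_spheroids[OF n f(1)]] by blast
  qed
qed

lemma inv_homotopy_group:
  assumes n: "n \<ge> 1" and x: "x \<in> topspace X" and f: "f \<in> spheroids n X x"
  shows "inv\<^bsub>homotopy_group n X x\<^esub> (sph_class n X x f) = sph_class n X x (sph_reverse f)"
proof (rule group.inv_equality[OF group_homotopy_group[OF n x]])
  show "sph_class n X x (sph_reverse f) \<otimes>\<^bsub>homotopy_group n X x\<^esub> sph_class n X x f =
      \<one>\<^bsub>homotopy_group n X x\<^esub>"
    using sph_class_eqI[OF sph_concat_reverse[OF n f]] f sph_reverse_spheroids[OF n f]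
    by (simp add: one_homotopy_group mult_homotopy_group[OF n])
qed (use f in \<open>auto intro!: sph_class_in_carrier sph_reverse_spheroids[OF n]\<close>)

section \<open>Induced homomorphisms\<close>

lemma spheroid_compose:
  assumes "continuous_map X Y p" "p x = y" "f \<in> spheroids n X x"
  shows "p \<circ> f \<in> spheroids n Y y"
  using assms continuous_map_compose[OF _ assms(1)] by (auto simp: spheroids_iff)

lemma sph_homotopic_compose:
  assumes p: "continuous_map X Y p" "p x = y" and f: "(f, g) \<in> sph_homotopic n X x"
  shows "(p \<circ> f, p \<circ> g) \<in> sph_homotopic n Y y"
proof -
  obtain F where F': "continuous_map (top_of_set ({0..1::real} \<times> cube n)) X F \<and>
    (\<forall>t. F (0, t) = f t) \<and> (\<forall>t. F (1, t) = g t) \<and>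
        (\<forall>s\<in>{0..1::real}. \<forall>t\<in>cube_boundary n. F (s, t) = x)"
    using sph_homotopicD[OF f] by meson
  then have F: "continuous_map (top_of_set ({0..1::real} \<times> cube n)) X F"
    "\<And>t. F (0, t) = f t" "\<And>t. F (1, t) = g t"
    "\<And>s t. 0 \<le> s \<Longrightarrow> s \<le> 1 \<Longrightarrow> t \<in> cube_boundary n \<Longrightarrow> F (s, t) = x" by simp_all
  show ?thesis
    by (rule sph_homotopicI[OF continuous_map_compose[OF F(1) p(1)]]) (auto simp: F p(2))
qed

lemma induced_map_sph_class:
  assumes p: "continuous_map X Y p" "p x = y" and f: "f \<in> spheroids n X x"
  shows "induced_map n Y y p (sph_class n X x f) = sph_class n Y y (p \<circ> f)"
proof -
  have "sph_class n Y y (p \<circ> f') = sph_class n Y y (p \<circ> f)" if "f' \<in> sph_class n X x f" for f'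
    using sph_class_eqI[OF sph_homotopic_compose[OF p, of f f']] that by (simp add: sph_class_def)
  then have "(\<Union>f'\<in>sph_class n X x f. sph_class n Y y (p \<circ> f')) =
      (\<Union>f'\<in>sph_class n X x f. sph_class n Y y (p \<circ> f))"
    by (intro SUP_cong refl)
  moreover have "sph_class n X x f \<noteq> {}" using sph_class_self[OF f] by blast
  ultimately show ?thesis by (simp add: induced_map_def)
qed

lemma induced_map_hom:
  assumes n: "n \<ge> 1" and p: "continuous_map X Y p" "p x = y"
  shows "induced_map n Y y p \<in> hom (homotopy_group n X x) (homotopy_group n Y y)"
proof (rule homI)
  fix A B assume A: "A \<in> carrier (homotopy_group n X x)" and B: "B \<in> carrier (homotopy_group n X x)"
  obtain f where f: "f \<in> spheroids n X x" "A = sph_class n X x f"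
      using homotopy_group_carrierE[OF A] .
  obtain g where g: "g \<in> spheroids n X x" "B = sph_class n X x g"
      using homotopy_group_carrierE[OF B] .
  have "p \<circ> sph_concat f g = sph_concat (p \<circ> f) (p \<circ> g)" by (auto simp: sph_concat_def fun_eq_iff)
  then show "induced_map n Y y p (A \<otimes>\<^bsub>homotopy_group n X x\<^esub> B) =
      induced_map n Y y p A \<otimes>\<^bsub>homotopy_group n Y y\<^esub> induced_map n Y y p B"
    using f g by (simp add: mult_homotopy_group[OF n] induced_map_sph_class[OF p]
        sph_concat_spheroids[OF n]
        spheroid_compose[OF p])
next
  fix A assume A: "A \<in> carrier (homotopy_group n X x)"
  obtain f where f: "f \<in> spheroids n X x" "A = sph_class n X x f"
      using homotopy_group_carrierE[OF A] .
  then show "induced_map n Y y p A \<in> carrier (homotopy_group n Y y)"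
    by (simp add: induced_map_sph_class[OF p] sph_class_in_carrier spheroid_compose[OF p])
qed

section \<open>Change of base point\<close>

lemma continuous_on_Max:
  fixes f :: "'i \<Rightarrow> 'a::topological_space \<Rightarrow> real"
  assumes "finite I" "I \<noteq> {}" "\<And>i. i \<in> I \<Longrightarrow> continuous_on S (f i)"
  shows "continuous_on S (\<lambda>x. Max ((\<lambda>i. f i x) ` I))"
  using assms
proof (induction I rule: finite_ne_induct)
  case (insert i I)
  then have "continuous_on S (\<lambda>x. max (f i x) (Max ((\<lambda>i. f i x) ` I)))"
    by (intro continuous_on_max) auto
  with insert show ?case by simp
qed auto

text \<open>The radius that occurs in \<open>path_act\<close>: twice the sup-norm distance from the
  centre of the cube, hence 1 on its boundary and 1/2 on the boundary of the inner cube.\<close>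

definition rad :: "nat \<Rightarrow> (nat \<Rightarrow> real) \<Rightarrow> real" where
  "rad n t = Max ((\<lambda>i. \<bar>2 * t i - 1\<bar>) ` {..<n})"

lemma rad_le_iff: "n \<ge> 1 \<Longrightarrow> rad n t \<le> a \<longleftrightarrow> (\<forall>i<n. \<bar>2 * t i - 1\<bar> \<le> a)"
  unfolding rad_def by (subst Max_le_iff) (auto simp: lessThan_empty_iff)

lemma rad_attained:
  assumes "n \<ge> 1" obtains i where "i < n" "\<bar>2 * t i - 1\<bar> = rad n t"
proof -
  have "rad n t \<in> (\<lambda>i. \<bar>2 * t i - 1\<bar>) ` {..<n}"
    unfolding rad_def using assms by (intro Max_in) (auto simp: lessThan_empty_iff)
  then show thesis using that by auto
qed

lemma rad_nonneg: "n \<ge> 1 \<Longrightarrow> 0 \<le> rad n t"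
  by (rule rad_attained[of n t]) auto

lemma rad_cube: "n \<ge> 1 \<Longrightarrow> t \<in> cube n \<Longrightarrow> rad n t \<le> 1"
  by (auto simp: rad_le_iff cube_def abs_le_iff)

lemma rad_boundary:
  assumes n: "n \<ge> 1" and t: "t \<in> cube_boundary n"
  shows "rad n t = 1"
proof (rule antisym)
  show "rad n t \<le> 1" using rad_cube[OF n] t cube_boundary_subset by blast
  obtain i where "i < n" "t i = 0 \<or> t i = 1" using t by (rule cube_boundaryE)
  then have "\<bar>2 * t i - 1\<bar> = 1" "\<bar>2 * t i - 1\<bar> \<le> rad n t"
    using rad_le_iff[OF n, of t "rad n t"] by auto
  then show "1 \<le> rad n t" by simp
qed

lemma continuous_on_rad: "n \<ge> 1 \<Longrightarrow> continuous_on S (rad n)"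
  unfolding rad_def by (intro continuous_on_Max) (auto simp: lessThan_empty_iff intro!:
      continuous_intros)

lemma path_act_eq:
  "path_act n \<alpha> f t = (if rad n t \<le> 1/2 then f (\<lambda>i.
      if i < n then 2 * t i - 1/2 else 0) else \<alpha> (2 - 2 * rad n t))"
  by (simp add: path_act_def rad_def Let_def)

lemma continuous_on_inner_cube:
  "continuous_on S (\<lambda>t i. if i < n then 2 * t i - 1/2 else (0::real))"
  by (intro continuous_on_coordinatewise_then_product continuous_on_If_const continuous_intros)

lemma inner_cube:
  assumes n: "n \<ge> 1" and t: "rad n t \<le> 1/2"
  shows "(\<lambda>i. if i < n then 2 * t i - 1/2 else 0) \<in> cube n"
proof -
  have H: "\<bar>2 * t i - 1\<bar> \<le> 1/2" if "i < n" for i using t that unfolding rad_le_iff[OF n] by blast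
  have "0 \<le> 2 * t i - 1/2 \<and> 2 * t i - 1/2 \<le> 1" if "i < n" for i using H[OF that]
      unfolding abs_le_iff by argo
  then show ?thesis by (simp add: cube_def)
qed

lemma inner_cube_boundary:
  assumes n: "n \<ge> 1" and t: "rad n t = 1/2"
  shows "(\<lambda>i. if i < n then 2 * t i - 1/2 else 0) \<in> cube_boundary n"
proof -
  obtain i where "i < n" "\<bar>2 * t i - 1\<bar> = rad n t" using n by (rule rad_attained)
  then have "2 * t i - 1/2 = 0 \<or> 2 * t i - 1/2 = 1" using t by (auto simp: abs_if split: if_splits)
  then show ?thesis using \<open>i < n\<close> inner_cube[OF n, of t] t by (auto simp: cube_boundary_eq)
qed

lemma path_act_homotopy_continuous:
  fixes S :: "'b::topological_space set"
  assumes n: "n \<ge> 1"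
    and E: "continuous_map (top_of_set (S \<times> cube n)) X (\<lambda>(s, t). E s t)"
    and \<gamma>: "continuous_map (top_of_set (S \<times> {0..1::real})) X (\<lambda>(s, \<tau>). \<gamma> s \<tau>)"
    and eq: "\<And>s t. s \<in> S \<Longrightarrow> t \<in> cube_boundary n \<Longrightarrow> E s t = \<gamma> s 1"
  shows "continuous_map (top_of_set (S \<times> cube n)) X (\<lambda>p. path_act n (\<gamma> (fst p)) (E (fst p)) (snd
      p))"
  unfolding path_act_eq
proof (rule continuous_map_top_of_set_If_le)
  have rc: "continuous_on T (\<lambda>p. rad n (snd p))" for T :: "('b \<times> (nat \<Rightarrow> real)) set"
    by (rule continuous_on_compose2[OF continuous_on_rad[OF n, of UNIV]]) (auto intro:
        continuous_intros)
  then show "continuous_on (S \<times> cube n) (\<lambda>p. rad n (snd p))" .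
  have ic: "continuous_on T (\<lambda>p i. if i < n then 2 * snd p i - 1/2 else 0)"
      for T :: "('b \<times> (nat \<Rightarrow> real)) set"
    by (rule continuous_on_compose2[OF continuous_on_inner_cube[of UNIV]]) (auto intro:
        continuous_intros)
  show "continuous_map (top_of_set {p \<in> S \<times> cube n. rad n (snd p) \<le> 1/2}) X
      (\<lambda>p. E (fst p) (\<lambda>i. if i < n then 2 * snd p i - 1/2 else 0))"
  proof -
    have "continuous_map (top_of_set {p \<in> S \<times> cube n. rad n (snd p) \<le> 1/2}) X
        (\<lambda>p. (\<lambda>(s, t). E s t) (fst p, \<lambda>i. if i < n then 2 * snd p i - 1/2 else 0))"
      by (rule continuous_map_top_of_set_compose[OF E])
        (use inner_cube[OF n] in \<open>auto intro!: continuous_on_Pair continuous_on_fst ic simp: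
            image_subset_iff\<close>)
    then show ?thesis by simp
  qed
  show "continuous_map (top_of_set {p \<in> S \<times> cube n. 1/2 \<le> rad n (snd p)}) X
      (\<lambda>p. \<gamma> (fst p) (2 - 2 * rad n (snd p)))"
  proof -
    have "continuous_map (top_of_set {p \<in> S \<times> cube n. 1/2 \<le> rad n (snd p)}) X
        (\<lambda>p. (\<lambda>(s, t). \<gamma> s t) (fst p, 2 - 2 * rad n (snd p)))"
      by (rule continuous_map_top_of_set_compose[OF \<gamma>])
        (use rad_cube[OF n] in \<open>auto intro!: continuous_intros rc simp: image_subset_iff\<close>)
    then show ?thesis by simp
  qed
  fix p assume p: "p \<in> S \<times> cube n" "rad n (snd p) = 1/2"
  then have "2 - 2 * rad n (snd p) = 1" by simp
  then show "E (fst p) (\<lambda>i. if i < n then 2 * snd p i - 1/2 else 0) =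
      \<gamma> (fst p) (2 - 2 * rad n (snd p))"
    using eq[OF _ inner_cube_boundary[OF n p(2)], of "fst p"] p(1) by auto
qed auto

lemma path_act_boundary:
  "n \<ge> 1 \<Longrightarrow> t \<in> cube_boundary n \<Longrightarrow> path_act n \<alpha> f t = \<alpha> 0"
  by (simp add: path_act_eq rad_boundary)

lemma path_act_homotopic:
  assumes n: "n \<ge> 1"
    and E: "continuous_map (top_of_set ({0..1::real} \<times> cube n)) X (\<lambda>(s, t). E s t)"
    and \<gamma>: "continuous_map (top_of_set ({0..1::real} \<times> {0..1::real})) X (\<lambda>(s, \<tau>). \<gamma> s \<tau>)"
    and eq: "\<And>s t. 0 \<le> s \<Longrightarrow> s \<le> 1 \<Longrightarrow> t \<in> cube_boundary n \<Longrightarrow> E s t = \<gamma> s 1"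
    and \<gamma>0: "\<And>s. 0 \<le> s \<Longrightarrow> s \<le> 1 \<Longrightarrow> \<gamma> s 0 = x"
  shows "(path_act n (\<gamma> 0) (E 0), path_act n (\<gamma> 1) (E 1)) \<in> sph_homotopic n X x"
proof (rule sph_homotopicI[OF path_act_homotopy_continuous[OF n E \<gamma>]])
  show "path_act n (\<gamma> (fst (s, t))) (E (fst (s, t))) (snd (s, t)) = x"
    if "0 \<le> s" "s \<le> 1" "t \<in> cube_boundary n" for s t
    using path_act_boundary[OF n that(3), of "\<gamma> s" "E s"] \<gamma>0[OF that(1,2)] by simp
qed (use eq in auto)

lemma path_act_spheroid:
  assumes n: "n \<ge> 1" and \<alpha>: "pathin X \<alpha>" and e: "continuous_map (top_of_set (cube n)) X e"
    and eq: "\<And>t. t \<in> cube_boundary n \<Longrightarrow> e t = \<alpha> 1"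
  shows "path_act n \<alpha> e \<in> spheroids n X (\<alpha> 0)"
proof -
  have 1: "continuous_map (top_of_set ({0..1::real} \<times> cube n)) X (\<lambda>(s, t). e t)"
    unfolding case_prod_unfold
    by (rule continuous_map_top_of_set_compose[OF e]) (auto intro!: continuous_intros)
  have 2: "continuous_map (top_of_set ({0..1::real} \<times> {0..1::real})) X (\<lambda>(s, \<tau>). \<alpha> \<tau>)"
    unfolding case_prod_unfold
    by (rule continuous_map_top_of_set_compose[OF \<alpha>[unfolded pathin_def]]) (auto intro!:
        continuous_intros)
  from path_act_homotopic[OF n 1 2, of "\<alpha> 0"] eq show ?thesis
    by (auto intro: sph_homotopic_spheroids(1))
qed

text \<open>The homotopy E moves the boundary of the cube along \<beta>, so by itself it is not a
  homotopy of spheroids. Lengthening the path by the part of \<beta> already traversed keeps the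
  outer end at \<open>\<alpha> 0\<close>; once E is constant, the lengthened path is withdrawn to
  its start.\<close>

lemma path_act_null:
  assumes n: "n \<ge> 1" and \<alpha>: "pathin X \<alpha>"
    and E: "continuous_map (top_of_set ({0..1::real} \<times> cube n)) X (\<lambda>(s, t). E s t)"
    and bd: "\<And>s t. 0 \<le> s \<Longrightarrow> s \<le> 1 \<Longrightarrow> t \<in> cube_boundary n \<Longrightarrow> E s t = \<beta> s"
    and \<beta>: "pathin X \<beta>" "\<beta> 0 = \<alpha> 1" and E1: "\<And>t. t \<in> cube n \<Longrightarrow> E 1 t = \<beta> 1"
  shows "(path_act n \<alpha> (E 0), \<lambda>_. \<alpha> 0) \<in> sph_homotopic n X (\<alpha> 0)"
proof -
  \<comment> \<open>At stage s the path runs through \<alpha> and then through \<beta> up to the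
    parameter s; 1 + s is the total length.\<close>
  define \<gamma> where "\<gamma> s \<tau> = (if \<tau> * (1 + s) \<le> 1 then \<alpha> (\<tau> * (1 + s)) else \<beta> (\<tau> * (1 + s) - 1))"
      for s \<tau> :: real
  have \<gamma>: "continuous_map (top_of_set ({0..1::real} \<times> {0..1::real})) X (\<lambda>p. \<gamma> (fst p) (snd p))"
    unfolding \<gamma>_def
  proof (rule continuous_map_top_of_set_If_le)
    show "continuous_map (top_of_set {p \<in> {0..1::real} \<times> {0..1::real}. snd p * (1 + fst p) \<le> 1}) X
        (\<lambda>p. \<alpha> (snd p * (1 + fst p)))"
      using \<alpha> unfolding pathin_def
      by (rule continuous_map_top_of_set_compose) (auto intro!: continuous_intros)
    have le2: "snd p * (1 + fst p) \<le> 2" if "p \<in> {0..1::real} \<times> {0..1::real}" for p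
      using that mult_mono[of "snd p" 1 "1 + fst p" 2] by auto
    show "continuous_map (top_of_set {p \<in> {0..1::real} \<times> {0..1::real}. 1 \<le> snd p * (1 + fst p)}) X
        (\<lambda>p. \<beta> (snd p * (1 + fst p) - 1))"
      using \<beta>(1) unfolding pathin_def
      by (rule continuous_map_top_of_set_compose) (use le2 in \<open>fastforce intro!:
          continuous_intros\<close>)+
  qed (use \<beta>(2) in \<open>auto intro!: continuous_intros\<close>)
  have "(path_act n (\<gamma> 0) (E 0), path_act n (\<gamma> 1) (E 1)) \<in> sph_homotopic n X (\<alpha> 0)"
  proof (rule path_act_homotopic[OF n E])
    show "E s t = \<gamma> s 1" if "0 \<le> s" "s \<le> 1" "t \<in> cube_boundary n" for s t
      using bd[OF that] that \<beta>(2) by (cases "s = 0") (auto simp: \<gamma>_def)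
  qed (use \<gamma> in \<open>auto simp: case_prod_unfold \<gamma>_def\<close>)
  note E01 = this
  have 1: "(path_act n \<alpha> (E 0), path_act n (\<gamma> 0) (E 0)) \<in> sph_homotopic n X (\<alpha> 0)"
  proof (rule sph_homotopic_eq_on_cube)
    show "path_act n \<alpha> (E 0) \<in> spheroids n X (\<alpha> 0)"
    proof (rule path_act_spheroid[OF n \<alpha>])
      show "continuous_map (top_of_set (cube n)) X (E 0)"
      proof -
        have "continuous_on (cube n) (\<lambda>t. (0::real, t))" by (intro continuous_intros)
        from continuous_map_top_of_set_compose[OF E this] show ?thesis
            by (simp add: image_subset_iff)
      qed
    qed (use bd \<beta>(2) in simp)
    fix t assume "t \<in> cube n"
    then show "path_act n \<alpha> (E 0) t = path_act n (\<gamma> 0) (E 0) t"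
      using rad_cube[OF n] rad_nonneg[OF n, of t] by (auto simp: path_act_eq \<gamma>_def)
  qed
  \<comment> \<open>The inner cube now carries a constant, so the path and this constant can retract
    together along \<open>\<gamma> 1\<close>.\<close>
  have 3: "(path_act n (\<lambda>\<tau>. \<gamma> 1 ((1 - 0) * \<tau>)) (\<lambda>t. \<gamma> 1 (1 - 0)),
      path_act n (\<lambda>\<tau>. \<gamma> 1 ((1 - 1) * \<tau>)) (\<lambda>t. \<gamma> 1 (1 - 1))) \<in> sph_homotopic n X (\<alpha> 0)"
  proof (rule path_act_homotopic[OF n])
    show "continuous_map (top_of_set ({0..1::real} \<times> cube n)) X (\<lambda>(s, t). \<gamma> 1 (1 - s))"
    proof -
      have "continuous_map (top_of_set ({0..1::real} \<times> cube n)) X (\<lambda>p. \<gamma> (fst (1, 1 - fst p))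
          (snd (1::real, 1 - fst p)))"
        by (rule continuous_map_top_of_set_compose[OF \<gamma>]) (intro continuous_intros | force)+
      then show ?thesis by (simp add: case_prod_unfold)
    qed
    show "continuous_map (top_of_set ({0..1::real} \<times> {0..1::real})) X (\<lambda>(s, \<tau>). \<gamma> 1 ((1 - s) * \<tau>))"
    proof -
      have "continuous_map (top_of_set ({0..1::real} \<times> {0..1::real})) X
          (\<lambda>p. \<gamma> (fst (1, (1 - fst p) * snd p)) (snd (1::real, (1 - fst p) * snd p)))"
      proof (rule continuous_map_top_of_set_compose[OF \<gamma>])
        show "continuous_on ({0..1} \<times> {0..1}) (\<lambda>p. (1::real, (1 - fst p) * snd (p :: real \<times> real)))"
          by (intro continuous_intros)
      qed (auto simp: mult_le_one)
      then show ?thesis by (simp add: case_prod_unfold)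
    qed
  qed (auto simp: \<gamma>_def)
  have "path_act n (\<gamma> 1) (E 1) t = path_act n (\<gamma> 1) (\<lambda>t. \<gamma> 1 1) t" if "t \<in> cube n" for t
    using E1 inner_cube[OF n, of t] by (auto simp: path_act_eq \<gamma>_def)
  with sph_homotopic_spheroids(2)[OF E01]
  have 2: "(path_act n (\<gamma> 1) (E 1), path_act n (\<gamma> 1) (\<lambda>t. \<gamma> 1 1)) \<in> sph_homotopic n X (\<alpha> 0)"
    by (rule sph_homotopic_eq_on_cube)
  have eqs: "path_act n (\<lambda>\<tau>. \<gamma> 1 ((1 - 1) * \<tau>)) (\<lambda>t. \<gamma> 1 (1 - 1)) = (\<lambda>_. \<alpha> 0)"
    by (auto simp: path_act_eq \<gamma>_def)
  have 4: "(path_act n (\<gamma> 1) (\<lambda>t. \<gamma> 1 1), \<lambda>_. \<alpha> 0) \<in> sph_homotopic n X (\<alpha> 0)"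
    using 3 unfolding eqs by simp
  from 1 E01 2 4 show ?thesis by (blast intro: sph_homotopic_trans)
qed

section \<open>Generators of Spanier groups\<close>

lemma compact_cube: "compact (cube n)"
proof -
  have "cube n = (\<Pi>\<^sub>E i\<in>UNIV. if i < n then {0..1} else {0})"
  proof (rule Set.set_eqI)
    fix t :: "nat \<Rightarrow> real"
    have "(\<forall>i. t i \<in> (if i < n then {0..1} else {0})) \<longleftrightarrow> (\<forall>i<n. 0 \<le> t i \<and> t i \<le> 1) \<and> (\<forall>i\<ge>n. t i = 0)"
      by (metis (full_types) atLeastAtMost_iff not_less singleton_iff)
    then show "t \<in> cube n \<longleftrightarrow> t \<in> (\<Pi>\<^sub>E i\<in>UNIV. if i < n then {0..1} else {0})"
      by (simp add: cube_def PiE_UNIV_domain Pi_iff)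
  qed
  moreover have "compactin (product_topology (\<lambda>i. euclideanreal) UNIV) (\<Pi>\<^sub>E i\<in>UNIV.
      if i < n then {0..1} else {0})"
    by (subst compactin_PiE) auto
  ultimately show ?thesis by (simp add: euclidean_product_topology)
qed

lemma nsphere_eq: "nsphere n = top_of_set {x. (\<Sum>i\<le>n. (x i)\<^sup>2) = 1 \<and> (\<forall>i>n. x i = 0)}"
  by (simp add: nsphere euclidean_product_topology)

lemma cube_collapse_0:
  "cube_collapse n t 0 = ((\<Sum>i<n. (2 * t i - 1)\<^sup>2) - (\<Prod>i<n. 1 - (2 * t i - 1)\<^sup>2)\<^sup>2) /
     ((\<Sum>i<n. (2 * t i - 1)\<^sup>2) + (\<Prod>i<n. 1 - (2 * t i - 1)\<^sup>2)\<^sup>2)"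
  by (simp add: cube_collapse_def Let_def)

lemma cube_collapse_Suc:
  "cube_collapse n t (Suc i) = (if i < n then 2 * (\<Prod>i<n. 1 - (2 * t i - 1)\<^sup>2) * (2 * t i - 1) /
     ((\<Sum>i<n. (2 * t i - 1)\<^sup>2) + (\<Prod>i<n. 1 - (2 * t i - 1)\<^sup>2)\<^sup>2) else 0)"
  by (simp add: cube_collapse_def Let_def)

lemma continuous_on_cube_collapse:
  assumes n: "n \<ge> 1" shows "continuous_on (cube n) (cube_collapse n)"
proof (intro continuous_on_coordinatewise_then_product)
  fix j
  have nz: "(\<Sum>i<n. (2 * t i - 1)\<^sup>2) + (\<Prod>i<n. 1 - (2 * t i - 1)\<^sup>2)\<^sup>2 \<noteq> 0" if "t \<in> cube n" for t
    using cube_collapse_denom_pos[OF n, of t] that by (simp add: cube_space_eq)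
  show "continuous_on (cube n) (\<lambda>t. cube_collapse n t j)"
  proof (cases j)
    case 0
    show ?thesis unfolding 0 cube_collapse_0
      by (intro continuous_intros ballI nz)
  next
    case (Suc i)
    show ?thesis unfolding Suc cube_collapse_Suc
      by (intro continuous_intros ballI nz)
  qed
qed

lemma cube_interior_pos:
  assumes "t \<in> cube n - cube_boundary n"
  shows "0 < (\<Prod>i<n. 1 - (2 * t i - 1)\<^sup>2)"
proof (rule prod_pos)
  fix i assume "i \<in> {..<n}"
  then have "0 < t i" "t i < 1" using assms by (auto simp: cube_def cube_boundary_eq less_le)
  then have "0 < 4 * t i * (1 - t i)" by simp
  also have "\<dots> = 1 - (2 * t i - 1)\<^sup>2" by (simp add: power2_eq_square algebra_simps)
  finally show "0 < 1 - (2 * t i - 1)\<^sup>2" .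
qed

text \<open>On the open cube, the collapse determines \<open>w = u / b\<close>, hence \<open>u\<close> up to a positive factor; since
  \<open>b\<close> decreases along rays, that factor is \<open>1\<close>.\<close>

lemma cube_collapse_inj:
  assumes n: "n \<ge> 1" and t: "t \<in> cube n - cube_boundary n" and t': "t' \<in> cube n - cube_boundary n"
    and eq: "cube_collapse n t = cube_collapse n t'"
  shows "t = t'"
proof -
  define u where "u t i = 2 * t i - 1" for t :: "nat \<Rightarrow> real" and i
  define b where "b t = (\<Prod>i<n. 1 - (u t i)\<^sup>2)" for t
  define s where "s t = (\<Sum>i<n. (u t i)\<^sup>2)" for t
  have bp: "b t > 0" "b t' > 0" using cube_interior_pos[OF t] cube_interior_pos[OF t']
      by (auto simp: b_def u_def)
  have s0: "s t \<ge> 0" for t by (auto simp: s_def intro: sum_nonneg)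
  have den: "s t + (b t)\<^sup>2 > 0" "s t' + (b t')\<^sup>2 > 0" using bp s0 by (simp_all add: add_nonneg_pos)
  have c0: "(s t - (b t)\<^sup>2) / (s t + (b t)\<^sup>2) = (s t' - (b t')\<^sup>2) / (s t' + (b t')\<^sup>2)"
    using fun_cong[OF eq, of 0] by (simp add: cube_collapse_0 s_def b_def u_def)
  \<comment> \<open>Coordinate 0 of the collapse is 1 - 2B/(S + B), with B the square of b, so it
    determines the ratio B/(S + B). Dividing this ratio out of the other coordinates leaves
    u/b.\<close>
  have "B / (S + B) = (1 - (S - B) / (S + B)) / 2" if "S + B > 0" for S B :: real
    using that by (simp add: field_simps)
  from this[OF den(1)] this[OF den(2)]
  have q: "(b t)\<^sup>2 / (s t + (b t)\<^sup>2) = (b t')\<^sup>2 / (s t' + (b t')\<^sup>2)" using c0 by argo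
  have w: "u t i / b t = u t' i / b t'" if "i < n" for i
  proof -
    have "2 * b t * u t i / (s t + (b t)\<^sup>2) = 2 * b t' * u t' i / (s t' + (b t')\<^sup>2)"
      using fun_cong[OF eq, of "Suc i"] that by (simp add: cube_collapse_Suc s_def b_def u_def)
    moreover have "2 * b t * u t i / (s t + (b t)\<^sup>2) =
        2 * (u t i / b t) * ((b t)\<^sup>2 / (s t + (b t)\<^sup>2))"
      "2 * b t' * u t' i / (s t' + (b t')\<^sup>2) = 2 * (u t' i / b t') * ((b t')\<^sup>2 / (s t' + (b t')\<^sup>2))"
      using bp by (simp_all add: power2_eq_square)
    ultimately have "2 * (u t i / b t) * ((b t')\<^sup>2 / (s t' + (b t')\<^sup>2)) =
        2 * (u t' i / b t') * ((b t')\<^sup>2 / (s t' + (b t')\<^sup>2))"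
      using q by metis
    moreover have "(b t')\<^sup>2 / (s t' + (b t')\<^sup>2) \<noteq> 0" using bp den by simp
    ultimately show ?thesis by (metis mult_cancel_left mult_cancel_right zero_neq_numeral)
  qed
  have mono: "b t' \<le> b t" if "b t \<le> b t'" "b t > 0" "b t' > 0" "t' \<in> cube n" "\<And>i. i < n \<Longrightarrow>
      u t i / b t = u t' i / b t'" for t t'
    unfolding b_def
  proof (rule prod_mono, intro conjI)
    fix i assume i: "i \<in> {..<n}"
    then have "\<bar>u t' i\<bar> \<le> 1" using that(4) by (auto simp: u_def cube_def abs_le_iff)
    then show "0 \<le> 1 - (u t' i)\<^sup>2" by (simp add: abs_square_le_1)
    have "u t i = b t / b t' * u t' i" using that(5)[of i] i that(2,3) by (simp add: field_simps)
    then have "\<bar>u t i\<bar> = b t / b t' * \<bar>u t' i\<bar>" using that(2,3) by (simp add: abs_mult)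
    also have "\<dots> \<le> 1 * \<bar>u t' i\<bar>" using that by (intro mult_right_mono) auto
    finally show "1 - (u t' i)\<^sup>2 \<le> 1 - (u t i)\<^sup>2" by (simp add: abs_le_square_iff)
  qed
  have "b t = b t'"
  proof (cases "b t \<le> b t'")
    case True
    then show ?thesis using mono[of t t'] bp t' w by auto
  next
    case False
    then show ?thesis using mono[of t' t] bp t w by fastforce
  qed
  then have "u t i = u t' i" if "i < n" for i using w[OF that] bp by simp
  then have "t i = t' i" for i using t t' by (cases "i < n") (auto simp: u_def cube_def)
  then show ?thesis by auto
qed

text \<open>Away from the base point, stereographic projection prescribes w = u/b. So u is sought as
  \<rho> times w, with \<rho> equal to the value of the product b at that point of the ray. For w
  nonzero the intermediate value theorem applies between \<rho> = 0, where the product is 1, and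
  \<rho> = 1/m with m the largest |w i|, where the ray meets the boundary and a factor
  vanishes.\<close>

lemma cube_collapse_surj:
  assumes n: "n \<ge> 1" and y: "y \<in> topspace (nsphere n)"
  shows "y \<in> cube_collapse n ` cube n"
proof (cases "y 0 = 1")
  case True
  have y1: "(\<Sum>i\<le>n. (y i)\<^sup>2) = 1" "\<And>i. i > n \<Longrightarrow> y i = 0" using y by (auto simp: nsphere)
  have "(y 0)\<^sup>2 + (\<Sum>i<n. (y (Suc i))\<^sup>2) = 1"
    using y1(1) by (simp add: lessThan_Suc_atMost[symmetric] sum.lessThan_Suc_shift del:
        sum.lessThan_Suc)
  then have "(\<Sum>i<n. (y (Suc i))\<^sup>2) = 0" using True by simp
  then have "y (Suc i) = 0" if "i < n" for i
    using that by (subst (asm) sum_nonneg_eq_0_iff) auto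
  then have "y = sphere_base"
    using True y1(2) by (auto simp: sphere_base_def fun_eq_iff gr0_conv_Suc) (metis Suc_lessI
        less_Suc_eq not_less_eq)
  moreover have "(\<lambda>_. 0) \<in> cube_boundary n" "(\<lambda>_. 0) \<in> cube n" using n
      by (auto simp: cube_boundary_eq cube_def intro!: exI[of _ 0])
  then have "cube_collapse n (\<lambda>_. 0) = sphere_base"
    using cube_collapse_eq_base[OF n, of "\<lambda>_. 0"] by (simp add: cube_space_eq)
  ultimately show ?thesis using \<open>(\<lambda>_. 0) \<in> cube n\<close> by (metis imageI)
next
  case False
  have y1: "(\<Sum>i\<le>n. (y i)\<^sup>2) = 1" "\<And>i. i > n \<Longrightarrow> y i = 0" using y by (auto simp: nsphere)
  have ys: "(y 0)\<^sup>2 + (\<Sum>i<n. (y (Suc i))\<^sup>2) = 1"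
    using y1(1) by (simp add: lessThan_Suc_atMost[symmetric] sum.lessThan_Suc_shift del:
        sum.lessThan_Suc)
  have "(y 0)\<^sup>2 \<le> 1" using ys sum_nonneg[of "{..<n}" "\<lambda>i. (y (Suc i))\<^sup>2"] by auto
  then have y0: "y 0 < 1" using False abs_square_le_1[of "y 0"] by auto
  define w where "w i = y (Suc i) / (1 - y 0)" for i
  define W where "W = (\<Sum>i<n. (w i)\<^sup>2)"
  define b where "b \<rho> = (\<Prod>i<n. 1 - (\<rho> * w i)\<^sup>2)" for \<rho> :: real
  have Wy: "W = (1 + y 0) / (1 - y 0)"
  proof -
    have "W = (\<Sum>i<n. (y (Suc i))\<^sup>2) / (1 - y 0)\<^sup>2"
        by (simp add: W_def w_def power_divide sum_divide_distrib)
    also have "\<dots> = (1 - (y 0)\<^sup>2) / (1 - y 0)\<^sup>2" using ys by (simp add: algebra_simps)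
    also have "1 - (y 0)\<^sup>2 = (1 + y 0) * (1 - y 0)" by (simp add: power2_eq_square algebra_simps)
    also have "(1 + y 0) * (1 - y 0) / (1 - y 0)\<^sup>2 = (1 + y 0) / (1 - y 0)" using y0
        by (simp add: power2_eq_square)
    finally show ?thesis .
  qed
  obtain \<rho> where \<rho>: "0 \<le> \<rho>" "\<rho> = b \<rho>" "\<And>i. i < n \<Longrightarrow> \<bar>\<rho> * w i\<bar> \<le> 1"
  proof (cases "\<forall>i<n. w i = 0")
    case True
    then show thesis by (intro that[of 1]) (auto simp: b_def)
  next
    case False
    define m where "m = Max ((\<lambda>i. \<bar>w i\<bar>) ` {..<n})"
    have mle: "\<bar>w i\<bar> \<le> m" if "i < n" for i using that by (auto simp: m_def intro: Max_ge)
    have m0: "m > 0" using False mle by (metis abs_le_zero_iff not_less order_trans)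
    have "m \<in> (\<lambda>i. \<bar>w i\<bar>) ` {..<n}" unfolding m_def using n
        by (intro Max_in) (auto simp: lessThan_empty_iff)
    then obtain k where k: "k < n" "\<bar>w k\<bar> = m" by auto
    have "(1 / m * w k)\<^sup>2 = 1" using k m0 by (simp add: power_divide power_mult_distrib) (metis
        power2_abs power_not_zero divide_self_if less_irrefl)
    then have b0: "b (1 / m) = 0" using k(1) by (auto simp: b_def)
    have "\<exists>\<rho>\<ge>0. \<rho> \<le> 1 / m \<and> \<rho> - b \<rho> = 0"
    proof (rule IVT')
      show "0 - b 0 \<le> 0" by (simp add: b_def)
      show "0 \<le> 1 / m - b (1 / m)" "0 \<le> 1 / m" using b0 m0 by simp_all
      show "continuous_on {0..1 / m} (\<lambda>\<rho>. \<rho> - b \<rho>)" unfolding b_def by (intro continuous_intros)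
    qed
    then obtain \<rho> where \<rho>: "0 \<le> \<rho>" "\<rho> \<le> 1 / m" "\<rho> - b \<rho> = 0" by auto
    have "\<bar>\<rho> * w i\<bar> \<le> 1" if "i < n" for i
    proof -
      have "\<bar>\<rho> * w i\<bar> \<le> 1 / m * m" using \<rho> mle[OF that] m0 unfolding abs_mult
          by (intro mult_mono) auto
      then show ?thesis using m0 by simp
    qed
    then show thesis using \<rho> by (intro that[of \<rho>]) auto
  qed
  define t where "t = (\<lambda>i. if i < n then (\<rho> * w i + 1) / 2 else 0)"
  have u: "2 * t i - 1 = \<rho> * w i" if "i < n" for i using that by (simp add: t_def field_simps)
  have "0 \<le> (\<rho> * w i + 1) / 2 \<and> (\<rho> * w i + 1) / 2 \<le> 1" if "i < n" for i
    using \<rho>(3)[OF that] unfolding abs_le_iff by argo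
  then have tc: "t \<in> cube n" by (simp add: t_def cube_def)
  have pr: "(\<Prod>i<n. 1 - (2 * t i - 1)\<^sup>2) = \<rho>" using \<rho>(2) by (simp add: u b_def)
  have su: "(\<Sum>i<n. (2 * t i - 1)\<^sup>2) = \<rho>\<^sup>2 * W"
      by (simp add: u W_def power_mult_distrib sum_distrib_left)
  have \<rho>0: "\<rho> \<noteq> 0"
  proof
    assume "\<rho> = 0"
    then have "b \<rho> = 1" by (simp add: b_def)
    with \<rho>(2) \<open>\<rho> = 0\<close> show False by simp
  qed
  have W1: "W + 1 = 2 / (1 - y 0)" "W - 1 = 2 * y 0 / (1 - y 0)" using y0
      by (simp_all add: Wy field_simps)
  have den: "\<rho>\<^sup>2 * W + \<rho>\<^sup>2 = \<rho>\<^sup>2 * (2 / (1 - y 0))" unfolding W1(1)[symmetric]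
      by (simp add: algebra_simps)
  have "cube_collapse n t j = y j" for j
  proof (cases j)
    case 0
    have "\<rho>\<^sup>2 * W - \<rho>\<^sup>2 = \<rho>\<^sup>2 * (2 * y 0 / (1 - y 0))" unfolding W1(2)[symmetric]
        by (simp add: algebra_simps)
    then show ?thesis using \<rho>0 y0 unfolding 0 cube_collapse_0 pr su den by simp
  next
    case (Suc i)
    show ?thesis
    proof (cases "i < n")
      case True
      then have "cube_collapse n t (Suc i) = 2 * \<rho> * (\<rho> * w i) / (\<rho>\<^sup>2 * (2 / (1 - y 0)))"
        unfolding cube_collapse_Suc pr su den by (simp add: u)
      then show ?thesis using \<rho>0 y0 Suc by (simp add: w_def power2_eq_square)
    next
      case False
      then show ?thesis using y1(2)[of "Suc i"] Suc by (simp add: cube_collapse_Suc)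
    qed
  qed
  then show ?thesis using tc by (metis ext imageI)
qed

lemma quotient_map_cube_collapse:
  assumes n: "n \<ge> 1"
  shows "quotient_map (top_of_set (cube n)) (nsphere n) (cube_collapse n)"
proof (rule continuous_closed_imp_quotient_map)
  show c: "continuous_map (top_of_set (cube n)) (nsphere n) (cube_collapse n)"
    using continuous_on_cube_collapse[OF n] cube_collapse_in_nsphere[OF n]
    by (auto simp: nsphere_eq continuous_map_in_subtopology continuous_map_iff_continuous
        cube_space_eq)
  show "closed_map (top_of_set (cube n)) (nsphere n) (cube_collapse n)"
  proof (rule T1_Spaces.continuous_imp_closed_map[OF c])
    show "compact_space (top_of_set (cube n))"
      using compact_cube by (simp add: compact_space_subtopology)
    show "Hausdorff_space (nsphere n)"
      unfolding nsphere_eq by (simp add: Hausdorff_space_subtopology)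
  qed
  show "cube_collapse n ` topspace (top_of_set (cube n)) = topspace (nsphere n)"
    using cube_collapse_surj[OF n] cube_collapse_in_nsphere[OF n] by (auto simp: cube_space_eq)
qed

text \<open>A map of the cube that is constant on the boundary descends along the quotient map
  \<open>cube_collapse\<close> to the sphere. Generators can therefore be exhibited by maps of
  cubes.\<close>

lemma path_act_in_spanier_generators:
  assumes n: "n \<ge> 1" and \<alpha>: "pathin X \<alpha>" "\<alpha> 0 = x" and e: "continuous_map (top_of_set (cube n)) X e"
    and eq: "\<And>t. t \<in> cube_boundary n \<Longrightarrow> e t = \<alpha> 1"
    and U: "U \<in> \<U>" "\<And>t. t \<in> cube n \<Longrightarrow> e t \<in> U"
  shows "sph_class n X x (path_act n \<alpha> e) \<in> spanier_generators n X \<U> x"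
proof -
  have inj: "e t = e t'" if "t \<in> cube n" "t' \<in> cube n" "cube_collapse n t = cube_collapse n t'"
      for t t'
  proof (cases "t \<in> cube_boundary n \<or> t' \<in> cube_boundary n")
    case True
    moreover have "t \<in> cube_boundary n \<longleftrightarrow> t' \<in> cube_boundary n"
      using cube_collapse_eq_base[OF n, of t] cube_collapse_eq_base[OF n, of t'] that
          by (simp add: cube_space_eq)
    ultimately have "t \<in> cube_boundary n" "t' \<in> cube_boundary n" by auto
    then show ?thesis using eq by simp
  next
    case False
    then show ?thesis using cube_collapse_inj[OF n, of t t'] that by auto
  qed
  have "\<exists>f. continuous_map (nsphere n) X f \<and> f ` topspace (nsphere n) = e ` cube n \<and>
      (\<forall>t\<in>cube n. f (cube_collapse n t) = e t)"
  proof (rule quotient_map_lift_exists[OF quotient_map_cube_collapse[OF n] e])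
    show "e t = e t'" if "t \<in> topspace (top_of_set (cube n))" "t' \<in> topspace (top_of_set (cube n))"
      "cube_collapse n t = cube_collapse n t'" for t t'
      using that by (intro inj) simp_all
    fix g assume "continuous_map (nsphere n) X g" "g ` topspace (nsphere n) =
        e ` topspace (top_of_set (cube n))"
      "\<And>t. t \<in> topspace (top_of_set (cube n)) \<Longrightarrow> g (cube_collapse n t) = e t"
    then show ?thesis by (intro exI[of _ g]) simp
  qed
  then obtain f where f: "continuous_map (nsphere n) X f" "f ` topspace (nsphere n) = e ` cube n"
    "\<forall>t\<in>cube n. f (cube_collapse n t) = e t" by blast
  have fe: "f (cube_collapse n t) = e t" if "t \<in> cube n" for t using f(3) that by simp
  have z: "(\<lambda>_. 0) \<in> cube_boundary n" "(\<lambda>_. 0) \<in> cube n" using n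
      by (auto simp: cube_boundary_eq cube_def intro!: exI[of _ 0])
  then have "cube_collapse n (\<lambda>_. 0) = sphere_base"
    using cube_collapse_eq_base[OF n, of "\<lambda>_. 0"] by (simp add: cube_space_eq)
  then have fb: "f sphere_base = \<alpha> 1" using fe z eq by metis
  have "(path_act n \<alpha> e, path_act n \<alpha> (f \<circ> cube_collapse n)) \<in> sph_homotopic n X x"
  proof (rule sph_homotopic_eq_on_cube)
    show "path_act n \<alpha> e \<in> spheroids n X x" using path_act_spheroid[OF n \<alpha>(1) e eq] \<alpha>(2) by simp
    show "path_act n \<alpha> e t = path_act n \<alpha> (f \<circ> cube_collapse n) t" if "t \<in> cube n" for t
      using fe inner_cube[OF n, of t] by (simp add: path_act_eq)
  qed
  then have "sph_class n X x (path_act n \<alpha> e) =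
      sph_class n X x (path_act n \<alpha> (f \<circ> cube_collapse n))"
    by (rule sph_class_eqI)
  moreover have "f ` topspace (nsphere n) \<subseteq> U" using f(2) U(2) by auto
  ultimately show ?thesis
    unfolding spanier_generators_def using \<alpha> f(1) fb U(1) by blast
qed

text \<open>Up to homotopy, the product of \<open>g\<close> with the reverse of \<open>g'\<close> is \<open>g'\<close> composed with a map of
  \<open>I\<^sup>n\<close> to \<open>\<real>\<^sup>n\<close> that folds \<open>I\<^sup>n\<close> along the hyperplane \<open>t\<^sub>0 = 1/2\<close>, except that \<open>g\<close> is used
  over one copy of the box \<open>Q\<close> with corners \<open>a\<close> and \<open>b\<close>. The fold sends \<open>\<partial>I\<^sup>n\<close> to a contractible part of the complement of the
  open cube, so relative to that copy it can be deformed to a map that is radial off a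
  concentric cube.\<close>

lemma spheroid_difference_in_spanier_generators:
  assumes n: "n \<ge> 1" and g: "g \<in> spheroids n X x" and g': "g' \<in> spheroids n X x"
    and ab: "\<And>i. i < n \<Longrightarrow> 0 \<le> a i \<and> a i \<le> b i \<and> b i \<le> 1"
    and agree: "\<And>t. t \<in> cube n \<Longrightarrow> \<exists>i<n. t i \<le> a i \<or> b i \<le> t i \<Longrightarrow> g t = g' t"
    and U: "U \<in> \<U>" "\<And>t. t \<in> cube n \<Longrightarrow> \<forall>i<n. a i \<le> t i \<and> t i \<le> b i \<Longrightarrow> g t \<in> U \<and> g' t \<in> U"
  shows "sph_class n X x (sph_concat g (sph_reverse g')) \<in> spanier_generators n X \<U> x"
proof -
  have n0: "0 < n" using n by simp
  \<comment> \<open>A signed sup-norm distance to the box Q: at most 0 exactly on Q, and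
    non-negative only where some coordinate is not strictly between its bounds.\<close>
  define dq where "dq t = Max ((\<lambda>i. max (a i - t i) (t i - b i)) ` {..<n})" for t
  have dq_le: "dq t \<le> 0 \<longleftrightarrow> (\<forall>i<n. a i \<le> t i \<and> t i \<le> b i)" for t
    unfolding dq_def using n by (subst Max_le_iff) (auto simp: lessThan_empty_iff)
  have dq_ge: "\<exists>i<n. t i \<le> a i \<or> b i \<le> t i" if "0 \<le> dq t" for t
  proof -
    have "dq t \<in> (\<lambda>i. max (a i - t i) (t i - b i)) ` {..<n}"
      unfolding dq_def using n by (intro Max_in) (auto simp: lessThan_empty_iff)
    then obtain i where "i < n" "dq t = max (a i - t i) (t i - b i)" by auto
    then show ?thesis using that by (intro exI[of _ i]) (auto simp: max_def split: if_splits)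
  qed
  have dq_cont: "continuous_on S dq" for S
    unfolding dq_def using n by (intro continuous_on_Max) (auto simp: lessThan_empty_iff intro!:
        continuous_intros)
  \<comment> \<open>The map 4t - 3/2 expands the concentric cube with sides [3/8, 5/8] to the unit
    cube, so what happens over that cube takes place within radius 1/4. Doubling coordinate 0
    selects the half that carries g; the copy of Q is the preimage of Q under A.\<close>
  define A where "A t i = (if i = 0 then 2 * (4 * t 0 - 3/2) else 4 * t i - 3/2)"
      for t :: "nat \<Rightarrow> real" and i
  \<comment> \<open>The fold: it equals A up to the hyperplane where coordinate 0 is 1/2, and turns
    back behind it, where g' is traversed in reverse.\<close>
  define \<rho>0 where "\<rho>0 t i = (if i = 0 then 1 - \<bar>2 * (4 * t 0 - 3/2) - 1\<bar> else 4 * t i - 3/2)"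
      for t :: "nat \<Rightarrow> real" and i
  \<comment> \<open>A cutoff, 0 up to radius 1/4, so on the copy of Q, and 1 from radius 1/2
    on.\<close>
  define w where "w t = max 0 (min 1 (4 * (rad n t - 1/4)))" for t
  \<comment> \<open>Subtracting 4 from a coordinate that is at most 1 moves everything from radius
    1/2 on into the half-space where coordinate 0 is at most 0. This half-space is convex and misses
    the open cube, so on the boundary a straight line can lead on to \<open>\<rho>2\<close>.\<close>
  define \<rho>1 where "\<rho>1 t i = \<rho>0 t i - (if i = 0 then 4 * w t else 0)" for t i
  \<comment> \<open>Up to radius 1/2 this is the retraction of A onto Q, drawn to the corner a as w
    grows to 1, so it stays in Q. Beyond that radius only coordinate 0 moves and the value depends
    on the radius alone, as \<open>path_act\<close> requires.\<close>
  define \<rho>2 where "\<rho>2 t i = (1 - w t) * max (a i) (min (b i) (A t i)) + w t * a i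
      - (if i = 0 then 4 * max 0 (2 * rad n t - 1) else 0)" for t i
  have A_cont: "continuous_on S A" for S
    unfolding A_def by (intro continuous_on_coordinatewise_then_product continuous_on_If_const
        continuous_intros)
  have \<rho>0_cont: "continuous_on S \<rho>0" for S
    unfolding \<rho>0_def by (intro continuous_on_coordinatewise_then_product continuous_on_If_const
        continuous_intros)
  have w_cont: "continuous_on S w" for S
    unfolding w_def by (intro continuous_intros continuous_on_rad n)
  have \<rho>1_cont: "continuous_on S \<rho>1" for S
    unfolding \<rho>1_def
    by (intro continuous_on_coordinatewise_then_product continuous_on_If_const continuous_intros
        w_cont
        continuous_on_product_then_coordinatewise[OF \<rho>0_cont])
  have \<rho>2_cont: "continuous_on S \<rho>2" for S
    unfolding \<rho>2_def
    by (intro continuous_on_coordinatewise_then_product continuous_on_If_const continuous_intros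
        w_cont
        continuous_on_product_then_coordinatewise[OF A_cont] continuous_on_rad n)
  have Q_rad: "rad n t \<le> 1/4" if "dq (A t) \<le> 0" for t
    unfolding rad_le_iff[OF n]
  proof (intro allI impI)
    fix i assume i: "i < n"
    then have "a i \<le> A t i" "A t i \<le> b i" using that dq_le by auto
    then have "0 \<le> A t i" "A t i \<le> 1" using ab[OF i] by auto
    then show "\<bar>2 * t i - 1\<bar> \<le> 1/4"
      by (cases "i = 0") (simp_all only: A_def if_True if_False abs_le_iff, argo+)
  qed
  have w_Q: "w t = 0" if "dq (A t) \<le> 0" for t using Q_rad[OF that] by (simp add: w_def)
  have w1: "w t = 1" if "rad n t \<ge> 1/2" for t using that by (simp add: w_def)
  have w01: "0 \<le> w t" "w t \<le> 1" for t by (auto simp: w_def)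
  have P_Q: "\<rho>0 t i = A t i" "\<rho>1 t i = A t i" "\<rho>2 t i = A t i" if "dq (A t) \<le> 0" "i < n" for t i
  proof -
    have "A t 0 \<le> b 0" "b 0 \<le> 1" using that(1) dq_le ab n0 by auto
    then have "A t 0 \<le> 1" by simp
    then show 0: "\<rho>0 t i = A t i" by (auto simp: \<rho>0_def A_def)
    then show "\<rho>1 t i = A t i" using w_Q[OF that(1)] by (simp add: \<rho>1_def)
    have "a i \<le> A t i" "A t i \<le> b i" using that dq_le by auto
    then show "\<rho>2 t i = A t i" using w_Q[OF that(1)] Q_rad[OF that(1)] by (simp add: \<rho>2_def)
  qed
  \<comment> \<open>g is used over the copy of Q, and g' after P elsewhere. As g and g' agree on the
    boundary of Q, the result is continuous whenever P is continuous and equals A on the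
    copy.\<close>
  define H where "H P t = (if dq (A t) \<le> 0 then g (clamp n (A t)) else g' (clamp n (P t)))"
      for P :: "_ \<Rightarrow> nat \<Rightarrow> real" and t
  have H_homotopic: "(H P, H P') \<in> sph_homotopic n X x"
    if P: "continuous_on (cube n) P" "\<And>t i. dq (A t) \<le> 0 \<Longrightarrow> i < n \<Longrightarrow> P t i = A t i"
      and P': "continuous_on (cube n) P'" "\<And>t i. dq (A t) \<le> 0 \<Longrightarrow> i < n \<Longrightarrow> P' t i = A t i"
      and bd: "\<And>s t. 0 \<le> s \<Longrightarrow> s \<le> 1 \<Longrightarrow> t \<in> cube_boundary n \<Longrightarrow>
        \<exists>i<n. (1 - s) * P t i + s * P' t i \<le> 0 \<or> 1 \<le> (1 - s) * P t i + s * P' t i" for P P'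
  proof (rule sph_homotopicI[where h = "\<lambda>p. if dq (A (snd p)) \<le> 0 then g (clamp n (A (snd p)))
        else g' (clamp n (\<lambda>i. (1 - fst p) * P (snd p) i + fst p * P' (snd p) i))"])
    have Ac: "continuous_on S (\<lambda>p. A (snd p))" for S :: "(real \<times> (nat \<Rightarrow> real)) set"
      by (rule continuous_on_compose2[OF A_cont[of UNIV]]) (auto intro: continuous_intros)
    have c: "continuous_on ({0..1::real} \<times> cube n) (\<lambda>p. R (snd p) i)" if "continuous_on (cube n) R"
      for R :: "_ \<Rightarrow> nat \<Rightarrow> real" and i
      by (rule continuous_on_compose2[OF continuous_on_product_then_coordinatewise[OF that]])
        (auto intro!: continuous_intros)
    have "continuous_on ({0..1::real} \<times> cube n) (\<lambda>p i. (1 - fst p) * P (snd p) i + fst p * P'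
        (snd p) i)"
      by (intro continuous_intros c P P')
    then have Pc: "continuous_on {p \<in> {0..1::real} \<times> cube n. 0 \<le> dq (A (snd p))}
        (\<lambda>p i. (1 - fst p) * P (snd p) i + fst p * P' (snd p) i)"
      by (rule continuous_on_subset) auto
    show "continuous_map (top_of_set ({0..1::real} \<times> cube n)) X (\<lambda>p. if dq (A (snd p)) \<le>
        0 then g (clamp n (A (snd p)))
        else g' (clamp n (\<lambda>i. (1 - fst p) * P (snd p) i + fst p * P' (snd p) i)))"
    proof (rule continuous_map_top_of_set_If_le)
      show "continuous_map (top_of_set {p \<in> {0..1::real} \<times> cube n. dq (A (snd p)) \<le>
          0}) X (\<lambda>p. g (clamp n (A (snd p))))"
        using continuous_map_top_of_set_compose[OF _ Ac, of UNIV X "\<lambda>t. g (clamp n t)"]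
          spheroid_clamp_continuous[OF g] by simp
      show "continuous_map (top_of_set {p \<in> {0..1::real} \<times> cube n. 0 \<le> dq (A (snd p))}) X
          (\<lambda>p. g' (clamp n (\<lambda>i. (1 - fst p) * P (snd p) i + fst p * P' (snd p) i)))"
        using continuous_map_top_of_set_compose[OF _ Pc, of UNIV X "\<lambda>t. g' (clamp n t)"]
          spheroid_clamp_continuous[OF g'] by simp
      show "continuous_on ({0..1::real} \<times> cube n) (\<lambda>p. dq (A (snd p)))"
        by (rule continuous_on_compose2[OF dq_cont[of UNIV] Ac]) auto
      fix p assume p: "p \<in> {0..1::real} \<times> cube n" "dq (A (snd p)) = 0"
      have "(1 - fst p) * P (snd p) i + fst p * P' (snd p) i = A (snd p) i" if "i < n" for i
        using P(2)[of "snd p" i] P'(2)[of "snd p" i] p that by (simp add: algebra_simps)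
      then have "clamp n (\<lambda>i. (1 - fst p) * P (snd p) i + fst p * P' (snd p) i) =
          clamp n (A (snd p))"
        by (auto simp: clamp_def)
      moreover have "g (clamp n (A (snd p))) = g' (clamp n (A (snd p)))"
      proof (rule agree[OF clamp_in_cube])
        obtain i where i: "i < n" "A (snd p) i \<le> a i \<or> b i \<le> A (snd p) i"
            using dq_ge[of "A (snd p)"] p(2) by auto
        then show "\<exists>i<n. clamp n (A (snd p)) i \<le> a i \<or> b i \<le> clamp n (A (snd p)) i"
          using ab[OF i(1)] by (intro exI[of _ i]) (auto simp: clamp_def)
      qed
      ultimately show "g (clamp n (A (snd p))) =
          g' (clamp n (\<lambda>i. (1 - fst p) * P (snd p) i + fst p * P' (snd p) i))" by simp
    qed auto
    fix t assume t: "t \<in> cube n"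
    show "(if dq (A (snd (0, t))) \<le> 0 then g (clamp n (A (snd (0, t))))
        else g' (clamp n (\<lambda>i. (1 - fst (0, t)) * P (snd (0, t)) i + fst (0, t) * P' (snd (0, t))
            i))) = H P t"
      by (simp add: H_def)
    show "(if dq (A (snd (1, t))) \<le> 0 then g (clamp n (A (snd (1, t))))
        else g' (clamp n (\<lambda>i. (1 - fst (1, t)) * P (snd (1, t)) i + fst (1, t) * P' (snd (1, t))
            i))) = H P' t"
      by (simp add: H_def)
  next
    fix s t assume s: "0 \<le> s" "s \<le> (1::real)" and t: "t \<in> cube_boundary n"
    have "\<not> dq (A t) \<le> 0" using Q_rad[of t] rad_boundary[OF n t] by auto
    moreover obtain i where "i < n" "(1 - s) * P t i + s * P' t i \<le> 0 \<or> 1 \<le>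
        (1 - s) * P t i + s * P' t i"
      using bd[OF s t] by blast
    then have "g' (clamp n (\<lambda>i. (1 - s) * P t i + s * P' t i)) = x"
      by (intro spheroid_clamp_base[OF g', of i]) auto
    ultimately show "(if dq (A (snd (s, t))) \<le> 0 then g (clamp n (A (snd (s, t))))
        else g' (clamp n (\<lambda>i. (1 - fst (s, t)) * P (snd (s, t)) i + fst (s, t) * P' (snd (s, t))
            i))) = x"
      by simp
  qed
  have K: "sph_concat g (sph_reverse g') \<in> spheroids n X x"
    using sph_concat_spheroids[OF n g sph_reverse_spheroids[OF n g']] .
  \<comment> \<open>The homotopy is the dilation about the centre of the cube from t to 4t - 3/2,
    under which every face moves outwards.\<close>
  have 1: "(sph_concat g (sph_reverse g'), H \<rho>0) \<in> sph_homotopic n X x"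
  proof (rule sph_homotopic_straight_line[OF K, where P = "\<lambda>t. t" and Q = "\<lambda>t i. 4 * t i - 3/2"])
    fix s :: real and t assume s: "0 \<le> s" "s \<le> 1" "t \<in> cube_boundary n"
    then obtain i where "i < n" "t i = 0 \<or> t i = 1" by (auto elim: cube_boundaryE)
    then show "\<exists>i<n. (1 - s) * t i + s * (4 * t i - 3/2) \<le> 0 \<or> 1 \<le>
        (1 - s) * t i + s * (4 * t i - 3/2)"
      using s by (intro exI[of _ i]) auto
  next
    fix t assume t: "t \<in> cube n"
    define z where "z = clamp n (\<lambda>i. 4 * t i - 3/2)"
    have z0: "z 0 = max 0 (min 1 (4 * t 0 - 3/2))" using n0 by (simp add: z_def clamp_def)
    show "H \<rho>0 t = sph_concat g (sph_reverse g') z"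
    proof (cases "4 * t 0 - 3/2 \<le> 1/2")
      case True
      then have "z 0 \<le> 1/2" by (simp add: z0 max_def)
      moreover have "z(0 := 2 * z 0) = clamp n (A t)"
        using True n0 by (auto simp: z_def clamp_def A_def fun_eq_iff max_def)
      ultimately have v: "sph_concat g (sph_reverse g') z = g (clamp n (A t))"
        by (simp add: sph_concat_def)
      have "g (clamp n (A t)) = g' (clamp n (\<rho>0 t))" if "\<not> dq (A t) \<le> 0"
      proof -
        have "\<rho>0 t = A t" using True by (auto simp: \<rho>0_def A_def fun_eq_iff)
        moreover have "g (clamp n (A t)) = g' (clamp n (A t))"
        proof (rule agree[OF clamp_in_cube])
          obtain i where i: "i < n" "A t i \<le> a i \<or> b i \<le> A t i"
              using dq_ge[of "A t"] \<open>\<not> dq (A t) \<le> 0\<close> by auto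
          then show "\<exists>i<n. clamp n (A t) i \<le> a i \<or> b i \<le> clamp n (A t) i"
            using ab[OF i(1)] by (intro exI[of _ i]) (auto simp: clamp_def)
        qed
        ultimately show ?thesis by simp
      qed
      then show ?thesis by (simp add: v H_def)
    next
      case False
      then have "\<not> z 0 \<le> 1/2" by (simp add: z0 min_def)
      moreover have "(z(0 := 2 * z 0 - 1))(0 := 1 - (z(0 := 2 * z 0 - 1)) 0) = clamp n (\<rho>0 t)"
        using False n0 by (auto simp: z_def clamp_def \<rho>0_def fun_eq_iff max_def min_def)
      ultimately have "sph_concat g (sph_reverse g') z = g' (clamp n (\<rho>0 t))"
        by (simp add: sph_concat_def sph_reverse_def)
      \<comment> \<open>In the second half, coordinate 0 of A exceeds 1 and hence
        \<open>b 0\<close>, so the copy of Q is not met.\<close>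
      moreover have "\<not> dq (A t) \<le> 0"
      proof
        assume "dq (A t) \<le> 0"
        then have "A t 0 \<le> b 0" "b 0 \<le> 1" using dq_le ab n0 by auto
        with False show False by (simp add: A_def)
      qed
      ultimately show ?thesis by (simp add: H_def)
    qed
    show "sph_concat g (sph_reverse g') t = sph_concat g (sph_reverse g') (clamp n t)"
      using clamp_id[OF t] by simp
  qed (auto intro!: continuous_intros)
  have 2: "(H \<rho>0, H \<rho>1) \<in> sph_homotopic n X x"
  proof (rule H_homotopic)
    fix s :: real and t assume s: "0 \<le> s" "s \<le> 1" "t \<in> cube_boundary n"
    then obtain i where i: "i < n" "t i = 0 \<or> t i = 1" by (auto elim: cube_boundaryE)
    have "(1 - s) * \<rho>0 t i + s * \<rho>1 t i = \<rho>0 t i - (if i = 0 then 4 * (s * w t) else 0)"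
      by (simp add: \<rho>1_def algebra_simps)
    moreover have "0 \<le> s * w t" using s w01 by simp
    \<comment> \<open>Only coordinate 0 is lowered, and the fold already makes it negative on both
      faces in that direction; on the remaining faces the decisive coordinate is left alone.\<close>
    moreover have "\<rho>0 t i \<le> 0 \<or> i \<noteq> 0 \<and> 1 \<le> \<rho>0 t i" using i(2) by (auto simp: \<rho>0_def)
    ultimately show "\<exists>i<n. (1 - s) * \<rho>0 t i + s * \<rho>1 t i \<le> 0 \<or> 1 \<le> (1 - s) * \<rho>0 t i + s * \<rho>1 t i"
      using i(1) by (intro exI[of _ i]) auto
  qed (auto intro: \<rho>0_cont \<rho>1_cont P_Q)
  have 3: "(H \<rho>1, H \<rho>2) \<in> sph_homotopic n X x"
  proof (rule H_homotopic)
    fix s :: real and t assume s: "0 \<le> s" "s \<le> 1" "t \<in> cube_boundary n"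
    have r: "rad n t = 1" using rad_boundary[OF n s(3)] .
    have "\<rho>1 t 0 \<le> 0" using w1[of t] r by (simp add: \<rho>1_def \<rho>0_def)
    moreover have "\<rho>2 t 0 \<le> 0" using w1[of t] r ab[OF n0] by (simp add: \<rho>2_def)
    ultimately have "(1 - s) * \<rho>1 t 0 + s * \<rho>2 t 0 \<le> 0"
      using s by (intro add_nonpos_nonpos mult_nonneg_nonpos) auto
    then show "\<exists>i<n. (1 - s) * \<rho>1 t i + s * \<rho>2 t i \<le> 0 \<or> 1 \<le> (1 - s) * \<rho>1 t i + s * \<rho>2 t i"
      using n0 by blast
  qed (auto intro: \<rho>2_cont \<rho>1_cont P_Q)
  \<comment> \<open>The path starts outside the cube, where coordinate 0 is \<open>a 0\<close> - 4,
    and ends at the corner a of Q.\<close>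
  define \<alpha> where "\<alpha> \<tau> = g' (clamp n (\<lambda>i. a i - (if i = 0 then 4 * (1 - \<tau>) else 0)))" for \<tau> :: real
  \<comment> \<open>The inverse of the rescaling of the inner cube in
    \<open>path_act\<close>.\<close>
  define T where "T u i = (if i < n then u i / 2 + 1/4 else 0)" for u :: "nat \<Rightarrow> real" and i
  define e where "e u = H \<rho>2 (T u)" for u
  have T_cube: "T u \<in> cube n" if "u \<in> cube n" for u using that by (auto simp: T_def cube_def)
  have T_rad: "rad n (T u) \<le> 1/2" if "u \<in> cube n" for u
    unfolding rad_le_iff[OF n]
  proof (intro allI impI)
    fix i assume "i < n"
    then have "0 \<le> u i" "u i \<le> 1" using that by (auto simp: cube_def)
    then show "\<bar>2 * T u i - 1\<bar> \<le> 1/2" using \<open>i < n\<close> by (simp only: T_def if_True abs_le_iff, argo)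
  qed
  have \<alpha>: "pathin X \<alpha>"
  proof -
    have c: "continuous_on {0..1} (\<lambda>\<tau> i. a i - (if i = 0 then 4 * (1 - \<tau>) else 0))"
      by (intro continuous_on_coordinatewise_then_product continuous_on_diff
          continuous_on_If_const continuous_intros)
    show ?thesis
      using continuous_map_top_of_set_compose[OF _ c, of UNIV X "\<lambda>t. g' (clamp n t)"]
        spheroid_clamp_continuous[OF g'] by (simp add: pathin_def \<alpha>_def[abs_def])
  qed
  have \<alpha>0: "\<alpha> 0 = x"
    unfolding \<alpha>_def using ab[OF n0] by (intro spheroid_clamp_base[OF g' n0]) auto
  have e: "continuous_map (top_of_set (cube n)) X e"
    unfolding e_def
  proof (rule continuous_map_top_of_set_compose[of "cube n" X "H \<rho>2" "cube n" T])
    show "continuous_map (top_of_set (cube n)) X (H \<rho>2)"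
      using sph_homotopic_spheroids(2)[OF 3] by (simp add: spheroids_iff)
    show "continuous_on (cube n) T"
      unfolding T_def by (intro continuous_on_coordinatewise_then_product continuous_on_If_const
          continuous_intros) auto
  qed (use T_cube in auto)
  have outer: "H \<rho>2 t = \<alpha> (2 - 2 * rad n t)" if "1/2 \<le> rad n t" for t
  proof -
    have "\<not> dq (A t) \<le> 0" using Q_rad[of t] that by auto
    moreover have "\<rho>2 t = (\<lambda>i. a i - (if i = 0 then 4 * (1 - (2 - 2 * rad n t)) else 0))"
      using w1[OF that] that by (auto simp: \<rho>2_def fun_eq_iff)
    ultimately show ?thesis by (simp add: H_def \<alpha>_def)
  qed
  have e_bd: "e u = \<alpha> 1" if u: "u \<in> cube_boundary n" for u
  proof -
    have uc: "u \<in> cube n" using u cube_boundary_subset by blast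
    obtain i where i: "i < n" "u i = 0 \<or> u i = 1" using u by (rule cube_boundaryE)
    then have "\<bar>2 * T u i - 1\<bar> = 1/2" by (auto simp: T_def)
    moreover have "\<bar>2 * T u i - 1\<bar> \<le> rad n (T u)"
        using rad_le_iff[OF n, of "T u" "rad n (T u)"] i by simp
    ultimately have "rad n (T u) = 1/2" using T_rad[OF uc] by simp
    moreover from this have "2 - 2 * rad n (T u) = 1" by simp
    ultimately show ?thesis using outer[of "T u"] by (simp add: e_def)
  qed
  have clamp_box: "\<forall>i<n. a i \<le> clamp n z i \<and> clamp n z i \<le> b i" if "\<forall>i<n. a i \<le> z i \<and> z i \<le> b i"
      for z
  proof (intro allI impI)
    fix i assume i: "i < n"
    then have "a i \<le> z i" "z i \<le> b i" using that by auto
    then show "a i \<le> clamp n z i \<and> clamp n z i \<le> b i" using ab[OF i] i by (simp add: clamp_def)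
  qed
  have e_U: "e u \<in> U" if u: "u \<in> cube n" for u
  proof (cases "dq (A (T u)) \<le> 0")
    case True
    then have "\<forall>i<n. a i \<le> A (T u) i \<and> A (T u) i \<le> b i" using dq_le by simp
    then have "\<forall>i<n. a i \<le> clamp n (A (T u)) i \<and> clamp n (A (T u)) i \<le> b i"
      by (rule clamp_box)
    then show ?thesis using True U(2)[OF clamp_in_cube] by (simp add: e_def H_def)
  next
    case False
    let ?c = "\<lambda>i. max (a i) (min (b i) (A (T u) i))"
    have "a i \<le> \<rho>2 (T u) i \<and> \<rho>2 (T u) i \<le> b i" if "i < n" for i
    proof -
      have "\<rho>2 (T u) i = (1 - w (T u)) * ?c i + w (T u) * a i"
        using T_rad[OF u] by (simp add: \<rho>2_def)
      moreover have "a i \<le> ?c i" "?c i \<le> b i" using ab[OF that] by auto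
      then have "(1 - w (T u)) * a i \<le> (1 - w (T u)) * ?c i" "(1 - w (T u)) * ?c i \<le>
          (1 - w (T u)) * b i"
        "w (T u) * a i \<le> w (T u) * b i"
        using w01 ab[OF that] by (auto intro!: mult_left_mono)
      ultimately show ?thesis by (auto simp: algebra_simps)
    qed
    then have "\<forall>i<n. a i \<le> \<rho>2 (T u) i \<and> \<rho>2 (T u) i \<le> b i" by simp
    then have "\<forall>i<n. a i \<le> clamp n (\<rho>2 (T u)) i \<and> clamp n (\<rho>2 (T u)) i \<le> b i"
      by (rule clamp_box)
    then show ?thesis using False U(2)[OF clamp_in_cube] by (simp add: e_def H_def)
  qed
  have "(H \<rho>2, path_act n \<alpha> e) \<in> sph_homotopic n X x"
  proof (rule sph_homotopic_eq_on_cube[OF sph_homotopic_spheroids(2)[OF 3]])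
    fix t assume t: "t \<in> cube n"
    have "T (\<lambda>i. if i < n then 2 * t i - 1/2 else 0) = t"
      using t by (auto simp: T_def cube_def fun_eq_iff field_simps)
    then show "H \<rho>2 t = path_act n \<alpha> e t"
      using outer[of t] by (simp add: path_act_eq e_def)
  qed
  with 1 2 3 have "(sph_concat g (sph_reverse g'), path_act n \<alpha> e) \<in> sph_homotopic n X x"
    by (blast intro: sph_homotopic_trans)
  then have "sph_class n X x (sph_concat g (sph_reverse g')) = sph_class n X x (path_act n \<alpha> e)"
    by (rule sph_class_eqI)
  then show ?thesis
    using path_act_in_spanier_generators[OF n \<alpha> \<alpha>0 e e_bd U(1) e_U] by simp
qed

section \<open>Spanier groups lie in the kernel\<close>

lemma cube_collapse_compose:
  assumes n: "n \<ge> 1" and f: "continuous_map (nsphere n) X f" "f sphere_base = y"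
  shows "continuous_map (top_of_set (cube n)) X (f \<circ> cube_collapse n)"
    and "\<And>t. t \<in> cube_boundary n \<Longrightarrow> (f \<circ> cube_collapse n) t = y"
    and "\<And>t. t \<in> cube n \<Longrightarrow> (f \<circ> cube_collapse n) t \<in> f ` topspace (nsphere n)"
proof -
  show "continuous_map (top_of_set (cube n)) X (f \<circ> cube_collapse n)"
    using continuous_map_compose[OF quotient_imp_continuous_map[OF quotient_map_cube_collapse[OF
        n]] f(1)] .
  show "(f \<circ> cube_collapse n) t = y" if "t \<in> cube_boundary n" for t
    using cube_collapse_eq_base[OF n, of t] that cube_boundary_subset[of n] f(2)
        by (auto simp: cube_space_eq)
  show "(f \<circ> cube_collapse n) t \<in> f ` topspace (nsphere n)" if "t \<in> cube n" for t
    using cube_collapse_in_nsphere[OF n, of t] that by (simp add: cube_space_eq)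
qed

lemma spanier_generators_carrier:
  assumes n: "n \<ge> 1"
  shows "spanier_generators n X \<U> x \<subseteq> carrier (homotopy_group n X x)"
proof
  fix A assume "A \<in> spanier_generators n X \<U> x"
  then obtain \<alpha> f where A: "A = sph_class n X x (path_act n \<alpha> (f \<circ> cube_collapse n))"
    and \<alpha>: "pathin X \<alpha>" "\<alpha> 0 = x" and f: "continuous_map (nsphere n) X f" "f sphere_base = \<alpha> 1"
    by (auto simp: spanier_generators_def)
  have "path_act n \<alpha> (f \<circ> cube_collapse n) \<in> spheroids n X (\<alpha> 0)"
    using path_act_spheroid[OF n \<alpha>(1) cube_collapse_compose(1,2)[OF n f]] .
  then show "A \<in> carrier (homotopy_group n X x)"
    by (simp add: A \<alpha>(2) sph_class_in_carrier)
qed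

text \<open>On the preimage of an open star, the straight-line contraction to the vertex drags the
  base point of the sphere along \<beta>; \<open>path_act_null\<close> absorbs this free motion into
  the path.\<close>

lemma induced_map_spanier_generator:
  assumes n: "n \<ge> 1" and p: "continuous_map X (realization K) p" "p x = y" and K: "\<And>\<sigma>. \<sigma> \<in> K \<Longrightarrow>
      finite \<sigma>"
    and A: "A \<in> spanier_generators n X ((\<lambda>v. {z \<in> topspace X. p z \<in> open_star K v}) ` V) x"
  shows "induced_map n (realization K) y p A = \<one>\<^bsub>homotopy_group n (realization K) y\<^esub>"
proof -
  obtain \<alpha> f v where A: "A = sph_class n X x (path_act n \<alpha> (f \<circ> cube_collapse n))"
    and \<alpha>: "pathin X \<alpha>" "\<alpha> 0 = x" and f: "continuous_map (nsphere n) X f" "f sphere_base = \<alpha> 1"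
    and v: "f ` topspace (nsphere n) \<subseteq> {z \<in> topspace X. p z \<in> open_star K v}"
    using A by (auto simp: spanier_generators_def)
  define e where "e = f \<circ> cube_collapse n"
  have e: "continuous_map (top_of_set (cube n)) X e" "\<And>t. t \<in> cube_boundary n \<Longrightarrow> e t = \<alpha> 1"
    using cube_collapse_compose(1,2)[OF n f] by (simp_all add: e_def)
  have ev: "p (e t) \<in> open_star K v" if "t \<in> cube n" for t
    using cube_collapse_compose(3)[OF n f that] v by (auto simp: e_def)
  define E where "E s t w = (1 - s) * p (e t) w + s * vertex v w" for s :: real and t w
  define \<beta> where "\<beta> s w = (1 - s) * p (\<alpha> 1) w + s * vertex v w" for s :: real and w
  have Ec: "continuous_map (top_of_set ({0..1::real} \<times> cube n)) (realization K) (\<lambda>(s, t). E s t)"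
  proof -
    have "compact_space (top_of_set (cube n))"
      using compact_cube by (simp add: compact_space_subtopology)
    moreover have "continuous_map (top_of_set (cube n)) (realization K) (\<lambda>t. p (e t))"
      using continuous_map_compose[OF e(1) p(1)] by (simp add: o_def)
    ultimately have "continuous_map (prod_topology (top_of_set {0..1}) (top_of_set (cube n)))
        (realization K)
        (\<lambda>(s, t) w. (1 - s) * p (e t) w + s * vertex v w)"
      by (rule open_star_contraction) (use ev K in auto)
    then show ?thesis by (simp add: E_def[abs_def])
  qed
  have z: "(\<lambda>_. 0) \<in> cube_boundary n" "(\<lambda>_. 0) \<in> cube n"
    using n by (auto simp: cube_boundary_eq cube_def intro!: exI[of _ 0])
  have \<beta>: "pathin (realization K) \<beta>"
  proof -
    have "continuous_on {0..1::real} (\<lambda>s. (s, (\<lambda>_. 0) :: nat \<Rightarrow> real))" by (intro continuous_intros)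
    from continuous_map_top_of_set_compose[OF Ec this] z(2)
    have "continuous_map (top_of_set {0..1}) (realization K) (\<lambda>s. E s (\<lambda>_. 0))"
        by (simp add: image_subset_iff)
    moreover have "E s (\<lambda>_. 0) = \<beta> s" for s using e(2)[OF z(1)]
        by (simp add: E_def[abs_def] \<beta>_def[abs_def])
    ultimately show ?thesis by (simp add: pathin_def)
  qed
  have "(path_act n (p \<circ> \<alpha>) (E 0), \<lambda>_. (p \<circ> \<alpha>) 0) \<in> sph_homotopic n (realization K) ((p \<circ> \<alpha>) 0)"
  proof (rule path_act_null[OF n _ Ec _ \<beta>])
    show "pathin (realization K) (p \<circ> \<alpha>)"
      using continuous_map_compose[OF \<alpha>(1)[unfolded pathin_def] p(1)] by (simp add: pathin_def)
    show "E s t = \<beta> s" if "t \<in> cube_boundary n" for s t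
      using e(2)[OF that] by (simp add: E_def[abs_def] \<beta>_def[abs_def])
  qed (simp_all add: E_def[abs_def] \<beta>_def[abs_def])
  moreover have "E 0 = p \<circ> e" by (simp add: E_def fun_eq_iff)
  moreover have "path_act n (p \<circ> \<alpha>) (p \<circ> e) = p \<circ> path_act n \<alpha> e"
      by (simp add: path_act_eq fun_eq_iff)
  ultimately have "sph_class n (realization K) y (p \<circ> path_act n \<alpha> e) =
      sph_class n (realization K) y (\<lambda>_. y)"
    using \<alpha>(2) p(2) by (intro sph_class_eqI) simp
  moreover have "path_act n \<alpha> e \<in> spheroids n X x"
    using path_act_spheroid[OF n \<alpha>(1) e] \<alpha>(2) by simp
  ultimately show ?thesis
    by (simp add: A e_def[symmetric] induced_map_sph_class[OF p] one_homotopy_group)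
qed

lemma canonical_map_SOME:
  assumes "x0 \<in> topspace X" "(\<U>, U0) \<in> pointed_covers X x0" "p =
      (SOME p. canonical_map X x0 (\<U>, U0) p)"
  shows "continuous_map X (realization (nerve \<U>)) p" "p x0 = vertex U0"
    "\<And>U. U \<in> \<U> \<Longrightarrow> {x \<in> topspace X. p x \<in> open_star (nerve \<U>) U} \<subseteq> U"
proof -
  have "canonical_map X x0 (\<U>, U0) p"
    unfolding assms(3) by (rule someI_ex[OF canonical_map_exists[OF assms(1,2)]])
  then show "continuous_map X (realization (nerve \<U>)) p" "p x0 = vertex U0"
    "\<And>U. U \<in> \<U> \<Longrightarrow> {x \<in> topspace X. p x \<in> open_star (nerve \<U>) U} \<subseteq> U"
    by (simp_all add: canonical_map_def)
qed

text \<open>The limit inherits its unit from the product, so membership in the kernel is tested one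
  pointed cover at a time.\<close>

lemma kernel_shape_hom_iff:
  "A \<in> kernel (homotopy_group n X x0) (shape_group n X x0) (shape_hom n X x0) \<longleftrightarrow>
     A \<in> carrier (homotopy_group n X x0) \<and>
     (\<forall>(\<U>, U0)\<in>pointed_covers X x0.
        induced_map n (realization (nerve \<U>)) (vertex U0) (SOME p. canonical_map X x0 (\<U>, U0) p) A =
        \<one>\<^bsub>homotopy_group n (realization (nerve \<U>)) (vertex U0)\<^esub>)"
proof -
  have 1: "\<one>\<^bsub>shape_group n X x0\<^esub> = (\<lambda>i\<in>pointed_covers X x0. \<one>\<^bsub>nerve_homotopy_group n i\<^esub>)"
    by (simp add: shape_group_def)
  have "shape_hom n X x0 A = \<one>\<^bsub>shape_group n X x0\<^esub> \<longleftrightarrow>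
      (\<forall>i\<in>pointed_covers X x0. nerve_induced n i (SOME p. canonical_map X x0 i p) A =
          \<one>\<^bsub>nerve_homotopy_group n i\<^esub>)"
    unfolding 1 shape_hom_def by (auto simp: fun_eq_iff restrict_def)
  then show ?thesis
    by (auto simp: kernel_def nerve_induced_def nerve_homotopy_group_def)
qed

lemma open_cover_topspace:
  "open_cover X {topspace X}"
  by (simp add: open_cover_def)

theorem spanier_group_subset_kernel:
  assumes n: "n \<ge> 1" and x0: "x0 \<in> topspace X"
  shows "spanier_group n X x0 \<subseteq> kernel (homotopy_group n X x0) (shape_group n X x0) (shape_hom n
      X x0)"
proof
  fix A assume A: "A \<in> spanier_group n X x0"
  note G = group_homotopy_group[OF n x0]
  \<comment> \<open>One particular cover is enough to know that A is an element of the homotopy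
    group at all.\<close>
  have "A \<in> spanier_group_cover n X {topspace X} x0"
    using A open_cover_topspace by (auto simp: spanier_group_def)
  then have "A \<in> carrier (homotopy_group n X x0)"
    using group.generate_incl[OF G spanier_generators_carrier[OF n]]
        by (auto simp: spanier_group_cover_def)
  moreover have "induced_map n (realization (nerve \<U>)) (vertex U0) (SOME p. canonical_map X x0
      (\<U>, U0) p) A =
        \<one>\<^bsub>homotopy_group n (realization (nerve \<U>)) (vertex U0)\<^esub>"
    if i: "(\<U>, U0) \<in> pointed_covers X x0" for \<U> U0
  proof -
    define p where "p = (SOME p. canonical_map X x0 (\<U>, U0) p)"
    note p = canonical_map_SOME[OF x0 i p_def]
    let ?K = "nerve \<U>"
    define \<V> where "\<V> = (\<lambda>U. {z \<in> topspace X. p z \<in> open_star ?K U}) ` \<U>"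
    have "open_cover X \<V>"
      unfolding open_cover_def
    proof (intro conjI ballI equalityI subsetI)
      show "openin X V" if "V \<in> \<V>" for V
        using that openin_continuous_map_preimage[OF p(1) openin_open_star] by (auto simp: \<V>_def)
      fix z assume z: "z \<in> topspace X"
      then have "p z \<in> topspace (realization ?K)"
        using continuous_map_image_subset_topspace[OF p(1)] by blast
      then obtain U where "U \<in> \<U>" "p z \<in> open_star ?K U" by (rule open_star_cover)
      then show "z \<in> \<Union>\<V>" using z by (auto simp: \<V>_def)
    qed (auto simp: \<V>_def)
    then have AV: "A \<in> generate (homotopy_group n X x0) (spanier_generators n X \<V> x0)"
      using A by (auto simp: spanier_group_def spanier_group_cover_def)
    let ?H = "homotopy_group n (realization ?K) (vertex U0)"
    have "vertex U0 \<in> topspace (realization ?K)"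
      using continuous_map_image_subset_topspace[OF p(1)] x0 p(2) by (metis image_subset_iff)
    then have hom: "group_hom (homotopy_group n X x0) ?H (induced_map n (realization ?K) (vertex
        U0) p)"
      using G group_homotopy_group[OF n] induced_map_hom[OF n p(1,2)]
      by (simp add: group_hom_def group_hom_axioms_def)
    let ?ker = "kernel (homotopy_group n X x0) ?H (induced_map n (realization ?K) (vertex U0) p)"
    have "spanier_generators n X \<V> x0 \<subseteq> ?ker"
    proof
      fix B assume B: "B \<in> spanier_generators n X \<V> x0"
      then have "induced_map n (realization ?K) (vertex U0) p B = \<one>\<^bsub>?H\<^esub>"
        unfolding \<V>_def by (intro induced_map_spanier_generator[OF n p(1,2)] nerve_finite)
      then show "B \<in> ?ker" using subsetD[OF spanier_generators_carrier[OF n] B]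
          by (simp add: kernel_def)
    qed
    then have "generate (homotopy_group n X x0) (spanier_generators n X \<V> x0) \<subseteq> ?ker"
      by (rule group.generate_subgroup_incl[OF G _ group_hom.subgroup_kernel[OF hom]])
    then show ?thesis using AV by (auto simp: kernel_def p_def)
  qed
  ultimately show "A \<in> kernel (homotopy_group n X x0) (shape_group n X x0) (shape_hom n X x0)"
    unfolding kernel_shape_hom_iff by auto
qed

section \<open>Filling cubes\<close>

definition cube_fill :: "nat \<Rightarrow> 'a topology \<Rightarrow> 'a set \<Rightarrow> 'a set \<Rightarrow> bool" where
  "cube_fill d X A B \<longleftrightarrow>
     (\<forall>f. continuous_map (top_of_set (cube_boundary d)) (subtopology X A) f \<longrightarrow>
        (\<exists>g. continuous_map (top_of_set (cube d)) (subtopology X B) g \<and>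
            (\<forall>t\<in>cube_boundary d. g t = f t)))"

text \<open>It suffices to have maps \<open>a : I\<^sup>d \<rightarrow> \<Delta>\<^sub>d\<close> and \<open>b : \<partial>\<Delta>\<^sub>d \<rightarrow> \<partial>I\<^sup>d\<close> with
  \<open>b \<circ> a = id\<close> on \<open>\<partial>I\<^sup>d\<close>. Both are radial about the centres; the denominator of \<open>a\<close> is cut off below
  by a value not exceeding its minimum on \<open>\<partial>I\<^sup>d\<close>.\<close>

lemma cube_fill_if_simplex_fill:
  assumes d: "d \<ge> 1" and fill: "simplex_fill d X A B"
  shows "cube_fill d X A B"
  unfolding cube_fill_def
proof (intro allI impI)
  fix f assume f: "continuous_map (top_of_set (cube_boundary d)) (subtopology X A) f"
  let ?bd = "{x \<in> standard_simplex d. \<exists>i\<le>d. x i = 0}"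
  \<comment> \<open>Coordinates about the centre of the cube, completed by an entry at d that makes
    the sum 0: a direction tangent to the simplex.\<close>
  define v where "v t i = (if i < d then 2 * t i - 1 else if i =
      d then - (\<Sum>j<d. 2 * t j - 1) else 0)" for t :: "nat \<Rightarrow> real" and i
  \<comment> \<open>The gauge of the simplex about its barycentre: a displacement by v/m, divided by
    d + 1, makes the least barycentric coordinate vanish.\<close>
  define m where "m t = Max ((\<lambda>i. - v t i) ` {..d})" for t
  \<comment> \<open>On the cube boundary m is at least 1/d, so the cutoff leaves the values there
    unchanged; near the centre it keeps the denominator positive.\<close>
  define M where "M t = max (m t) (1 / real d)" for t
  define a where "a t i = (if i \<le> d then (1 + v t i / M t) / (real d + 1) else 0)" for t i
  \<comment> \<open>The sup-norm distance from the barycentre in the first d coordinates; dividing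
    by it projects radially to the boundary of the cube.\<close>
  define \<mu> where "\<mu> y = Max ((\<lambda>i. \<bar>y i - 1 / (real d + 1)\<bar>) ` {..<d})" for y :: "nat \<Rightarrow> real"
  define b where "b y i = (if i < d then ((y i - 1 / (real d + 1)) / \<mu> y + 1) / 2 else 0)" for y i
  have M0: "M t > 0" for t using d by (simp add: M_def less_max_iff_disj)
  have v_le: "- v t i \<le> m t" if "i \<le> d" for t i using that by (auto simp: m_def intro!: Max_ge)
  have v_sum: "(\<Sum>i\<le>d. v t i) = 0" for t
    by (simp add: lessThan_Suc_atMost[symmetric] v_def)
  have v_cont: "continuous_on S (\<lambda>t. v t i)" for S i
    unfolding v_def by (intro continuous_on_If_const continuous_intros)
  have m_cont: "continuous_on S m" for S
    unfolding m_def by (intro continuous_on_Max continuous_on_minus v_cont) auto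
  have a_cont: "continuous_on S a" for S
  proof (intro continuous_on_coordinatewise_then_product)
    fix i
    have "M t \<noteq> 0" for t using M0[of t] by simp
    then show "continuous_on S (\<lambda>t. a t i)"
      unfolding a_def M_def
      by (intro continuous_on_If_const continuous_intros v_cont m_cont ballI) (auto simp: M_def)
  qed
  have a_simplex: "a t \<in> standard_simplex d" for t
  proof -
    have nn: "0 \<le> a t i" for i
    proof (cases "i \<le> d")
      case True
      then have "- v t i \<le> M t" using v_le[of i t] by (simp add: M_def)
      then have "- 1 \<le> v t i / M t" using M0[of t] by (simp add: pos_le_divide_eq)
      then show ?thesis using True by (simp add: a_def)
    qed (simp add: a_def)
    have "(\<Sum>i\<le>d. a t i) = (\<Sum>i\<le>d. 1 + v t i / M t) / (real d + 1)"
      by (simp add: a_def sum_divide_distrib)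
    also have "(\<Sum>i\<le>d. 1 + v t i / M t) = real d + 1 + (\<Sum>i\<le>d. v t i) / M t"
      by (simp add: sum.distrib sum_divide_distrib)
    finally have s: "(\<Sum>i\<le>d. a t i) = 1" using v_sum by simp
    have "a t i \<le> 1" for i
    proof (cases "i \<le> d")
      case True
      then have "a t i \<le> (\<Sum>i\<le>d. a t i)" using nn by (intro member_le_sum) auto
      then show ?thesis using s by simp
    qed (simp add: a_def)
    then show ?thesis using nn s by (simp add: standard_simplex_def a_def)
  qed
  have m_bd: "1 / real d \<le> m t" if t: "t \<in> cube_boundary d" for t
  proof -
    obtain i where i: "i < d" "t i = 0 \<or> t i = 1" using t by (rule cube_boundaryE)
    show ?thesis
    proof (cases "t i = 0")
      case True
      then have "1 \<le> m t" using v_le[of i t] i(1) by (simp add: v_def)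
      moreover have "1 / real d \<le> 1" using d by simp
      ultimately show ?thesis by linarith
    next
      case False
      \<comment> \<open>The other d entries then sum to -1, so the largest of their negatives is at
        least the average 1/d.\<close>
      then have "v t i = 1" using i by (simp add: v_def)
      then have "(\<Sum>j\<in>{..d} - {i}. - v t j) = 1"
        using v_sum[of t] i(1) by (simp add: sum.remove[of "{..d}" i] sum_negf)
      moreover have "(\<Sum>j\<in>{..d} - {i}. - v t j) \<le> (\<Sum>j\<in>{..d} - {i}. m t)"
        using v_le by (intro sum_mono) auto
      moreover have "card ({..d} - {i}) = d" using i(1) by simp
      ultimately have "1 \<le> real d * m t" by simp
      then show ?thesis using d by (simp add: pos_divide_le_eq mult.commute)
    qed
  qed
  have a_bd: "a t \<in> ?bd" if t: "t \<in> cube_boundary d" for t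
  proof -
    have "m t \<in> (\<lambda>i. - v t i) ` {..d}" unfolding m_def by (intro Max_in) auto
    then obtain i where i: "i \<le> d" "m t = - v t i" by auto
    have "M t = m t" using m_bd[OF t] by (simp add: M_def)
    then have "v t i / M t = - 1" using i(2) M0[of t] by (simp add: divide_eq_eq)
    then have "a t i = 0" using i(1) by (simp add: a_def)
    then show ?thesis using a_simplex i(1) by blast
  qed
  have \<mu>_le: "\<bar>y i - 1 / (real d + 1)\<bar> \<le> \<mu> y" if "i < d" for y i
    using that by (auto simp: \<mu>_def intro!: Max_ge)
  have \<mu>_in: "\<exists>i<d. \<bar>y i - 1 / (real d + 1)\<bar> = \<mu> y" for y
  proof -
    have "\<mu> y \<in> (\<lambda>i. \<bar>y i - 1 / (real d + 1)\<bar>) ` {..<d}"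
      unfolding \<mu>_def using d by (intro Max_in) (auto simp: lessThan_empty_iff)
    then show ?thesis by auto
  qed
  have \<mu>0: "\<mu> y > 0" if y: "y \<in> ?bd" for y
  proof (rule ccontr)
    assume "\<not> \<mu> y > 0"
    then have eq: "y i = 1 / (real d + 1)" if "i < d" for i using \<mu>_le[OF that, of y] by simp
    have "(\<Sum>i\<le>d. y i) = 1" using y by (simp add: standard_simplex_def)
    then have "real d * (1 / (real d + 1)) + y d = 1"
      using eq by (simp add: lessThan_Suc_atMost[symmetric])
    then have "y d = 1 / (real d + 1)" by (simp add: field_simps)
    then have "y i \<noteq> 0" if "i \<le> d" for i using eq[of i] that by (cases "i = d") auto
    then show False using y by auto
  qed
  have b_cont: "continuous_on ?bd b"
  proof (intro continuous_on_coordinatewise_then_product)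
    fix i
    have "continuous_on ?bd \<mu>"
      unfolding \<mu>_def using d by (intro continuous_on_Max) (auto simp: lessThan_empty_iff intro!:
          continuous_intros)
    moreover have "\<mu> y \<noteq> 0" if "y \<in> ?bd" for y using \<mu>0[OF that] by simp
    ultimately show "continuous_on ?bd (\<lambda>y. b y i)"
      unfolding b_def by (intro continuous_on_If_const continuous_intros ballI) auto
  qed
  have b_bd: "b y \<in> cube_boundary d" if y: "y \<in> ?bd" for y
  proof -
    have q: "\<bar>(y i - 1 / (real d + 1)) / \<mu> y\<bar> \<le> 1" if "i < d" for i
      using \<mu>_le[OF that, of y] \<mu>0[OF y] by (simp add: abs_divide)
    have "0 \<le> b y i \<and> b y i \<le> 1" if "i < d" for i
    proof -
      have "b y i = ((y i - 1 / (real d + 1)) / \<mu> y + 1) / 2" using that by (simp add: b_def)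
      then show ?thesis using q[OF that] unfolding abs_le_iff by argo
    qed
    then have "b y \<in> cube d" by (simp add: cube_def b_def)
    moreover obtain i where i: "i < d" "\<bar>y i - 1 / (real d + 1)\<bar> = \<mu> y" using \<mu>_in by blast
    then have "\<bar>(y i - 1 / (real d + 1)) / \<mu> y\<bar> = 1" using \<mu>0[OF y] by (simp add: abs_divide)
    then have "(y i - 1 / (real d + 1)) / \<mu> y = 1 \<or> (y i - 1 / (real d + 1)) / \<mu> y = - 1" by argo
    then have "b y i = 0 \<or> b y i = 1" using i(1) by (auto simp: b_def)
    ultimately show ?thesis using i(1) by (auto simp: cube_boundary_eq)
  qed
  have ba: "b (a t) = t" if t: "t \<in> cube_boundary d" for t
  proof -
    define c where "c = 1 / ((real d + 1) * M t)"
    have c0: "c > 0" using M0[of t] by (simp add: c_def)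
    \<comment> \<open>Up to the positive factor c, the deviation from the barycentre is the centred
      cube coordinate, so the radial projection undoes \<open>a\<close> on the boundary.\<close>
    have z: "a t i - 1 / (real d + 1) = c * (2 * t i - 1)" if "i < d" for i
      using that by (simp add: a_def v_def c_def add_divide_distrib)
    have r: "rad d t = 1" using rad_boundary[OF d t] .
    have "\<mu> (a t) = c"
    proof (rule antisym)
      obtain i where "i < d" "\<bar>a t i - 1 / (real d + 1)\<bar> = \<mu> (a t)" using \<mu>_in by blast
      moreover from this have "\<bar>2 * t i - 1\<bar> \<le> 1" using rad_le_iff[OF d, of t 1] r by simp
      ultimately show "\<mu> (a t) \<le> c" using z[of i] c0 mult_left_mono[of "\<bar>2 * t i - 1\<bar>" 1 c]
        by (simp add: abs_mult)
      obtain i where i: "i < d" "\<bar>2 * t i - 1\<bar> = rad d t" using d by (rule rad_attained)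
      then show "c \<le> \<mu> (a t)" using \<mu>_le[OF i(1), of "a t"] z[OF i(1)] r c0 by (simp add: abs_mult)
    qed
    then have "b (a t) i = t i" if "i < d" for i using z[OF that] c0 that by (simp add: b_def)
    moreover have "t i = 0" if "\<not> i < d" for i using t that
        by (auto simp: cube_boundary_eq cube_def)
    ultimately show ?thesis by (auto simp: fun_eq_iff b_def)
  qed
  have "continuous_map (top_of_set ?bd) (subtopology X A) (\<lambda>y. f (b y))"
    using continuous_map_top_of_set_compose[OF f b_cont] b_bd by blast
  then obtain G where G: "continuous_map (top_of_set (standard_simplex d)) (subtopology X B) G"
    "\<forall>y\<in>?bd. G y = f (b y)"
    using fill unfolding simplex_fill_def euclidean_product_topology
        topspace_euclidean_subtopology by blast
  show "\<exists>g. continuous_map (top_of_set (cube d)) (subtopology X B) g \<and> (\<forall>t\<in>cube_boundary d. g t =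
      f t)"
  proof (intro exI conjI ballI)
    show "continuous_map (top_of_set (cube d)) (subtopology X B) (\<lambda>t. G (a t))"
      using continuous_map_top_of_set_compose[OF G(1) a_cont, of "cube d"] a_simplex by blast
    show "G (a t) = f t" if "t \<in> cube_boundary d" for t
      using G(2) a_bd[OF that] ba[OF that] by auto
  qed
qed

section \<open>Grids\<close>

definition cell :: "(nat \<Rightarrow> nat) \<Rightarrow> nat set \<Rightarrow> (nat \<Rightarrow> real) set" where
  "cell z S = {t. \<forall>i. if i \<in> S then real (z i) \<le> t i \<and> t i \<le> real (z i) + 1 else t i = real (z i)}"

definition cell_boundary :: "(nat \<Rightarrow> nat) \<Rightarrow> nat set \<Rightarrow> (nat \<Rightarrow> real) set" where
  "cell_boundary z S = {t \<in> cell z S. \<exists>i\<in>S. t i = real (z i) \<or> t i = real (z i) + 1}"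

lemma closed_cell: "closed (cell z S)"
proof -
  have "closed {t :: nat \<Rightarrow> real. if i \<in> S then real (z i) \<le> t i \<and> t i \<le> real (z i) + 1 else t i =
      real (z i)}" for i
    by (cases "i \<in> S")
      (auto intro!: closed_Collect_conj closed_Collect_le closed_Collect_eq continuous_intros)
  then have "closed (\<Inter>i. {t :: nat \<Rightarrow> real. if i \<in> S then real (z i) \<le> t i \<and> t i \<le>
      real (z i) + 1 else t i = real (z i)})"
    by blast
  moreover have "cell z S = (\<Inter>i. {t. if i \<in> S then real (z i) \<le> t i \<and> t i \<le>
      real (z i) + 1 else t i = real (z i)})"
    unfolding cell_def by blast
  ultimately show ?thesis by simp
qed

lemma cell_fill:
  assumes fill: "cube_fill d X A B" and S: "finite S" "card S = d"
    and f: "continuous_map (top_of_set (cell_boundary z S)) (subtopology X A) f"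
  shows "\<exists>g. continuous_map (top_of_set (cell z S)) (subtopology X B) g \<and>
      (\<forall>t\<in>cell_boundary z S. g t = f t)"
proof -
  obtain idx where idx: "bij_betw idx {..<d} S"
    using S by (metis ex_bij_betw_nat_finite lessThan_atLeast0)
  define jdx where "jdx = inv_into {..<d} idx"
  have j: "jdx i < d" "idx (jdx i) = i" if "i \<in> S" for i
    using idx that unfolding jdx_def bij_betw_def
        by (auto simp: f_inv_into_f inv_into_into[of i idx "{..<d}", simplified])
  have i: "idx k \<in> S" "jdx (idx k) = k" if "k < d" for k
    using idx that unfolding jdx_def bij_betw_def by (auto simp: inv_into_f_f)
  define \<phi> where "\<phi> t k = (if k < d then t (idx k) - real (z (idx k)) else 0)"
      for t :: "nat \<Rightarrow> real" and k
  define \<psi> where "\<psi> u i = (if i \<in> S then real (z i) + u (jdx i) else real (z i))"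
      for u :: "nat \<Rightarrow> real" and i
  have \<phi>_cont: "continuous_on T \<phi>" for T
    unfolding \<phi>_def by (intro continuous_on_coordinatewise_then_product continuous_on_If_const
        continuous_intros)
  have \<psi>_cont: "continuous_on T \<psi>" for T
    unfolding \<psi>_def by (intro continuous_on_coordinatewise_then_product continuous_on_If_const
        continuous_intros)
  have \<phi>c: "\<phi> t \<in> cube d" if "t \<in> cell z S" for t
  proof -
    have "real (z l) \<le> t l \<and> t l \<le> real (z l) + 1" if "l \<in> S" for l
      using \<open>t \<in> cell z S\<close> that by (simp add: cell_def)
    then have "0 \<le> t (idx k) - real (z (idx k)) \<and> t (idx k) - real (z (idx k)) \<le> 1" if "k < d" for k
      using i(1)[OF that] by (simp add: algebra_simps)
    then show ?thesis by (simp add: cube_def \<phi>_def)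
  qed
  have \<phi>b: "\<phi> t \<in> cube_boundary d" if "t \<in> cell_boundary z S" for t
  proof -
    obtain l where l: "l \<in> S" "t l = real (z l) \<or> t l = real (z l) + 1" "t \<in> cell z S"
      using \<open>t \<in> cell_boundary z S\<close> by (auto simp: cell_boundary_def)
    then have "\<phi> t (jdx l) = 0 \<or> \<phi> t (jdx l) = 1" using j[OF l(1)] by (auto simp: \<phi>_def)
    then show ?thesis using \<phi>c[OF l(3)] j(1)[OF l(1)] by (auto simp: cube_boundary_eq)
  qed
  have \<psi>b: "\<psi> u \<in> cell_boundary z S" if u: "u \<in> cube_boundary d" for u
  proof -
    obtain k where k: "k < d" "u k = 0 \<or> u k = 1" "u \<in> cube d" using u
        by (auto simp: cube_boundary_eq)
    have "0 \<le> u (jdx l) \<and> u (jdx l) \<le> 1" if "l \<in> S" for l using j(1)[OF that] k(3)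
        by (auto simp: cube_def)
    then have "\<psi> u \<in> cell z S" by (simp add: cell_def \<psi>_def)
    moreover have "\<psi> u (idx k) = real (z (idx k)) \<or> \<psi> u (idx k) = real (z (idx k)) + 1"
      using i[OF k(1)] k(2) by (auto simp: \<psi>_def)
    ultimately show ?thesis using i(1)[OF k(1)] by (auto simp: cell_boundary_def)
  qed
  have \<psi>\<phi>: "\<psi> (\<phi> t) = t" if "t \<in> cell z S" for t
  proof
    fix l show "\<psi> (\<phi> t) l = t l"
    proof (cases "l \<in> S")
      case True
      then show ?thesis using j[OF True] by (simp add: \<psi>_def \<phi>_def)
    next
      case False
      then have "t l = real (z l)" using that by (auto simp: cell_def split: if_splits)
      then show ?thesis using False by (simp add: \<psi>_def)
    qed
  qed
  have "continuous_map (top_of_set (cube_boundary d)) (subtopology X A) (\<lambda>u. f (\<psi> u))"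
    using continuous_map_top_of_set_compose[OF f \<psi>_cont, of "cube_boundary d"] \<psi>b by blast
  then obtain G where G: "continuous_map (top_of_set (cube d)) (subtopology X B) G"
    "\<forall>u\<in>cube_boundary d. G u = f (\<psi> u)"
    using fill unfolding cube_fill_def by blast
  show ?thesis
  proof (intro exI conjI ballI)
    show "continuous_map (top_of_set (cell z S)) (subtopology X B) (\<lambda>t. G (\<phi> t))"
      using continuous_map_top_of_set_compose[OF G(1) \<phi>_cont, of "cell z S"] \<phi>c by blast
    show "G (\<phi> t) = f t" if "t \<in> cell_boundary z S" for t
      using G(2) \<phi>b[OF that] \<psi>\<phi>[of t] that by (auto simp: cell_boundary_def)
  qed
qed

text \<open>The pieces overlap only inside D, so agreement with F on D already makes them compatible
  with one another.\<close>

lemma extend_over_closed_pieces: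
  fixes D :: "'b::topological_space set"
  assumes D: "closed D" "continuous_map (top_of_set D) X F"
    and J: "finite J" "\<And>j. j \<in> J \<Longrightarrow> closed (e j)" "\<And>j. j \<in> J \<Longrightarrow>
        continuous_map (top_of_set (e j)) X (g j)"
    and eq: "\<And>j t. j \<in> J \<Longrightarrow> t \<in> e j \<Longrightarrow> t \<in> D \<Longrightarrow> g j t = F t"
    and disj: "\<And>i j t. i \<in> J \<Longrightarrow> j \<in> J \<Longrightarrow> i \<noteq> j \<Longrightarrow> t \<in> e i \<Longrightarrow> t \<in> e j \<Longrightarrow> t \<in> D"
  shows "\<exists>F'. continuous_map (top_of_set (D \<union> (\<Union>j\<in>J. e j))) X F' \<and> (\<forall>t\<in>D. F' t = F t) \<and>
    (\<forall>j\<in>J. \<forall>t\<in>e j. F' t = g j t)"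
proof -
  let ?T = "D \<union> (\<Union>j\<in>J. e j)"
  let ?e = "case_option D e" and ?g = "case_option F g"
  have sub: "?e j \<subseteq> ?T" if "j \<in> insert None (Some ` J)" for j using that by auto
  obtain h where h: "continuous_map (top_of_set ?T) X h"
    "\<And>x j. j \<in> insert None (Some ` J) \<Longrightarrow> x \<in> topspace (top_of_set ?T) \<inter> ?e j \<Longrightarrow> h x = ?g j x"
  proof (rule pasting_lemma_exists_closed[where X = "top_of_set ?T"
      and I = "insert None (Some ` J)" and T = ?e and f = ?g and Y = X])
    show "finite (insert None (Some ` J))" using J(1) by simp
    show "topspace (top_of_set ?T) \<subseteq> (\<Union>j\<in>insert None (Some ` J). ?e j)" by auto
    show "closedin (top_of_set ?T) (?e j)" if "j \<in> insert None (Some ` J)" for j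
    proof (rule closed_subset[OF sub[OF that]])
      show "closed (?e j)" using that D(1) J(2) by auto
    qed
    show "continuous_map (subtopology (top_of_set ?T) (?e j)) X (?g j)" if "j \<in>
        insert None (Some ` J)" for j
    proof -
      have "subtopology (top_of_set ?T) (?e j) = top_of_set (?e j)"
        using sub[OF that] by (simp add: subtopology_subtopology Int_absorb1)
      then show ?thesis using that D(2) J(3) by auto
    qed
    show "?g i x = ?g j x" if "i \<in> insert None (Some ` J)" "j \<in> insert None (Some ` J)"
      "x \<in> topspace (top_of_set ?T) \<inter> ?e i \<inter> ?e j" for i j x
    proof (cases "i = j")
      case False
      have "x \<in> D" using that False disj by (cases i; cases j) auto
      then have "?g l x = F x" if "l \<in> insert None (Some ` J)" "x \<in> ?e l" for l
        using eq that by (cases l) auto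
      then show ?thesis using that by auto
    qed simp
  qed blast
  have "h t = F t" if "t \<in> D" for t using h(2)[of None t] that by simp
  moreover have "h t = g j t" if "j \<in> J" "t \<in> e j" for j t using h(2)[of "Some j" t] that by auto
  ultimately show ?thesis using h(1) by blast
qed

section \<open>Boundary, cells and relative skeleta of a cubical grid\<close>

definition grid_box :: "nat \<Rightarrow> nat \<Rightarrow> (nat \<Rightarrow> real) set" where
  "grid_box m N = {t. (\<forall>i<m. 0 \<le> t i \<and> t i \<le> real N) \<and> (\<forall>i\<ge>m. t i = 0)}"

definition grid_boundary :: "nat \<Rightarrow> nat \<Rightarrow> (nat \<Rightarrow> real) set" where
  "grid_boundary m N = {t \<in> grid_box m N. \<exists>i<m. t i = 0 \<or> t i = real N}"

definition grid_index :: "nat \<Rightarrow> nat \<Rightarrow> (nat \<Rightarrow> nat) set" where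
  "grid_index m N = {z. (\<forall>i<m. z i < N) \<and> (\<forall>i\<ge>m. z i = 0)}"

text \<open>A skeleton relative to the boundary: all of \<open>grid_boundary\<close> is included for
  every k, because the map is prescribed there. The number of non-integral coordinates of a point is
  the dimension of the open cell containing it.\<close>

definition grid_skeleton :: "nat \<Rightarrow> nat \<Rightarrow> nat \<Rightarrow> (nat \<Rightarrow> real) set" where
  "grid_skeleton m N k = {t \<in> grid_box m N. t \<in> grid_boundary m N \<or> card {i. t i \<notin> \<int>} \<le> k}"

text \<open>A cell is coded by its lowest corner z and its set S of directions. The bounds 0 < z i <
  N outside S exclude the cells lying in the grid boundary; what remains are the cells still to be
  filled.\<close>

definition inner_cells :: "nat \<Rightarrow> nat \<Rightarrow> nat \<Rightarrow> ((nat \<Rightarrow> nat) \<times> nat set) set" where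
  "inner_cells m N d = {(z, S). z \<in> grid_index m N \<and> S \<subseteq> {..<m} \<and> card S = d \<and> (\<forall>i<m. i \<notin> S \<longrightarrow>
      0 < z i)}"

lemma finite_grid_index: "finite (grid_index m N)"
proof -
  have "finite {z. \<forall>i. (i \<in> {..<m} \<longrightarrow> z i \<in> {..<N}) \<and> (i \<notin> {..<m} \<longrightarrow> z i = 0)}"
    by (rule finite_set_of_finite_funs) auto
  moreover have "grid_index m N = {z. \<forall>i. (i \<in> {..<m} \<longrightarrow> z i \<in> {..<N}) \<and> (i \<notin> {..<m} \<longrightarrow> z i = 0)}"
    by (auto simp: grid_index_def not_less)
  ultimately show ?thesis by simp
qed

lemma finite_inner_cells: "finite (inner_cells m N d)"
  by (rule finite_subset[of _ "grid_index m N \<times> Pow {..<m}"]) (auto simp: inner_cells_def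
      finite_grid_index)

lemma nonint_subset: "t \<in> grid_box m N \<Longrightarrow> {i. t i \<notin> \<int>} \<subseteq> {..<m}"
  by (auto simp: grid_box_def) (metis Ints_0 not_less)

lemma int_between: "x \<in> \<int> \<Longrightarrow> real k \<le> x \<Longrightarrow> x \<le> real k + 1 \<Longrightarrow> x = real k \<or> x = real k + 1"
  for x :: real
proof (elim Ints_cases)
  fix i assume "real k \<le> x" "x \<le> real k + 1" "x = of_int i"
  then have "i = int k \<or> i = int k + 1" by linarith
  then show ?thesis using \<open>x = of_int i\<close> by auto
qed

lemma not_int_between: "real k < x \<Longrightarrow> x < real k + 1 \<Longrightarrow> x \<notin> \<int>" for x :: real
  using int_between[of x k] by auto

lemma cell_in_grid_box:
  assumes "z \<in> grid_index m N" "S \<subseteq> {..<m}" "t \<in> cell z S"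
  shows "t \<in> grid_box m N"
proof -
  have "0 \<le> t i \<and> t i \<le> real N" if "i < m" for i
  proof -
    have "z i < N" using assms(1) that by (simp add: grid_index_def)
    then have "real (z i) + 1 \<le> real N" by linarith
    moreover have "real (z i) \<le> t i \<and> t i \<le> real (z i) + 1" using assms(3)
        by (auto simp: cell_def split: if_splits)
    ultimately show ?thesis by auto
  qed
  moreover have "t i = 0" if "i \<ge> m" for i
  proof -
    have "i \<notin> S" "z i = 0" using assms(1,2) that by (auto simp: grid_index_def)
    then show ?thesis using assms(3) by (auto simp: cell_def split: if_splits)
  qed
  ultimately show ?thesis by (simp add: grid_box_def)
qed

lemma cell_bounds: "t \<in> cell z S \<Longrightarrow> real (z i) \<le> t i \<and> t i \<le> real (z i) + 1"
  by (auto simp: cell_def split: if_splits)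

lemma cell_eq: "t \<in> cell z S \<Longrightarrow> i \<notin> S \<Longrightarrow> t i = real (z i)"
  by (auto simp: cell_def split: if_splits)

text \<open>A point of the cell in the lower skeleton has an integral coordinate in a direction of
  S: on the grid boundary because the coordinates outside S are strictly between 0 and N, elsewhere
  by counting non-integral coordinates.\<close>

lemma inner_cell_Int_skeleton:
  assumes J: "(z, S) \<in> inner_cells m N (Suc k)" and t: "t \<in> cell z S" "t \<in> grid_skeleton m N k"
  shows "t \<in> cell_boundary z S"
proof -
  have z: "z \<in> grid_index m N" "S \<subseteq> {..<m}" "card S = Suc k" "\<And>i. i < m \<Longrightarrow> i \<notin> S \<Longrightarrow> 0 < z i"
    using J by (auto simp: inner_cells_def)
  have tb: "t \<in> grid_box m N" using t(2) by (simp add: grid_skeleton_def)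
  have "\<exists>i\<in>S. t i \<in> \<int>"
  proof (cases "t \<in> grid_boundary m N")
    case True
    then obtain i where i: "i < m" "t i = 0 \<or> t i = real N" by (auto simp: grid_boundary_def)
    have "i \<in> S"
    proof (rule ccontr)
      assume "i \<notin> S"
      then have "t i = real (z i)" "0 < z i" "z i < N" using cell_eq[OF t(1)] z i(1)
          by (auto simp: grid_index_def)
      then show False using i(2) by auto
    qed
    moreover have "t i \<in> \<int>" using i(2) by auto
    ultimately show ?thesis by blast
  next
    case False
    then have "card {i. t i \<notin> \<int>} \<le> k" using t(2) by (simp add: grid_skeleton_def)
    moreover have "finite {i. t i \<notin> \<int>}" using nonint_subset[OF tb] finite_subset by blast
    ultimately have "\<not> S \<subseteq> {i. t i \<notin> \<int>}" using z(3) card_mono[of "{i. t i \<notin> \<int>}" S] by auto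
    then show ?thesis by auto
  qed
  then obtain i where "i \<in> S" "t i \<in> \<int>" by blast
  then show ?thesis using int_between[of "t i" "z i"] cell_bounds[OF t(1), of i] t(1)
      by (auto simp: cell_boundary_def)
qed

lemma cell_nonint: "t \<in> cell z S \<Longrightarrow> {i. t i \<notin> \<int>} \<subseteq> S"
  using cell_eq by fastforce

lemma cell_in_skeleton:
  assumes J: "(z, S) \<in> inner_cells m N k" and t: "t \<in> cell z S"
  shows "t \<in> grid_skeleton m N k"
proof -
  have z: "z \<in> grid_index m N" "S \<subseteq> {..<m}" "card S = k" "finite S"
    using J by (auto simp: inner_cells_def intro: finite_subset)
  then show ?thesis
    using cell_in_grid_box[OF z(1,2) t] card_mono[OF z(4) cell_nonint[OF t]]
        by (simp add: grid_skeleton_def)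
qed

lemma cell_boundary_in_skeleton:
  assumes J: "(z, S) \<in> inner_cells m N (Suc k)" and t: "t \<in> cell_boundary z S"
  shows "t \<in> grid_skeleton m N k"
proof -
  have z: "z \<in> grid_index m N" "S \<subseteq> {..<m}" "card S = Suc k" "finite S"
    using J by (auto simp: inner_cells_def intro: finite_subset)
  obtain i where i: "i \<in> S" "t i = real (z i) \<or> t i = real (z i) + 1" "t \<in> cell z S"
    using t by (auto simp: cell_boundary_def)
  have "t i \<in> \<int>" using i(2) by auto
  then have "{i. t i \<notin> \<int>} \<subseteq> S - {i}" using cell_nonint[OF i(3)] by auto
  then have "card {i. t i \<notin> \<int>} \<le> card (S - {i})" using z(4) by (intro card_mono) auto
  then show ?thesis using cell_in_grid_box[OF z(1,2) i(3)] i(1) z by (simp add: grid_skeleton_def)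
qed

text \<open>A point off the k-skeleton recovers its cell: the directions are its non-integral
  coordinates, and the corner is given by the floors. Hence distinct inner cells of dimension k + 1
  meet only in the k-skeleton.\<close>

lemma inner_cell_interior:
  assumes J: "(z, S) \<in> inner_cells m N (Suc k)" and t: "t \<in> cell z S" "t \<notin> grid_skeleton m N k"
  shows "i \<in> S \<Longrightarrow> real (z i) < t i \<and> t i < real (z i) + 1"
      and "S = {i. t i \<notin> \<int>}" "z = (\<lambda>i. nat \<lfloor>t i\<rfloor>)"
proof -
  have "t \<notin> cell_boundary z S" using cell_boundary_in_skeleton[OF J] t(2) by blast
  then have st: "real (z i) < t i \<and> t i < real (z i) + 1" if "i \<in> S" for i
    using cell_bounds[OF t(1), of i] t(1) that by (auto simp: cell_boundary_def less_le)
  then show "i \<in> S \<Longrightarrow> real (z i) < t i \<and> t i < real (z i) + 1" by blast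
  show "S = {i. t i \<notin> \<int>}" using cell_nonint[OF t(1)] st not_int_between by blast
  show "z = (\<lambda>i. nat \<lfloor>t i\<rfloor>)"
  proof
    fix i show "z i = nat \<lfloor>t i\<rfloor>"
    proof (cases "i \<in> S")
      case True
      then have "\<lfloor>t i\<rfloor> = int (z i)" using st[OF True] by (intro floor_unique) auto
      then show ?thesis by simp
    next
      case False
      then show ?thesis using cell_eq[OF t(1) False] by simp
    qed
  qed
qed

lemma grid_skeleton_Suc:
  "grid_skeleton m N (Suc k) = grid_skeleton m N k \<union> (\<Union>j\<in>inner_cells m N (Suc k). cell (fst j)
      (snd j))"
proof (intro equalityI subsetI)
  fix t assume t: "t \<in> grid_skeleton m N (Suc k)"
  then have tb: "t \<in> grid_box m N" by (simp add: grid_skeleton_def)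
  show "t \<in> grid_skeleton m N k \<union> (\<Union>j\<in>inner_cells m N (Suc k). cell (fst j) (snd j))"
  proof (cases "t \<in> grid_skeleton m N k")
    case False
    define S where "S = {i. t i \<notin> \<int>}"
    define z where "z i = nat \<lfloor>t i\<rfloor>" for i
    have nb: "t \<notin> grid_boundary m N" and c: "card S = Suc k" using t False
        by (auto simp: grid_skeleton_def S_def)
    have Sm: "S \<subseteq> {..<m}" using nonint_subset[OF tb] by (simp add: S_def)
    have t0: "0 \<le> t i" for i using tb by (cases "i < m") (auto simp: grid_box_def)
    have zi: "real (z i) = t i" if "i \<notin> S" for i
    proof -
      have "t i \<in> \<int>" using that by (simp add: S_def)
      then have "of_int \<lfloor>t i\<rfloor> = t i" by simp
      then show ?thesis using t0[of i] by (simp add: z_def)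
    qed
    have zl: "real (z i) \<le> t i" "t i \<le> real (z i) + 1" for i
        using t0[of i] of_int_floor_le[of "t i"] real_of_int_floor_add_one_ge[of "t i"]
        by (simp_all add: z_def)
    have "t i < real N \<and> 0 < t i" if "i < m" for i
      using tb nb that by (auto simp: grid_box_def grid_boundary_def less_le)
    then have zN: "z i < N \<and> (i \<notin> S \<longrightarrow> 0 < z i)" if "i < m" for i
      using zl[of i] zi[of i] that by force
    have "z i = 0" if "i \<ge> m" for i using tb that by (simp add: z_def grid_box_def)
    then have "(z, S) \<in> inner_cells m N (Suc k)" using zN c Sm
        by (auto simp: inner_cells_def grid_index_def)
    moreover have "t \<in> cell z S" using zl zi by (simp add: cell_def)
    ultimately show ?thesis by force
  qed simp
next
  fix t assume "t \<in> grid_skeleton m N k \<union> (\<Union>j\<in>inner_cells m N (Suc k). cell (fst j) (snd j))"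
  then show "t \<in> grid_skeleton m N (Suc k)"
  proof
    assume "t \<in> (\<Union>j\<in>inner_cells m N (Suc k). cell (fst j) (snd j))"
    then obtain z S where "(z, S) \<in> inner_cells m N (Suc k)" "t \<in> cell z S" by auto
    then show ?thesis by (rule cell_in_skeleton)
  qed (auto simp: grid_skeleton_def)
qed

lemma cell_subset_top:
  assumes "S \<subseteq> {..<m}" shows "cell z S \<subseteq> cell z {..<m}"
proof
  fix t assume t: "t \<in> cell z S"
  have "t i = real (z i)" if "\<not> i < m" for i using cell_eq[OF t] assms that by blast
  then show "t \<in> cell z {..<m}" using cell_bounds[OF t] by (simp add: cell_def)
qed

text \<open>In each direction of S, an interior coordinate determines the unit interval around it,
  so a top cell through an interior point contains the whole small cell. In particular it contains
  the lowest corner, where the labels of the two can be compared.\<close>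

lemma inner_cell_subset_top:
  assumes J: "(z, S) \<in> inner_cells m N (Suc k)" and t: "t \<in> cell z S" "t \<notin> grid_skeleton m N k"
    and c: "c \<in> grid_index m N" "t \<in> cell c {..<m}"
  shows "cell z S \<subseteq> cell c {..<m}"
proof
  fix s assume s: "s \<in> cell z S"
  have z: "z \<in> grid_index m N" "S \<subseteq> {..<m}" using J by (auto simp: inner_cells_def)
  have "real (c i) \<le> s i \<and> s i \<le> real (c i) + 1" if "i < m" for i
  proof (cases "i \<in> S")
    case True
    have "real (z i) < t i" "t i < real (z i) + 1" using inner_cell_interior(1)[OF J t True] by auto
    then have "c i = z i" using cell_bounds[OF c(2), of i] by linarith
    then show ?thesis using cell_bounds[OF s, of i] by simp
  next
    case False
    then show ?thesis using cell_eq[OF s False] cell_eq[OF t(1) False] cell_bounds[OF c(2), of i]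
        by simp
  qed
  moreover have "s i = real (c i)" if "\<not> i < m" for i
  proof -
    have "i \<notin> S" "z i = 0" "c i = 0" using z c(1) that by (auto simp: grid_index_def)
    then show ?thesis using cell_eq[OF s] by simp
  qed
  ultimately show "s \<in> cell c {..<m}" by (simp add: cell_def)
qed

lemma closed_grid_boundary: "closed (grid_boundary m N)"
proof -
  have "closed (\<Inter>i\<in>{..<m}. {t :: nat \<Rightarrow> real. 0 \<le> t i \<and> t i \<le> real N})"
    by (intro closed_INT ballI closed_Collect_conj closed_Collect_le continuous_intros)
  moreover have "closed (\<Inter>i\<in>{m..}. {t :: nat \<Rightarrow> real. t i = 0})"
    by (intro closed_INT ballI closed_Collect_eq continuous_intros)
  moreover have "closed (\<Union>i\<in>{..<m}. {t :: nat \<Rightarrow> real. t i = 0 \<or> t i = real N})"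
    by (intro closed_UN ballI closed_Collect_disj closed_Collect_eq continuous_intros) auto
  ultimately have "closed ((\<Inter>i\<in>{..<m}. {t :: nat \<Rightarrow> real. 0 \<le> t i \<and> t i \<le>
      real N}) \<inter> (\<Inter>i\<in>{m..}. {t. t i = 0}) \<inter>
      (\<Union>i\<in>{..<m}. {t. t i = 0 \<or> t i = real N}))" by (intro closed_Int)
  also have "\<dots> = grid_boundary m N" by (auto simp: grid_boundary_def grid_box_def)
  finally show ?thesis .
qed

lemma grid_skeleton_0:
  "grid_skeleton m N 0 = grid_boundary m N \<union> (\<Union>v\<in>grid_skeleton m N 0 - grid_boundary m N. {v})"
  by (auto simp: grid_skeleton_def grid_boundary_def)

lemma grid_skeleton_0_int:
  assumes "v \<in> grid_skeleton m N 0 - grid_boundary m N"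
  shows "v i \<in> \<int>" "v \<in> grid_box m N"
proof -
  show b: "v \<in> grid_box m N" using assms by (simp add: grid_skeleton_def)
  have "card {i. v i \<notin> \<int>} = 0" using assms by (auto simp: grid_skeleton_def)
  moreover have "finite {i. v i \<notin> \<int>}" using nonint_subset[OF b] finite_subset by blast
  ultimately show "v i \<in> \<int>" by auto
qed

lemma finite_inner_vertices: "finite (grid_skeleton m N 0 - grid_boundary m N)"
proof (rule finite_subset)
  show "grid_skeleton m N 0 - grid_boundary m N \<subseteq> (\<lambda>z i. real (z i)) ` grid_index m N"
  proof
    fix v assume v: "v \<in> grid_skeleton m N 0 - grid_boundary m N"
    note b = grid_skeleton_0_int[OF v]
    have v0: "0 \<le> v i" for i using b(2) by (cases "i < m") (auto simp: grid_box_def)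
    have ri: "real (nat \<lfloor>v i\<rfloor>) = v i" for i
    proof -
      have "of_int \<lfloor>v i\<rfloor> = v i" using b(1)[of i] by simp
      then show ?thesis using v0[of i] by simp
    qed
    have "v i < real N" if "i < m" for i
      using b(2) v that by (auto simp: grid_box_def grid_boundary_def less_le)
    then have "nat \<lfloor>v i\<rfloor> < N" if "i < m" for i using that ri[of i] by (metis of_nat_less_iff)
    moreover have "nat \<lfloor>v i\<rfloor> = 0" if "i \<ge> m" for i using b(2) that by (simp add: grid_box_def)
    ultimately have "(\<lambda>i. nat \<lfloor>v i\<rfloor>) \<in> grid_index m N" by (simp add: grid_index_def)
    moreover have "v = (\<lambda>i. real (nat \<lfloor>v i\<rfloor>))" by (simp add: ri)
    ultimately show "v \<in> (\<lambda>z i. real (z i)) ` grid_index m N"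
      by (intro image_eqI[where x = "\<lambda>i. nat \<lfloor>v i\<rfloor>"])
  qed
qed (simp add: finite_grid_index)

lemma closed_grid_skeleton: "closed (grid_skeleton m N k)"
proof (induction k)
  case 0
  show ?case
    by (subst grid_skeleton_0) (intro closed_Un closed_UN closed_grid_boundary
        finite_inner_vertices ballI closed_singleton)
next
  case (Suc k)
  show ?case
    unfolding grid_skeleton_Suc by (intro closed_Un closed_UN Suc.IH finite_inner_cells ballI
        closed_cell)
qed

text \<open>The members \<open>W z\<close> and \<open>U z\<close> of the covers label the top cells. The last premise lets the inner
  vertices of the grid be mapped compatibly with all labels at once.\<close>

definition extends_over_skeleton :: "nat \<Rightarrow> 'a topology \<Rightarrow> 'a set set \<Rightarrow> 'a set set \<Rightarrow> bool" where
  "extends_over_skeleton k X \<W> \<U> \<longleftrightarrow> (\<forall>m N W F0.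
     (\<forall>z\<in>grid_index m N. W z \<in> \<W>) \<longrightarrow> continuous_map (top_of_set (grid_boundary m N)) X F0 \<longrightarrow>
     (\<forall>z\<in>grid_index m N. \<forall>t\<in>cell z {..<m} \<inter> grid_boundary m N. F0 t \<in> W z) \<longrightarrow>
     (\<forall>v\<in>grid_box m N. \<exists>x\<in>topspace X. \<forall>z\<in>grid_index m N. v \<in> cell z {..<m} \<longrightarrow> x \<in> W z) \<longrightarrow>
     (\<exists>F U. continuous_map (top_of_set (grid_skeleton m N k)) X F \<and> (\<forall>t\<in>grid_boundary m N. F t =
         F0 t) \<and>
        (\<forall>z\<in>grid_index m N. U z \<in> \<U> \<and> (\<forall>t\<in>cell z {..<m} \<inter> grid_skeleton m N k. F t \<in> U z))))"

lemma extends_over_skeletonD: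
  assumes "extends_over_skeleton k X \<W> \<U>" "\<And>z. z \<in> grid_index m N \<Longrightarrow> W z \<in> \<W>"
    and "continuous_map (top_of_set (grid_boundary m N)) X F0"
    and "\<And>z t. z \<in> grid_index m N \<Longrightarrow> t \<in> cell z {..<m} \<inter> grid_boundary m N \<Longrightarrow> F0 t \<in> W z"
    and "\<And>v. v \<in> grid_box m N \<Longrightarrow>
      \<exists>x\<in>topspace X. \<forall>z\<in>grid_index m N. v \<in> cell z {..<m} \<longrightarrow> x \<in> W z"
  shows "\<exists>F U. continuous_map (top_of_set (grid_skeleton m N k)) X F \<and>
      (\<forall>t\<in>grid_boundary m N. F t = F0 t) \<and>
        (\<forall>z\<in>grid_index m N. U z \<in> \<U> \<and> (\<forall>t\<in>cell z {..<m} \<inter> grid_skeleton m N k. F t \<in> U z))"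
  by (rule assms(1)[unfolded extends_over_skeleton_def, rule_format, of m N W F0])
    (use assms(2-) in simp_all)

text \<open>The induction on the dimension works backwards through covers: the target for the
  k-skeleton is the cover \<V> of filling neighbourhoods. The cell (z, S) is filled in
  \<open>B (A z)\<close>, with the label of the top cell having the same lowest corner. Any top cell
  c through a new point of it contains this corner, so \<open>B (A z)\<close> and
  \<open>B (A c)\<close> share the value of F there, and the star property puts the filling into
  \<open>U c\<close>.\<close>

lemma skeleton_extension:
  assumes P: "paracompact_space X" and H: "Hausdorff_space X" and L: "LC n X" and k: "k \<le> Suc n"
    and \<U>: "open_cover X \<U>"
  shows "\<exists>\<W>. open_cover X \<W> \<and> extends_over_skeleton k X \<W> \<U>"
  using k \<U>
proof (induction k arbitrary: \<U>)
  case 0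
  show ?case
    unfolding extends_over_skeleton_def
  \<comment> \<open>Vertices need no refinement: the last premise provides a common point of the
    surrounding labels.\<close>
  proof (intro exI[of _ \<U>] conjI allI impI 0)
    fix m N W and F0 :: "(nat \<Rightarrow> real) \<Rightarrow> 'a"
    assume W: "\<forall>z\<in>grid_index m N. W z \<in> \<U>" and F0: "continuous_map (top_of_set (grid_boundary m
        N)) X F0"
      and WF: "\<forall>z\<in>grid_index m N. \<forall>t\<in>cell z {..<m} \<inter> grid_boundary m N. F0 t \<in> W z"
      and V: "\<forall>v\<in>grid_box m N. \<exists>x\<in>topspace X. \<forall>z\<in>grid_index m N. v \<in> cell z {..<m} \<longrightarrow> x \<in> W z"
    obtain x where x: "\<forall>v\<in>grid_box m N. x v \<in> topspace X \<and> (\<forall>z\<in>grid_index m N. v \<in>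
        cell z {..<m} \<longrightarrow> x v \<in> W z)"
      using bchoice[of "grid_box m N" "\<lambda>v x. x \<in> topspace X \<and> (\<forall>z\<in>grid_index m N. v \<in>
          cell z {..<m} \<longrightarrow> x \<in> W z)"] V
      by blast
    have "\<exists>F. continuous_map (top_of_set (grid_boundary m N \<union> (\<Union>v\<in>grid_skeleton m N 0 -
        grid_boundary m N. {v}))) X F \<and>
        (\<forall>t\<in>grid_boundary m N. F t = F0 t) \<and>
        (\<forall>v\<in>grid_skeleton m N 0 - grid_boundary m N. \<forall>t\<in>{v}. F t = x v)"
    proof (rule extend_over_closed_pieces[OF closed_grid_boundary F0 finite_inner_vertices])
      fix v assume "v \<in> grid_skeleton m N 0 - grid_boundary m N"
      then have "x v \<in> topspace X" using x by (auto simp: grid_skeleton_def)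
      then show "continuous_map (top_of_set {v}) X (\<lambda>_. x v)" by simp
    qed auto
    then obtain F where F: "continuous_map (top_of_set (grid_skeleton m N 0)) X F"
      "\<forall>t\<in>grid_boundary m N. F t = F0 t" "\<forall>v\<in>grid_skeleton m N 0 - grid_boundary m N. F v = x v"
      by (subst (asm) grid_skeleton_0[symmetric]) auto
    have "F t \<in> W z" if z: "z \<in> grid_index m N"
        and t: "t \<in> cell z {..<m}" "t \<in> grid_skeleton m N 0" for z t
    proof (cases "t \<in> grid_boundary m N")
      case True
      then show ?thesis using F(2) WF z t by auto
    next
      case False
      then show ?thesis using F(3) x z t by (auto simp: grid_skeleton_def)
    qed
    then show "\<exists>F U. continuous_map (top_of_set (grid_skeleton m N 0)) X F \<and>
        (\<forall>t\<in>grid_boundary m N. F t = F0 t) \<and>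
        (\<forall>z\<in>grid_index m N. U z \<in> \<U> \<and> (\<forall>t\<in>cell z {..<m} \<inter> grid_skeleton m N 0. F t \<in> U z))"
      using F W by (intro exI[of _ F] exI[of _ W]) auto
  qed
next
  case (Suc k)
  then have kn: "k \<le> n" by simp
  have "\<exists>\<V> B. open_cover X \<V> \<and> (\<forall>A\<in>\<V>. A \<subseteq> B A \<and> simplex_fill (Suc k) X A (B A) \<and>
     (A \<noteq> {} \<longrightarrow> (\<exists>U\<in>\<U>. \<forall>A'\<in>\<V>. B A' \<inter> B A \<noteq> {} \<longrightarrow> B A' \<subseteq> U)))"
  proof (rule LC_star_refinement[OF P H L kn Suc.prems(2)])
    fix \<V> B assume "open_cover X \<V>" "\<And>A. A \<in> \<V> \<Longrightarrow> A \<subseteq> B A"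
      "\<And>A. A \<in> \<V> \<Longrightarrow> simplex_fill (Suc k) X A (B A)"
      "\<And>A. A \<in> \<V> \<Longrightarrow> A \<noteq> {} \<Longrightarrow> \<exists>U\<in>\<U>. \<forall>A'\<in>\<V>. B A' \<inter> B A \<noteq> {} \<longrightarrow> B A' \<subseteq> U"
    then show ?thesis by (intro exI[of _ \<V>] exI[of _ B]) simp
  qed
  then obtain \<V> B where \<V>: "open_cover X \<V>" and VB: "\<forall>A\<in>\<V>. A \<subseteq> B A \<and>
      simplex_fill (Suc k) X A (B A) \<and>
     (A \<noteq> {} \<longrightarrow> (\<exists>U\<in>\<U>. \<forall>A'\<in>\<V>. B A' \<inter> B A \<noteq> {} \<longrightarrow> B A' \<subseteq> U))" by blast
  have AB: "\<And>A. A \<in> \<V> \<Longrightarrow> A \<subseteq> B A"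
    and fill: "\<And>A. A \<in> \<V> \<Longrightarrow> simplex_fill (Suc k) X A (B A)"
    and star: "\<And>A. A \<in> \<V> \<Longrightarrow> A \<noteq> {} \<Longrightarrow> \<exists>U\<in>\<U>. \<forall>A'\<in>\<V>. B A' \<inter> B A \<noteq> {} \<longrightarrow> B A' \<subseteq> U"
    using VB by simp_all
  have kn': "k \<le> Suc n" using kn by simp
  obtain \<W> where \<W>: "open_cover X \<W>"
    and ext: "extends_over_skeleton k X \<W> \<V>"
    using Suc.IH[OF kn' \<V>] by blast
  show ?case
    unfolding extends_over_skeleton_def
  proof (rule exI[of _ \<W>], rule conjI[OF \<W>], intro allI impI)
    fix m N W and F0 :: "(nat \<Rightarrow> real) \<Rightarrow> 'a"
    assume hyp: "\<forall>z\<in>grid_index m N. W z \<in> \<W>" "continuous_map (top_of_set (grid_boundary m N)) X F0"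
     "\<forall>z\<in>grid_index m N. \<forall>t\<in>cell z {..<m} \<inter> grid_boundary m N. F0 t \<in> W z"
     "\<forall>v\<in>grid_box m N. \<exists>x\<in>topspace X. \<forall>z\<in>grid_index m N. v \<in> cell z {..<m} \<longrightarrow> x \<in> W z"
    obtain F A where FA': "continuous_map (top_of_set (grid_skeleton m N k)) X F \<and>
        (\<forall>t\<in>grid_boundary m N. F t = F0 t) \<and>
        (\<forall>z\<in>grid_index m N. A z \<in> \<V> \<and> (\<forall>t\<in>cell z {..<m} \<inter> grid_skeleton m N k. F t \<in> A z))"
      using extends_over_skeletonD[OF ext hyp[rule_format]] by blast
    then have F: "continuous_map (top_of_set (grid_skeleton m N k)) X F" "\<forall>t\<in>grid_boundary m N. F
        t = F0 t"
      and A: "\<And>z. z \<in> grid_index m N \<Longrightarrow> A z \<in> \<V>"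
      and FA: "\<And>z t. z \<in> grid_index m N \<Longrightarrow> t \<in> cell z {..<m} \<Longrightarrow> t \<in> grid_skeleton m N k \<Longrightarrow> F t \<in> A z"
      by simp_all
    let ?J = "inner_cells m N (Suc k)"
    have "\<forall>j\<in>?J. \<exists>g. continuous_map (top_of_set (cell (fst j) (snd j))) (subtopology X (B (A (fst
        j)))) g \<and>
        (\<forall>t\<in>cell_boundary (fst j) (snd j). g t = F t)"
    proof
      fix j assume j: "j \<in> ?J"
      obtain z S where zS: "j = (z, S)" by fastforce
      have z: "z \<in> grid_index m N" "S \<subseteq> {..<m}" "card S = Suc k" "finite S"
        using j by (auto simp: inner_cells_def zS intro: finite_subset)
      have sub: "cell_boundary z S \<subseteq> grid_skeleton m N k"
        using cell_boundary_in_skeleton j zS by blast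
      have "continuous_map (top_of_set (cell_boundary z S)) X F"
        using continuous_map_from_subtopology_mono[OF F(1) sub] .
      moreover have "F t \<in> A z" if "t \<in> cell_boundary z S" for t
      proof -
        have "t \<in> cell z {..<m}" using that cell_subset_top[OF z(2), of z]
            by (auto simp: cell_boundary_def)
        then show ?thesis using FA[OF z(1)] sub that by blast
      qed
      ultimately have "continuous_map (top_of_set (cell_boundary z S)) (subtopology X (A z)) F"
        by (auto simp: continuous_map_in_subtopology)
      from cell_fill[OF cube_fill_if_simplex_fill[OF _ fill[OF A[OF z(1)]]] z(4,3) this]
      show "\<exists>g. continuous_map (top_of_set (cell (fst j) (snd j))) (subtopology X (B (A (fst
          j)))) g \<and>
        (\<forall>t\<in>cell_boundary (fst j) (snd j). g t = F t)" by (simp add: zS)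
    qed
    then obtain g where g: "\<forall>j\<in>?J. continuous_map (top_of_set (cell (fst j) (snd j)))
        (subtopology X (B (A (fst j)))) (g j) \<and>
        (\<forall>t\<in>cell_boundary (fst j) (snd j). g j t = F t)"
      by (rule bchoice[elim_format]) blast
    have "\<exists>F'. continuous_map (top_of_set (grid_skeleton m N k \<union> (\<Union>j\<in>?J. cell (fst j) (snd j))))
        X F' \<and>
       (\<forall>t\<in>grid_skeleton m N k. F' t = F t) \<and> (\<forall>j\<in>?J. \<forall>t\<in>cell (fst j) (snd j). F' t = g j t)"
    proof (rule extend_over_closed_pieces[OF closed_grid_skeleton F(1) finite_inner_cells
        closed_cell])
      show "continuous_map (top_of_set (cell (fst j) (snd j))) X (g j)" if "j \<in> ?J" for j
        using g that by (simp add: continuous_map_in_subtopology)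
      show "g j t = F t" if "j \<in> ?J" "t \<in> cell (fst j) (snd j)" "t \<in> grid_skeleton m N k" for j t
        using g that inner_cell_Int_skeleton[of "fst j" "snd j" m N k t] by simp
      show "t \<in> grid_skeleton m N k" if "i \<in> ?J" "j \<in> ?J" "i \<noteq> j" "t \<in> cell (fst i) (snd i)" "t \<in>
          cell (fst j) (snd j)" for i j t
      proof (rule ccontr)
        assume nt: "t \<notin> grid_skeleton m N k"
        have "snd l = {i. t i \<notin> \<int>} \<and> fst l = (\<lambda>i. nat \<lfloor>t i\<rfloor>)" if "l \<in> ?J" "t \<in>
            cell (fst l) (snd l)" for l
          using inner_cell_interior(2,3)[OF _ that(2) nt] that(1) by (metis prod.collapse)
        from this[OF that(1,4)] this[OF that(2,5)] have "fst i = fst j" "snd i = snd j" by simp_all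
        then show False using that(3) by (simp add: prod_eq_iff)
      qed
    qed
    then obtain F' where F': "continuous_map (top_of_set (grid_skeleton m N (Suc k))) X F'"
      "\<forall>t\<in>grid_skeleton m N k. F' t = F t" "\<forall>j\<in>?J. \<forall>t\<in>cell (fst j) (snd j). F' t = g j t"
      unfolding grid_skeleton_Suc by blast
    \<comment> \<open>The lowest corner has integral coordinates, so it belongs to every skeleton.
      The value of F there shows that \<open>A z\<close> is non-empty, as the star property
      requires.\<close>
    have corner: "(\<lambda>i. real (z i)) \<in> cell z {..<m} \<and> (\<lambda>i. real (z i)) \<in> grid_skeleton m N k"
        if "z \<in> grid_index m N" for z
    proof -
      have c: "(\<lambda>i. real (z i)) \<in> cell z {..<m}" by (simp add: cell_def)
      then show ?thesis using cell_in_grid_box[OF that _ c] by (simp add: grid_skeleton_def)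
    qed
    have "\<forall>z\<in>grid_index m N. \<exists>U. U \<in> \<U> \<and> (\<forall>A'\<in>\<V>. B A' \<inter> B (A z) \<noteq> {} \<longrightarrow> B A' \<subseteq> U)"
    proof
      fix z assume z: "z \<in> grid_index m N"
      then have "A z \<noteq> {}" using FA[OF z] corner[OF z] by blast
      then show "\<exists>U. U \<in> \<U> \<and> (\<forall>A'\<in>\<V>. B A' \<inter> B (A z) \<noteq> {} \<longrightarrow> B A' \<subseteq> U)" using star[OF A[OF z]]
          by blast
    qed
    then obtain U where U: "\<forall>z\<in>grid_index m N. U z \<in> \<U> \<and> (\<forall>A'\<in>\<V>. B A' \<inter> B (A z) \<noteq> {} \<longrightarrow> B A' \<subseteq> U z)"
      by (rule bchoice[elim_format]) blast
    have "F' t \<in> U c" if c: "c \<in> grid_index m N"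
        and t: "t \<in> cell c {..<m}" "t \<in> grid_skeleton m N (Suc k)" for c t
    proof (cases "t \<in> grid_skeleton m N k")
      case True
      have "F t \<in> A c" using FA[OF c t(1) True] .
      then have Ft: "F t \<in> B (A c)" using AB[OF A[OF c]] by blast
      then have "B (A c) \<subseteq> U c" using U c A[OF c] by blast
      then show ?thesis using Ft F'(2) True by auto
    next
      case False
      then obtain z S where zS: "(z, S) \<in> ?J" "t \<in> cell z S" using t(2)
          unfolding grid_skeleton_Suc by auto
      have z: "z \<in> grid_index m N" "S \<subseteq> {..<m}" "card S = Suc k" using zS(1)
          by (auto simp: inner_cells_def)
      have "continuous_map (top_of_set (cell z S)) (subtopology X (B (A z))) (g (z, S))"
          using g zS(1) by auto
      then have "g (z, S) t \<in> B (A z)" using zS(2) by (auto simp: continuous_map_in_subtopology)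
      moreover have "F' t = g (z, S) t" using F'(3) zS by auto
      moreover have "B (A z) \<subseteq> U c"
      proof -
        let ?v = "\<lambda>i. real (z i)"
        have "?v \<in> cell z S" by (simp add: cell_def)
        then have "?v \<in> cell c {..<m}" using inner_cell_subset_top[OF zS False c t(1)] by blast
        then have "F ?v \<in> A c" using FA[OF c] corner[OF z(1)] by blast
        moreover have "F ?v \<in> A z" using FA[OF z(1)] corner[OF z(1)] by blast
        ultimately have "B (A z) \<inter> B (A c) \<noteq> {}" using AB[OF A[OF c]] AB[OF A[OF z(1)]] by blast
        then show ?thesis using U c A[OF z(1)] by blast
      qed
      ultimately show ?thesis by auto
    qed
    then show "\<exists>F U. continuous_map (top_of_set (grid_skeleton m N (Suc k))) X F \<and>
        (\<forall>t\<in>grid_boundary m N. F t = F0 t) \<and>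
        (\<forall>z\<in>grid_index m N. U z \<in> \<U> \<and> (\<forall>t\<in>cell z {..<m} \<inter> grid_skeleton m N (Suc k). F t \<in> U z))"
      using F' F(2) U by (intro exI[of _ F'] exI[of _ U]) (auto simp: grid_skeleton_def
          grid_boundary_def)
  qed
qed

section \<open>Sweeping across a grid\<close>

definition spanier_related ::
  "nat \<Rightarrow> 'a topology \<Rightarrow> 'a set set \<Rightarrow> 'a \<Rightarrow> ((nat \<Rightarrow> real) \<Rightarrow> 'a) \<Rightarrow> ((nat \<Rightarrow> real) \<Rightarrow> 'a) \<Rightarrow> bool" where
  "spanier_related n X \<U> x f g \<longleftrightarrow> f \<in> spheroids n X x \<and> g \<in> spheroids n X x \<and>
     sph_class n X x f \<otimes>\<^bsub>homotopy_group n X x\<^esub> inv\<^bsub>homotopy_group n X x\<^esub> (sph_class n X x g)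
       \<in> spanier_group_cover n X \<U> x"

lemma subgroup_spanier_group_cover:
  assumes "n \<ge> 1" "x \<in> topspace X"
  shows "subgroup (spanier_group_cover n X \<U> x) (homotopy_group n X x)"
  unfolding spanier_group_cover_def
  by (rule group.generate_is_subgroup[OF group_homotopy_group[OF assms]
      spanier_generators_carrier[OF assms(1)]])

lemma spanier_related_homotopic:
  assumes n: "n \<ge> 1" and x: "x \<in> topspace X" and h: "(f, g) \<in> sph_homotopic n X x"
  shows "spanier_related n X \<U> x f g"
proof -
  note G = group_homotopy_group[OF n x]
  have "sph_class n X x g \<in> carrier (homotopy_group n X x)"
    using sph_homotopic_spheroids(2)[OF h] by (rule sph_class_in_carrier)
  then show ?thesis
    using sph_homotopic_spheroids[OF h] group.r_inv[OF G] subgroup.one_closed[OF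
        subgroup_spanier_group_cover[OF n x]]
    by (simp add: spanier_related_def sph_class_eqI[OF h])
qed

lemma spanier_related_trans:
  assumes n: "n \<ge> 1" and x: "x \<in> topspace X"
    and fg: "spanier_related n X \<U> x f g" and gh: "spanier_related n X \<U> x g h"
  shows "spanier_related n X \<U> x f h"
proof -
  let ?G = "homotopy_group n X x"
  interpret group ?G by (rule group_homotopy_group[OF n x])
  let ?f = "sph_class n X x f" and ?g = "sph_class n X x g" and ?h = "sph_class n X x h"
  have c: "?f \<in> carrier ?G" "?g \<in> carrier ?G" "?h \<in> carrier ?G"
    using fg gh by (auto simp: spanier_related_def intro: sph_class_in_carrier)
  have "(?f \<otimes>\<^bsub>?G\<^esub> inv\<^bsub>?G\<^esub> ?g) \<otimes>\<^bsub>?G\<^esub> (?g \<otimes>\<^bsub>?G\<^esub> inv\<^bsub>?G\<^esub> ?h) \<in> spanier_group_cover n X \<U> x"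
    using fg gh subgroup.m_closed[OF subgroup_spanier_group_cover[OF n x]]
        by (simp add: spanier_related_def)
  moreover have "(?f \<otimes>\<^bsub>?G\<^esub> inv\<^bsub>?G\<^esub> ?g) \<otimes>\<^bsub>?G\<^esub> (?g \<otimes>\<^bsub>?G\<^esub> inv\<^bsub>?G\<^esub> ?h) = ?f \<otimes>\<^bsub>?G\<^esub> inv\<^bsub>?G\<^esub> ?h"
    using c by (simp add: m_assoc inv_solve_left')
  ultimately show ?thesis using fg gh by (simp add: spanier_related_def)
qed

lemma spanier_related_box:
  assumes n: "n \<ge> 1" and x: "x \<in> topspace X" and g: "g \<in> spheroids n X x"
      and g': "g' \<in> spheroids n X x"
    and ab: "\<And>i. i < n \<Longrightarrow> 0 \<le> a i \<and> a i \<le> b i \<and> b i \<le> 1"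
    and agree: "\<And>t. t \<in> cube n \<Longrightarrow> \<exists>i<n. t i \<le> a i \<or> b i \<le> t i \<Longrightarrow> g t = g' t"
    and U: "U \<in> \<U>" "\<And>t. t \<in> cube n \<Longrightarrow> \<forall>i<n. a i \<le> t i \<and> t i \<le> b i \<Longrightarrow> g t \<in> U \<and> g' t \<in> U"
  shows "spanier_related n X \<U> x g g'"
proof -
  have "sph_class n X x (sph_concat g (sph_reverse g')) \<in> spanier_generators n X \<U> x"
    by (rule spheroid_difference_in_spanier_generators[OF n g g' ab agree U])
  then have "sph_class n X x (sph_concat g (sph_reverse g')) \<in> spanier_group_cover n X \<U> x"
    unfolding spanier_group_cover_def by (rule generate.incl)
  then show ?thesis
    using g g' by (simp add: spanier_related_def inv_homotopy_group[OF n x]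
        mult_homotopy_group[OF n]
        sph_reverse_spheroids[OF n])
qed

text \<open>One integral coordinate leaves at most n non-integral ones; thus the walls and the
  levels of the grid lie in the n-skeleton.\<close>

lemma grid_skeleton_codim_1:
  assumes t: "t \<in> grid_box (Suc n) N" and i: "i < Suc n" "t i \<in> \<int>"
  shows "t \<in> grid_skeleton (Suc n) N n"
proof -
  have "{i. t i \<notin> \<int>} \<subseteq> {..<Suc n} - {i}" using nonint_subset[OF t] i(2) by auto
  then have "card {i. t i \<notin> \<int>} \<le> card ({..<Suc n} - {i})" by (intro card_mono) auto
  then show ?thesis using t i(1) by (simp add: grid_skeleton_def)
qed

text \<open>The unit cube placed in the grid at height c; the height is the last coordinate, of
  index n.\<close>

definition slice :: "nat \<Rightarrow> nat \<Rightarrow> real \<Rightarrow> (nat \<Rightarrow> real) \<Rightarrow> nat \<Rightarrow> real" where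
  "slice n N c t i = (if i < n then real N * t i else if i = n then c else 0)"

text \<open>Passing from one level of the grid to the next: \<open>f\<^sub>j\<close> is first deformed along the vertical walls
  to a map agreeing with \<open>f\<^sub>j\<^sub>+\<^sub>1\<close> over the boundary of each base cell, and then replaced by
  \<open>f\<^sub>j\<^sub>+\<^sub>1\<close> one base cell at a time.\<close>

lemma spanier_related_level:
  assumes n: "n \<ge> 1" and x: "x \<in> topspace X"
    and F: "continuous_map (top_of_set (grid_skeleton (Suc n) N n)) X F"
    and FU: "\<And>z. z \<in> grid_index (Suc n) N \<Longrightarrow> U z \<in> \<U>"
      "\<And>z t. z \<in> grid_index (Suc n) N \<Longrightarrow> t \<in> cell z {..<Suc n} \<Longrightarrow> t \<in> grid_skeleton (Suc n) N n \<Longrightarrow>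
          F t \<in> U z"
    and Fx: "\<And>t i. t \<in> grid_box (Suc n) N \<Longrightarrow> i < n \<Longrightarrow> t i = 0 \<or> t i = real N \<Longrightarrow> F t = x"
    and j: "j < N"
  shows "spanier_related n X \<U> x (\<lambda>t. F (slice n N (real j) t)) (\<lambda>t. F (slice n N (real (Suc j))
      t))"
proof -
  have N: "real N > 0" using j by simp
  define Q where "Q z = {t \<in> cube n. \<forall>i<n. real (z i) \<le> real N * t i \<and> real N * t i \<le>
      real (z i) + 1}" for z :: "nat \<Rightarrow> nat"
  \<comment> \<open>The radius within a base cell: at most 1 over the cell, and 1 over its boundary,
    where neighbouring cells meet.\<close>
  define r where "r z t = rad n (\<lambda>i. real N * t i - real (z i))" for z :: "nat \<Rightarrow> nat" and t
  \<comment> \<open>At stage s the part of radius up to 1 - s/2 is stretched over the whole bottom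
    face, and the collar around it climbs the walls up to height j + s. The maximum in the
    denominator switches from stretching to radial projection onto the walls. At s = 1 the collar
    reaches the next level, while the concentric cube of half the size covers the bottom.\<close>
  define pos where "pos z s t i = (if i < n then real (z i) + 1/2 + ((2 * (real N * t i - real (z
      i)) - 1) / max (r z t) (1 - s/2)) / 2
      else if i = n then real j + max 0 (2 * (r z t - (1 - s/2))) else 0)" for z :: "nat \<Rightarrow> nat"
          and s :: real and t i
  let ?Z = "grid_index n N"
  define f1 where "f1 t = F (slice n N (real (Suc j)) t)" for t
  have Q_closed: "closed (Q z)" for z
  proof -
    have "closed (cube n)" using compact_cube by (rule compact_imp_closed)
    moreover have "closed (\<Inter>i\<in>{..<n}. {t :: nat \<Rightarrow> real. real (z i) \<le> real N * t i \<and>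
        real N * t i \<le> real (z i) + 1})"
      by (intro closed_INT ballI closed_Collect_conj closed_Collect_le continuous_intros)
    ultimately have "closed (cube n \<inter> (\<Inter>i\<in>{..<n}. {t. real (z i) \<le> real N * t i \<and> real N * t i \<le>
        real (z i) + 1}))"
      by (rule closed_Int)
    moreover have "Q z = cube n \<inter> (\<Inter>i\<in>{..<n}. {t. real (z i) \<le> real N * t i \<and> real N * t i \<le>
        real (z i) + 1})"
      by (auto simp: Q_def)
    ultimately show ?thesis by simp
  qed
  have Q_cover: "\<exists>z\<in>?Z. t \<in> Q z" if t: "t \<in> cube n" for t
  proof -
    define z where "z i = (if i < n then min (nat \<lfloor>real N * t i\<rfloor>) (N - 1) else 0)" for i
    have "real (z i) \<le> real N * t i \<and> real N * t i \<le> real (z i) + 1" if "i < n" for i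
    proof -
      have ti: "0 \<le> t i" "t i \<le> 1" using t that by (auto simp: cube_def)
      then have nn: "0 \<le> real N * t i" "real N * t i \<le> real N" using N by (auto simp: mult_left_le)
      have fl: "real (nat \<lfloor>real N * t i\<rfloor>) \<le> real N * t i" "real N * t i \<le>
          real (nat \<lfloor>real N * t i\<rfloor>) + 1"
        using nn(1) real_of_int_floor_add_one_ge[of "real N * t i"] by simp_all
      show ?thesis
      proof (cases "nat \<lfloor>real N * t i\<rfloor> \<le> N - 1")
        case True
        then show ?thesis using fl that by (simp add: z_def)
      next
        case False
        then have "real N \<le> real (nat \<lfloor>real N * t i\<rfloor>)" by simp
        then have "real N * t i = real N" using fl(1) nn(2) by linarith
        then show ?thesis using False j that by (simp add: z_def of_nat_diff)
      qed
    qed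
    moreover have "z \<in> ?Z" using j by (auto simp: z_def grid_index_def)
    ultimately show ?thesis using t by (auto simp: Q_def)
  qed
  have r_le: "r z t \<le> 1" if "t \<in> Q z" for z t
    unfolding r_def rad_le_iff[OF n]
  proof (intro allI impI)
    fix i assume "i < n"
    then have "real (z i) \<le> real N * t i" "real N * t i \<le> real (z i) + 1" using that
        by (auto simp: Q_def)
    then show "\<bar>2 * (real N * t i - real (z i)) - 1\<bar> \<le> 1" unfolding abs_le_iff by argo
  qed
  have r_ge: "\<bar>2 * (real N * t i - real (z i)) - 1\<bar> \<le> r z t" if "i < n" for i z t
    using rad_le_iff[OF n, of "\<lambda>i. real N * t i - real (z i)" "r z t"] that by (simp add: r_def)
  have r_edge: "r z t = 1" if "t \<in> Q z" "i < n" "real N * t i \<le> real (z i) \<or> real (z i) + 1 \<le>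
      real N * t i" for z t i
  proof (rule antisym[OF r_le[OF that(1)]])
    have "1 \<le> \<bar>2 * (real N * t i - real (z i)) - 1\<bar>" using that(3) by argo
    then show "1 \<le> r z t" using r_ge[OF that(2), of t z] by simp
  qed
  have r_overlap: "r z t = 1" if "z \<in> ?Z" "z' \<in> ?Z" "z \<noteq> z'" "t \<in> Q z" "t \<in> Q z'" for z z' t
  proof -
    from \<open>z \<noteq> z'\<close> obtain i where i: "z i \<noteq> z' i" by auto
    then have "i < n" using that(1,2) by (cases "i < n") (auto simp: grid_index_def)
    moreover have "real N * t i \<le> real (z i) \<or> real (z i) + 1 \<le> real N * t i"
    proof (cases "z i < z' i")
      case True
      then have "real (z i) + 1 \<le> real (z' i)" by simp
      then show ?thesis using that(5) \<open>i < n\<close> by (auto simp: Q_def)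
    next
      case False
      then have "real (z' i) + 1 \<le> real (z i)" using i by simp
      then show ?thesis using that(5) \<open>i < n\<close> by (fastforce simp: Q_def)
    qed
    ultimately show ?thesis using r_edge[OF that(4)] by blast
  qed
  have r_boundary: "r z t = 1" if "z \<in> ?Z" "t \<in> Q z" "t \<in> cube_boundary n" for z t
  proof -
    from \<open>t \<in> cube_boundary n\<close> obtain i where i: "i < n" "t i = 0 \<or> t i = 1"
        by (rule cube_boundaryE)
    have "real (z i) + 1 \<le> real N" using that(1) i(1) by (auto simp: grid_index_def)
    then have "real N * t i \<le> real (z i) \<or> real (z i) + 1 \<le> real N * t i" using i(2) by auto
    then show ?thesis by (rule r_edge[OF that(2) i(1)])
  qed
  have slice_cell: "slice n N c t \<in> cell (z(n := j)) {..<Suc n}" if "t \<in> Q z" "z \<in> ?Z" "real j \<le>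
      c" "c \<le> real j + 1" for c t z
    using that by (auto simp: cell_def slice_def Q_def grid_index_def less_Suc_eq)
  have top_index: "z(n := j) \<in> grid_index (Suc n) N" if "z \<in> ?Z" for z
    using that j by (auto simp: grid_index_def less_Suc_eq)
  \<comment> \<open>Over the edges of the base cells the position does not depend on z, so the
    homotopies over adjacent cells fit together.\<close>
  have pos_edge: "pos z s t = slice n N (real j + s) t" if "r z t = 1" "0 \<le> s" "t \<in> Q z" for z s t
    using that by (auto simp: pos_def slice_def fun_eq_iff field_simps)
  have pos_0: "pos z 0 t = slice n N (real j) t" if "t \<in> Q z" for z t
    using r_le[OF that] by (auto simp: pos_def slice_def fun_eq_iff field_simps)
  have pos_cell: "pos z s t \<in> cell (z(n := j)) {..<Suc n} \<and> pos z s t \<in> grid_skeleton (Suc n) N n"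
    if z: "z \<in> ?Z" and t: "t \<in> Q z" and s: "0 \<le> s" "s \<le> 1" for z s t
  proof -
    define M where "M = max (r z t) (1 - s/2)"
    have M0: "M > 0" using s by (simp add: M_def less_max_iff_disj)
    have u: "\<bar>(2 * (real N * t i - real (z i)) - 1) / M\<bar> \<le> 1" if "i < n" for i
      using r_ge[OF that, of t z] M0 by (simp add: abs_divide M_def)
    have "real (z i) \<le> pos z s t i \<and> pos z s t i \<le> real (z i) + 1" if "i < n" for i
    proof -
      have "pos z s t i = real (z i) + 1/2 + ((2 * (real N * t i - real (z i)) - 1) / M) / 2"
        using that by (simp add: pos_def M_def)
      then show ?thesis using u[OF that] unfolding abs_le_iff by argo
    qed
    moreover have "real j \<le> pos z s t n \<and> pos z s t n \<le> real j + 1"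
      using r_le[OF t] s by (auto simp: pos_def)
    ultimately have c: "pos z s t \<in> cell (z(n := j)) {..<Suc n}"
      using z by (auto simp: cell_def less_Suc_eq pos_def grid_index_def)
    have b: "pos z s t \<in> grid_box (Suc n) N"
      by (rule cell_in_grid_box[OF top_index[OF z] _ c]) simp
    show ?thesis
    \<comment> \<open>The point is either on the bottom face, with an integral last coordinate, or
      on a wall, with an integral coordinate in a base direction. Both lie in the n-skeleton, where
      F is defined.\<close>
    proof (cases "r z t \<le> 1 - s/2")
      case True
      then have "pos z s t n = real j" by (simp add: pos_def)
      then have "pos z s t \<in> grid_skeleton (Suc n) N n"
          by (intro grid_skeleton_codim_1[OF b, of n]) auto
      then show ?thesis using c by simp
    next
      case False
      obtain i where i: "i < n" "\<bar>2 * (real N * t i - real (z i)) - 1\<bar> = r z t"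
        using rad_attained[OF n, of "\<lambda>i. real N * t i - real (z i)"] by (auto simp: r_def)
      have "M = r z t" using False by (simp add: M_def)
      then have "\<bar>(2 * (real N * t i - real (z i)) - 1) / M\<bar> = 1" using i(2) M0
          by (simp add: abs_divide)
      then have "(2 * (real N * t i - real (z i)) - 1) / M = 1 \<or>
          (2 * (real N * t i - real (z i)) - 1) / M = - 1"
        by argo
      moreover have "pos z s t i = real (z i) + 1/2 + ((2 * (real N * t i - real (z i)) - 1) / M)
          / 2"
        using i(1) by (simp add: pos_def M_def)
      ultimately have "pos z s t i = real (z i) + 1 \<or> pos z s t i = real (z i)"
        by argo
      then have "pos z s t i \<in> \<int>" by auto
      then have "pos z s t \<in> grid_skeleton (Suc n) N n" using i(1)
          by (intro grid_skeleton_codim_1[OF b, of i]) auto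
      then show ?thesis using c by simp
    qed
  qed
  have r_cont: "continuous_on S (\<lambda>p. r z (snd p))" for S :: "(real \<times> (nat \<Rightarrow> real)) set" and z
    unfolding r_def
    by (rule continuous_on_compose2[OF continuous_on_rad[OF n, of UNIV]])
      (auto intro!: continuous_on_coordinatewise_then_product continuous_intros)
  have pos_cont: "continuous_on ({0..1::real} \<times> S) (\<lambda>p. pos z (fst p) (snd p))" for S z
  proof (intro continuous_on_coordinatewise_then_product)
    fix i
    have "max (r z (snd p)) (1 - fst p / 2) \<noteq> 0" if "p \<in> {0..1::real} \<times> S" for p
      using that by (auto simp: max_def)
    then show "continuous_on ({0..1::real} \<times> S) (\<lambda>p. pos z (fst p) (snd p) i)"
      unfolding pos_def by (intro continuous_on_If_const continuous_intros r_cont ballI) auto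
  qed
  let ?T = "top_of_set ({0..1::real} \<times> cube n)"
  have "\<exists>h. continuous_map ?T X h \<and> (\<forall>z\<in>?Z. \<forall>s\<in>{0..1}. \<forall>t\<in>Q z. h (s, t) = F (pos z s t))"
  proof (rule pasting_lemma_exists_closed[where X = ?T and Y = X and I = ?Z
      and T = "\<lambda>z. {0..1::real} \<times> Q z"
        and f = "\<lambda>z p. F (pos z (fst p) (snd p))"])
    show "topspace ?T \<subseteq> (\<Union>z\<in>?Z. {0..1} \<times> Q z)" using Q_cover by fastforce
    show "closedin ?T ({0..1} \<times> Q z)" if "z \<in> ?Z" for z
      by (rule closed_subset) (auto simp: Q_def[of z] intro!: closed_Times Q_closed[unfolded Q_def])
    show "continuous_map (subtopology ?T ({0..1} \<times> Q z)) X (\<lambda>p. F (pos z (fst p) (snd p)))"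
        if z: "z \<in> ?Z" for z
    proof -
      have "{0..1::real} \<times> Q z \<subseteq> {0..1::real} \<times> cube n" by (auto simp: Q_def)
      then have "subtopology ?T ({0..1} \<times> Q z) = top_of_set ({0..1} \<times> Q z)"
        by (simp add: subtopology_subtopology Int_absorb1)
      moreover have "(\<lambda>p. pos z (fst p) (snd p)) ` ({0..1} \<times> Q z) \<subseteq> grid_skeleton (Suc n) N n"
        using pos_cell[OF z] by auto
      then have "continuous_map (top_of_set ({0..1} \<times> Q z)) X (\<lambda>p. F (pos z (fst p) (snd p)))"
        by (rule continuous_map_top_of_set_compose[OF F pos_cont])
      ultimately show ?thesis by simp
    qed
    show "F (pos z (fst p) (snd p)) = F (pos z' (fst p) (snd p))"
      if "z \<in> ?Z" "z' \<in> ?Z" "p \<in> topspace ?T \<inter> ({0..1} \<times> Q z) \<inter> ({0..1} \<times> Q z')" for z z' p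
    proof (cases "z = z'")
      case False
      have p: "snd p \<in> Q z" "snd p \<in> Q z'" "0 \<le> fst p" using that(3) by auto
      show ?thesis
        using pos_edge[OF r_overlap[OF that(1,2) False p(1,2)] p(3,1)]
          pos_edge[OF r_overlap[OF that(2,1) _ p(2,1)] p(3,2)] False by simp
    qed simp
    fix h assume "continuous_map ?T X h" "\<And>p z. z \<in> ?Z \<Longrightarrow> p \<in> topspace ?T \<inter> ({0..1} \<times> Q z) \<Longrightarrow>
        h p = F (pos z (fst p) (snd p))"
    then show ?thesis by (intro exI[of _ h]) (auto simp: Q_def)
  qed (rule finite_grid_index)
  then obtain h where h: "continuous_map ?T X h" "\<And>z s t. z \<in> ?Z \<Longrightarrow> 0 \<le> s \<Longrightarrow> s \<le> 1 \<Longrightarrow> t \<in> Q z \<Longrightarrow>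
      h (s, t) = F (pos z s t)"
    by auto
  define f' where "f' t = h (1, t)" for t
  have 1: "(\<lambda>t. F (slice n N (real j) t), f') \<in> sph_homotopic n X x"
  proof (rule sph_homotopicI[OF h(1)])
    fix t assume "t \<in> cube n"
    then obtain z where "z \<in> ?Z" "t \<in> Q z" using Q_cover by blast
    then show "h (0, t) = F (slice n N (real j) t)" using h(2)[of z 0 t] pos_0 by simp
  next
    fix s t assume s: "0 \<le> s" "s \<le> (1::real)" and t: "t \<in> cube_boundary n"
    then obtain z where z: "z \<in> ?Z" "t \<in> Q z" using Q_cover cube_boundary_subset by blast
    have eq: "pos z s t = slice n N (real j + s) t"
        using pos_edge[OF r_boundary[OF z t] s(1) z(2)] .
    have b: "pos z s t \<in> grid_box (Suc n) N" using pos_cell[OF z s] by (simp add: grid_skeleton_def)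
    obtain i where i: "i < n" "t i = 0 \<or> t i = 1" using t by (rule cube_boundaryE)
    \<comment> \<open>Over the boundary of the cube the sheet moves along the sides of the grid,
      which F sends to the base point.\<close>
    have "F (pos z s t) = x" by (rule Fx[OF b i(1)]) (use i eq in \<open>auto simp: slice_def\<close>)
    then show "h (s, t) = x" using h(2)[OF z(1) s z(2)] by simp
  qed (simp add: f'_def)
  have f': "f' \<in> spheroids n X x" using sph_homotopic_spheroids(2)[OF 1] .
  have f'_edge: "f' t = f1 t" if "z \<in> ?Z" "t \<in> Q z" "r z t = 1" for z t
    using h(2)[of z 1 t] pos_edge[of z t 1] that by (simp add: f'_def f1_def add.commute)
  have f'_U: "f' t \<in> U (z(n := j))" "f1 t \<in> U (z(n := j))" if z: "z \<in> ?Z" "t \<in> Q z" for z t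
  proof -
    show "f' t \<in> U (z(n := j))"
      using h(2)[of z 1 t] FU(2)[OF top_index[OF z(1)]] pos_cell[OF z, of 1] z by (simp add: f'_def)
    have c: "slice n N (real (Suc j)) t \<in> cell (z(n := j)) {..<Suc n}"
        by (rule slice_cell[OF z(2,1)]) auto
    have b: "slice n N (real (Suc j)) t \<in> grid_box (Suc n) N"
      by (rule cell_in_grid_box[OF top_index[OF z(1)] _ c]) simp
    have "slice n N (real (Suc j)) t n \<in> \<int>" by (simp add: slice_def)
    then show "f1 t \<in> U (z(n := j))"
      unfolding f1_def using FU(2)[OF top_index[OF z(1)] c grid_skeleton_codim_1[OF b, of n]]
          by simp
  qed
  have f1_cont: "continuous_map (top_of_set (cube n)) X f1"
    unfolding f1_def
  proof (rule continuous_map_top_of_set_compose[OF F])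
    show "continuous_on (cube n) (slice n N (real (Suc j)))"
      unfolding slice_def
      by (intro continuous_on_coordinatewise_then_product continuous_on_If_const continuous_intros)
    show "slice n N (real (Suc j)) ` cube n \<subseteq> grid_skeleton (Suc n) N n"
    proof
      fix y assume "y \<in> slice n N (real (Suc j)) ` cube n"
      then obtain t where t: "t \<in> cube n" "y = slice n N (real (Suc j)) t" by auto
      then obtain z where z: "z \<in> ?Z" "t \<in> Q z" using Q_cover by blast
      have c: "y \<in> cell (z(n := j)) {..<Suc n}" unfolding t(2) by (rule slice_cell[OF z(2,1)]) auto
      have b: "y \<in> grid_box (Suc n) N"
        by (rule cell_in_grid_box[OF top_index[OF z(1)] _ c]) simp
      show "y \<in> grid_skeleton (Suc n) N n"
        by (rule grid_skeleton_codim_1[OF b, of n]) (simp_all add: t(2) slice_def)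
    qed
  qed
  \<comment> \<open>The hybrid that already uses \<open>f1\<close> over the cells of P. Points
    shared by two cells cause no conflict, because \<open>f1\<close> and \<open>f'\<close> agree
    over the edges.\<close>
  define g where "g P t = (if \<exists>z\<in>P. t \<in> Q z then f1 t else f' t)" for P t
  have g_out: "g P t = f' t" if "P \<subseteq> ?Z" "z \<in> ?Z" "z \<notin> P" "t \<in> Q z" for P z t
  proof (cases "\<exists>z'\<in>P. t \<in> Q z'")
    case True
    then obtain z' where z': "z' \<in> P" "t \<in> Q z'" by blast
    have "z \<noteq> z'" "z' \<in> ?Z" using z'(1) that(1,3) by auto
    then have "r z t = 1" using r_overlap[OF that(2) _ _ that(4) z'(2)] by blast
    then show ?thesis using f'_edge[OF that(2,4)] by (simp add: g_def)
  qed (simp add: g_def)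
  have g_sph: "g P \<in> spheroids n X x" if P: "P \<subseteq> ?Z" for P
    unfolding spheroids_iff
  proof (intro conjI ballI)
    show "continuous_map (top_of_set (cube n)) X (g P)"
    proof (rule pasting_lemma_closed[where I = ?Z and T = Q and f = "\<lambda>z. if z \<in> P then f1 else f'"])
      show "closedin (top_of_set (cube n)) (Q z)" if "z \<in> ?Z" for z
        by (rule closed_subset[OF _ Q_closed]) (auto simp: Q_def)
      show "continuous_map (subtopology (top_of_set (cube n)) (Q z)) X (if z \<in>
          P then f1 else f')" if "z \<in> ?Z" for z
        using f1_cont f' by (auto simp: spheroids_iff intro: continuous_map_from_subtopology)
      show "(if z \<in> P then f1 else f') t = (if z' \<in> P then f1 else f') t"
        if "z \<in> ?Z" "z' \<in> ?Z" "t \<in> topspace (top_of_set (cube n)) \<inter> Q z \<inter> Q z'" for z z' t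
      proof (cases "z = z'")
        case False
        have "r z t = 1" using r_overlap[OF that(1,2) False] that(3) by auto
        then show ?thesis using f'_edge[OF that(1)] that(3) by auto
      qed simp
      fix t assume "t \<in> topspace (top_of_set (cube n))"
      then obtain z where z: "z \<in> ?Z" "t \<in> Q z" using Q_cover by auto
      show "\<exists>z. z \<in> ?Z \<and> t \<in> Q z \<and> g P t = (if z \<in> P then f1 else f') t"
      proof (cases "z \<in> P")
        case True
        then show ?thesis using z by (intro exI[of _ z]) (auto simp: g_def)
      next
        case False
        then show ?thesis using z g_out[OF P z(1) False z(2)] by (intro exI[of _ z]) auto
      qed
    qed (rule finite_grid_index)
    fix t assume t: "t \<in> cube_boundary n"
    then obtain z where z: "z \<in> ?Z" "t \<in> Q z" using Q_cover cube_boundary_subset by blast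
    have "f1 t = f' t" using f'_edge[OF z r_boundary[OF z t]] by simp
    then show "g P t = x" using f' t by (simp add: g_def spheroids_iff)
  qed
  \<comment> \<open>Adding one base cell changes the hybrid only inside a box. Over this box both
    versions are F along the n-skeleton of one top cell, so they stay in one member of the coarse
    cover.\<close>
  have "spanier_related n X \<U> x (g {}) (g P)" if "finite P" "P \<subseteq> ?Z" for P
    using that
  proof (induction P rule: finite_induct)
    case empty
    show ?case by (rule spanier_related_homotopic[OF n x sph_homotopic_refl[OF g_sph]]) simp
  next
    case (insert z P)
    then have P: "P \<subseteq> ?Z" and z: "z \<in> ?Z" and zP: "z \<notin> P" by auto
    have Q_iff: "t \<in> Q z \<longleftrightarrow> (\<forall>i<n. real (z i) / real N \<le> t i \<and> t i \<le> (real (z i) + 1) / real N)"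
        if "t \<in> cube n" for t
      using that N by (simp add: Q_def pos_divide_le_eq pos_le_divide_eq mult.commute)
    have ins: "g (insert z P) t = (if t \<in> Q z then f1 t else g P t)" for t by (auto simp: g_def)
    have "spanier_related n X \<U> x (g P) (g (insert z P))"
    proof (rule spanier_related_box[OF n x g_sph[OF P] g_sph[OF insert.prems]])
      show "0 \<le> real (z i) / real N \<and> real (z i) / real N \<le> (real (z i) + 1) / real N \<and>
          (real (z i) + 1) / real N \<le> 1"
        if "i < n" for i
      proof -
        have "real (z i) + 1 \<le> real N" using z that by (auto simp: grid_index_def)
        then show ?thesis using N by (simp add: divide_right_mono)
      qed
      show "g P t = g (insert z P) t"
        if t: "t \<in> cube n" "\<exists>i<n. t i \<le> real (z i) / real N \<or> (real (z i) + 1) / real N \<le> t i" for t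
      proof (cases "t \<in> Q z")
        case True
        obtain i where i: "i < n" "t i \<le> real (z i) / real N \<or> (real (z i) + 1) / real N \<le> t i"
            using t(2) by blast
        then have "real N * t i \<le> real (z i) \<or> real (z i) + 1 \<le> real N * t i"
          using N by (simp add: pos_divide_le_eq pos_le_divide_eq mult.commute)
        then have "r z t = 1" by (rule r_edge[OF True i(1)])
        then show ?thesis using g_out[OF P z zP True] f'_edge[OF z True] True by (simp add: ins)
      qed (simp add: ins)
      show "U (z(n := j)) \<in> \<U>" using FU(1)[OF top_index[OF z]] .
      show "g P t \<in> U (z(n := j)) \<and> g (insert z P) t \<in> U (z(n := j))"
        if t: "t \<in> cube n" "\<forall>i<n. real (z i) / real N \<le> t i \<and> t i \<le> (real (z i) + 1) / real N" for t
      proof -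
        have "t \<in> Q z" using Q_iff[OF t(1)] t(2) by simp
        then show ?thesis using g_out[OF P z zP] f'_U[OF z] by (simp add: ins)
      qed
    qed
    with insert.IH[OF P] show ?case by (rule spanier_related_trans[OF n x])
  qed
  from this[OF finite_grid_index subset_refl]
  have "spanier_related n X \<U> x (g {}) (g ?Z)" .
  moreover have "g {} = f'" by (simp add: g_def fun_eq_iff)
  ultimately have 2: "spanier_related n X \<U> x f' (g ?Z)" by simp
  have "(g ?Z, \<lambda>t. F (slice n N (real (Suc j)) t)) \<in> sph_homotopic n X x"
    by (rule sph_homotopic_eq_on_cube[OF g_sph]) (use Q_cover in \<open>auto simp: g_def f1_def\<close>)
  with 1 2 show ?thesis
    by (meson spanier_related_homotopic[OF n x] spanier_related_trans[OF n x])
qed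

section \<open>The kernel lies in the Spanier group\<close>

text \<open>The metric on sequences sums the coordinate distances, truncated at 1, with weights 1,
  1/2, 1/4 and so on; the weights add up to 2.\<close>

lemma dist_fun_le:
  fixes s t :: "nat \<Rightarrow> real"
  assumes "\<And>i. \<bar>s i - t i\<bar> \<le> \<delta>"
  shows "dist s t \<le> 2 * \<delta>"
proof -
  have le: "(1/2) ^ k * min (dist (s (from_nat k)) (t (from_nat k))) 1 \<le> (1/2) ^ k * \<delta>" for k
    using assms[of "from_nat k"] by (intro mult_left_mono) (auto simp: dist_real_def
        min_le_iff_disj)
  have sm: "summable (\<lambda>k. (1/2) ^ k * \<delta>)" by (intro summable_mult2 summable_geometric) simp
  have "dist s t \<le> suminf (\<lambda>k. (1/2) ^ k * \<delta>)"
    unfolding dist_fun_def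
    by (rule suminf_le[OF le summable_comparison_test'[OF sm, of 0] sm]) (use le in auto)
  also have "\<dots> = 2 * \<delta>" by (subst suminf_mult2[symmetric]) (auto simp: suminf_geometric
      summable_geometric)
  finally show ?thesis .
qed

text \<open>The last grid coordinate becomes the homotopy parameter, so level 0 of the grid
  corresponds to the start of the homotopy and level N to its end.\<close>

definition unscale :: "nat \<Rightarrow> nat \<Rightarrow> (nat \<Rightarrow> real) \<Rightarrow> real \<times> (nat \<Rightarrow> real)" where
  "unscale n N t = (t n / real N, \<lambda>i. if i < n then t i / real N else 0)"

lemma unscale_in: 
  assumes "t \<in> grid_box (Suc n) N" "N > 0"
  shows "unscale n N t \<in> {0..1} \<times> cube n"
  using assms by (auto simp: unscale_def grid_box_def cube_def)

text \<open>The preimages of the sets \<open>O' w\<close> have a Lebesgue number on the compact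
  domain; N is taken so large that each unscaled cell lies within this distance of its lowest
  corner.\<close>

lemma fine_grid:
  assumes h: "continuous_map (top_of_set ({0..1::real} \<times> cube n)) Y h"
    and op: "\<And>w. w \<in> I \<Longrightarrow> openin Y (O' w)" and cov: "topspace Y \<subseteq> (\<Union>w\<in>I. O' w)"
  shows "\<exists>N>0. \<forall>z\<in>grid_index (Suc n) N. \<exists>w\<in>I. \<forall>t\<in>cell z {..<Suc n}. h (unscale n N t) \<in> O' w"
proof -
  let ?K = "{0..1::real} \<times> cube n"
  have "\<forall>w\<in>I. \<exists>G. open G \<and> {k \<in> ?K. h k \<in> O' w} = ?K \<inter> G"
  proof
    fix w assume "w \<in> I"
    then have "openin (top_of_set ?K) {k \<in> topspace (top_of_set ?K). h k \<in> O' w}"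
      by (intro openin_continuous_map_preimage[OF h op])
    then show "\<exists>G. open G \<and> {k \<in> ?K. h k \<in> O' w} = ?K \<inter> G"
      unfolding openin_open topspace_euclidean_subtopology .
  qed
  then obtain G' where G': "\<forall>w\<in>I. open (G' w) \<and> {k \<in> ?K. h k \<in> O' w} = ?K \<inter> G' w"
    by (rule bchoice[elim_format]) blast
  define G where "G = G'"
  have G: "open (G w)" "\<And>k. k \<in> ?K \<Longrightarrow> k \<in> G w \<longleftrightarrow> h k \<in> O' w" if "w \<in> I" for w
    using G' that unfolding G_def by (blast, blast)
  have cK: "compact ?K" by (intro compact_Times compact_cube compact_Icc)
  have sub: "?K \<subseteq> \<Union>(G ` I)"
  proof
    fix k assume k: "k \<in> ?K"
    then have "h k \<in> topspace Y" using continuous_map_image_subset_topspace[OF h] by auto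
    then obtain w where "w \<in> I" "h k \<in> O' w" using cov by blast
    then show "k \<in> \<Union>(G ` I)" using G(2)[of w k] k by blast
  qed
  obtain e where e: "0 < e" "\<And>k. k \<in> ?K \<Longrightarrow> \<exists>B\<in>G ` I. ball k e \<subseteq> B"
    by (rule Heine_Borel_lemma[OF cK sub]) (use G(1) in auto)
  \<comment> \<open>Coordinates within a cell differ by at most 1/N after unscaling. The 3 consists
    of 1 for the homotopy parameter and 2 for the metric on sequences.\<close>
  obtain N :: nat where N: "N > 0" "3 / real N < e"
  proof -
    obtain N :: nat where "3 / e < real N" using reals_Archimedean2 by blast
    moreover from this have "0 < real N" using e(1)
        by (meson divide_pos_pos less_trans zero_less_numeral)
    ultimately show thesis using e(1) by (intro that[of N]) (auto simp: field_simps)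
  qed
  show ?thesis
  proof (intro exI[of _ N] conjI ballI)
    fix z assume z: "z \<in> grid_index (Suc n) N"
    define c where "c = (\<lambda>i. real (z i))"
    have c: "c \<in> cell z {..<Suc n}" by (simp add: cell_def c_def)
    have box: "t \<in> grid_box (Suc n) N" if "t \<in> cell z {..<Suc n}" for t
      by (rule cell_in_grid_box[OF z _ that]) simp
    obtain w where w: "w \<in> I" "ball (unscale n N c) e \<subseteq> G w"
      using e(2)[OF unscale_in[OF box[OF c] N(1)]] by blast
    have "h (unscale n N t) \<in> O' w" if t: "t \<in> cell z {..<Suc n}" for t
    proof -
      have d: "\<bar>c i / real N - t i / real N\<bar> \<le> 1 / real N" for i
      proof -
        have "\<bar>c i - t i\<bar> \<le> 1" using cell_bounds[OF t, of i] by (simp add: c_def)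
        then show ?thesis using N(1) by (simp add: diff_divide_distrib[symmetric] abs_divide
            divide_right_mono)
      qed
      have "dist (unscale n N c) (unscale n N t) \<le> dist (c n / real N) (t n / real N) +
          dist (\<lambda>i. if i < n then c i / real N else 0) (\<lambda>i. if i < n then t i / real N else 0)"
        unfolding unscale_def dist_Pair_Pair by (rule sqrt_sum_squares_le_sum) auto
      also have "\<dots> \<le> 1 / real N + 2 * (1 / real N)"
        using d by (intro add_mono dist_fun_le) (auto simp: dist_real_def)
      finally have "dist (unscale n N c) (unscale n N t) < e" using N(2) by simp
      then have "unscale n N t \<in> G w" using w(2) by auto
      then show ?thesis using G(2)[OF w(1) unscale_in[OF box[OF t] N(1)]] by simp
    qed
    then show "\<exists>w\<in>I. \<forall>t\<in>cell z {..<Suc n}. h (unscale n N t) \<in> O' w" using w(1) by blast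
  qed (rule N(1))
qed

theorem kernel_subset_spanier_group:
  assumes n: "n \<ge> 1" and x0: "x0 \<in> topspace X" and P: "paracompact_space X"
      and H: "Hausdorff_space X"
    and L: "LC (n - 1) X"
  shows "kernel (homotopy_group n X x0) (shape_group n X x0) (shape_hom n X x0) \<subseteq>
      spanier_group n X x0"
proof
  fix A assume A: "A \<in> kernel (homotopy_group n X x0) (shape_group n X x0) (shape_hom n X x0)"
  then have Ac: "A \<in> carrier (homotopy_group n X x0)" by (simp add: kernel_def)
  obtain f where f: "f \<in> spheroids n X x0" "A = sph_class n X x0 f"
    by (rule homotopy_group_carrierE[OF Ac])
  have "A \<in> spanier_group_cover n X \<U> x0" if \<U>: "open_cover X \<U>" for \<U>
  proof -
    have nn: "n \<le> Suc (n - 1)" using n by simp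
    obtain \<W>' where \<W>': "open_cover X \<W>'" and ext: "extends_over_skeleton n X \<W>' \<U>"
      using skeleton_extension[OF P H L nn \<U>] by blast
    \<comment> \<open>Membership in the kernel speaks of pointed covers, so the labels are taken
      from a pointed refinement; \<open>R\<close> later enlarges them to members of \<W>'.\<close>
    obtain \<W> W0 where \<W>: "(\<W>, W0) \<in> pointed_covers X x0" "refines \<W> \<W>'"
      by (rule pointed_refinement[OF P H \<W>' x0])
    have \<W>oc: "open_cover X \<W>" and W0: "W0 \<in> \<W>" "x0 \<in> W0" using \<W>(1)
        by (auto simp: pointed_covers_def)
    define p where "p = (SOME p. canonical_map X x0 (\<W>, W0) p)"
    note p = canonical_map_SOME[OF x0 \<W>(1) p_def]
    let ?K = "nerve \<W>" let ?Y = "realization (nerve \<W>)"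
    have y0: "vertex W0 \<in> topspace ?Y"
      using continuous_map_image_subset_topspace[OF p(1)] x0 p(2) by (metis image_subset_iff)
    have "induced_map n ?Y (vertex W0) p A = sph_class n ?Y (vertex W0) (\<lambda>_. vertex W0)"
      using A \<W>(1) unfolding kernel_shape_hom_iff one_homotopy_group p_def by auto
    then have "(p \<circ> f, \<lambda>_. vertex W0) \<in> sph_homotopic n ?Y (vertex W0)"
      using f sph_class_eq_iff[OF spheroid_compose[OF p(1,2) f(1)] spheroid_const[OF y0]]
      by (simp add: induced_map_sph_class[OF p(1,2)])
    from sph_homotopicD[OF this] obtain h where h: "continuous_map (top_of_set ({0..1::real} \<times>
        cube n)) ?Y h"
      and h0: "\<And>t. h (0, t) = p (f t)" and h1: "\<And>t. h (1, t) = vertex W0"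
      and hb: "\<And>s t. 0 \<le> s \<Longrightarrow> s \<le> 1 \<Longrightarrow> t \<in> cube_boundary n \<Longrightarrow> h (s, t) = vertex W0"
      by auto
    have "topspace ?Y \<subseteq> (\<Union>W\<in>\<W>. open_star ?K W)"
    proof
      fix b assume "b \<in> topspace ?Y"
      then obtain W where "W \<in> \<W>" "b \<in> open_star ?K W" by (rule open_star_cover)
      then show "b \<in> (\<Union>W\<in>\<W>. open_star ?K W)" by blast
    qed
    from fine_grid[OF h openin_open_star this] obtain N where N: "N > 0"
      and "\<forall>z\<in>grid_index (Suc n) N. \<exists>W\<in>\<W>. \<forall>t\<in>cell z {..<Suc n}. h (unscale n N t) \<in> open_star ?K W"
      by auto
    then have "\<forall>z\<in>grid_index (Suc n) N. \<exists>W. W \<in> \<W> \<and> (\<forall>t\<in>cell z {..<Suc n}. h (unscale n N t) \<in>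
        open_star ?K W)"
      by blast
    then obtain W where "\<forall>z\<in>grid_index (Suc n) N. W z \<in> \<W> \<and>
        (\<forall>t\<in>cell z {..<Suc n}. h (unscale n N t) \<in> open_star ?K (W z))"
      by (rule bchoice[elim_format]) blast
    then have W: "\<And>z. z \<in> grid_index (Suc n) N \<Longrightarrow> W z \<in> \<W>"
      and hW: "\<And>z t. z \<in> grid_index (Suc n) N \<Longrightarrow> t \<in> cell z {..<Suc n} \<Longrightarrow>
          h (unscale n N t) \<in> open_star ?K (W z)"
      by simp_all
    have "\<forall>w\<in>\<W>. \<exists>w'. w' \<in> \<W>' \<and> w \<subseteq> w'" using \<W>(2) by (auto simp: refines_def)
    then obtain R where R: "\<forall>w\<in>\<W>. R w \<in> \<W>' \<and> w \<subseteq> R w" by metis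
    \<comment> \<open>The sides and the top of the grid, where the null-homotopy is constant;
      \<open>C0\<close> is the bottom, where it is p after f.\<close>
    define C where "C = {t \<in> grid_boundary (Suc n) N. (\<exists>i<n. t i = 0 \<or> t i = real N) \<or> t n =
        real N}"
    define C0 where "C0 = {t \<in> grid_boundary (Suc n) N. t n = 0}"
    have bd: "grid_boundary (Suc n) N = C \<union> C0"
      by (auto simp: C_def C0_def grid_boundary_def less_Suc_eq)
    have C_closed: "closed C"
    proof -
      have "closed ((\<Union>i\<in>{..<n}. {t :: nat \<Rightarrow> real. t i = 0 \<or> t i = real N}) \<union> {t. t n = real N})"
        by (intro closed_Un closed_UN ballI closed_Collect_disj closed_Collect_eq
            continuous_intros) auto
      from closed_Int[OF closed_grid_boundary this, of "Suc n" N]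
      show ?thesis by (rule back_subst[where P = closed]) (auto simp: C_def)
    qed
    have C0_closed: "closed C0"
    proof -
      have "closed {t :: nat \<Rightarrow> real. t n = 0}" by (intro closed_Collect_eq continuous_intros)
      from closed_Int[OF closed_grid_boundary this, of "Suc n" N]
      show ?thesis by (rule back_subst[where P = closed]) (auto simp: C0_def)
    qed
    define base where "base t i = (if i < n then t i / real N else 0)" for t :: "nat \<Rightarrow> real" and i
    have base_cube: "base t \<in> cube n" if "t \<in> grid_box (Suc n) N" for t
      using unscale_in[OF that N] by (simp add: unscale_def base_def[abs_def])
    have base_bd: "base t \<in> cube_boundary n" if "t \<in> grid_box (Suc n) N" "i < n" "t i = 0 \<or> t i =
        real N" for t i
      using base_cube[OF that(1)] that(2,3) N
          by (auto simp: cube_boundary_eq base_def intro!: exI[of _ i])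
    have un: "unscale n N t = (t n / real N, base t)" for t
        by (simp add: unscale_def base_def[abs_def])
    have hC: "h (unscale n N t) = vertex W0" if t: "t \<in> C" for t
    proof -
      have b: "t \<in> grid_box (Suc n) N" using t by (simp add: C_def grid_boundary_def)
      consider i where "i < n" "t i = 0 \<or> t i = real N" | "t n = real N" using t
          by (auto simp: C_def)
      then show ?thesis
      proof cases
        case 1
        then show ?thesis using hb[of "t n / real N" "base t"] base_bd[OF b 1] unscale_in[OF b N]
            by (simp add: un)
      next
        case 2
        then show ?thesis using h1 N by (simp add: un)
      qed
    qed
    \<comment> \<open>The boundary values of the extension are \<open>x0\<close> on \<open>C\<close>
      and f on the bottom. They match where the two meet, because f sends the boundary of the cube
      to \<open>x0\<close>.\<close>
    have "\<exists>F0. continuous_map (top_of_set (C \<union> (\<Union>j\<in>{()}. C0))) X F0 \<and> (\<forall>t\<in>C. F0 t = x0) \<and>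
       (\<forall>j\<in>{()}. \<forall>t\<in>C0. F0 t = f (base t))"
    proof (rule extend_over_closed_pieces[OF C_closed])
      show "continuous_map (top_of_set C) X (\<lambda>_. x0)" using x0 by simp
      show "continuous_map (top_of_set C0) X (\<lambda>t. f (base t))"
      proof (rule continuous_map_top_of_set_compose[of "cube n" X f C0 base])
        show "continuous_map (top_of_set (cube n)) X f" using f(1) by (simp add: spheroids_iff)
        show "continuous_on C0 base"
          unfolding base_def by (intro continuous_on_coordinatewise_then_product
              continuous_on_If_const continuous_intros) (use N in auto)
        show "base ` C0 \<subseteq> cube n" using base_cube by (auto simp: C0_def grid_boundary_def)
      qed
      show "f (base t) = x0" if t: "t \<in> C0" "t \<in> C" for t
      proof -
        have b: "t \<in> grid_box (Suc n) N" using t by (simp add: C_def grid_boundary_def)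
        obtain i where "i < n" "t i = 0 \<or> t i = real N" using t N by (auto simp: C_def C0_def)
        then show ?thesis using base_bd[OF b] f(1) by (simp add: spheroids_iff)
      qed
    qed (use C0_closed in auto)
    then obtain F0 where F0: "continuous_map (top_of_set (grid_boundary (Suc n) N)) X F0"
      "\<And>t. t \<in> C \<Longrightarrow> F0 t = x0" "\<And>t. t \<in> C0 \<Longrightarrow> F0 t = f (base t)"
      by (auto simp: bd)
    \<comment> \<open>On \<open>C\<close> the null-homotopy is at the base vertex, so the label is
      \<open>W0\<close>, which contains \<open>x0\<close>. On the bottom, p sends the value of f
      into the open star of the label, and a canonical map pulls this star back into the label
      itself.\<close>
    have F0W: "F0 t \<in> W z" if z: "z \<in> grid_index (Suc n) N"
        and t: "t \<in> cell z {..<Suc n}" "t \<in> grid_boundary (Suc n) N" for z t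
    proof (cases "t \<in> C")
      case True
      have "vertex W0 \<in> open_star ?K (W z)" using hW[OF z t(1)] hC[OF True] by simp
      then have "W z = W0" using vertex_in_open_star_iff[of W0 \<W> "W z"] W0 by auto
      then show ?thesis using F0(2)[OF True] W0(2) by simp
    next
      case False
      then have C0: "t \<in> C0" using t(2) bd by blast
      have "h (unscale n N t) = p (f (base t))" using C0 h0 by (simp add: un C0_def)
      then have "p (f (base t)) \<in> open_star ?K (W z)" using hW[OF z t(1)] by simp
      moreover have "f (base t) \<in> topspace X"
      proof -
        have "base t \<in> cube n" using base_cube t(2) by (simp add: grid_boundary_def)
        then show ?thesis using f(1) continuous_map_image_subset_topspace[of "top_of_set (cube
            n)" X f] by (auto simp: spheroids_iff)
      qed
      ultimately have "f (base t) \<in> W z" using p(3)[OF W[OF z]] by blast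
      then show ?thesis using F0(3)[OF C0] by simp
    qed
    have "\<exists>F U. continuous_map (top_of_set (grid_skeleton (Suc n) N n)) X F \<and>
        (\<forall>t\<in>grid_boundary (Suc n) N. F t = F0 t) \<and>
        (\<forall>z\<in>grid_index (Suc n) N. U z \<in> \<U> \<and> (\<forall>t\<in>cell z {..<Suc n} \<inter> grid_skeleton (Suc n) N n. F
            t \<in> U z))"
    proof (rule extends_over_skeletonD[OF ext, where W = "\<lambda>z. R (W z)"])
      show "R (W z) \<in> \<W>'" if "z \<in> grid_index (Suc n) N" for z using R W[OF that] by blast
      show "continuous_map (top_of_set (grid_boundary (Suc n) N)) X F0" by (rule F0(1))
      show "F0 t \<in> R (W z)" if "z \<in> grid_index (Suc n) N" "t \<in>
          cell z {..<Suc n} \<inter> grid_boundary (Suc n) N" for z t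
        using F0W[OF that(1)] that(2) R W[OF that(1)] by blast
      fix v assume v: "v \<in> grid_box (Suc n) N"
      have "h (unscale n N v) \<in> topspace ?Y"
        using continuous_map_image_subset_topspace[OF h] unscale_in[OF v N] by auto
      then show "\<exists>x\<in>topspace X. \<forall>z\<in>grid_index (Suc n) N. v \<in> cell z {..<Suc n} \<longrightarrow> x \<in> R (W z)"
      proof (rule open_stars_Inter_nonempty)
        fix x assume x: "\<And>U. h (unscale n N v) \<in> open_star ?K U \<Longrightarrow> x \<in> U" "\<exists>U\<in>\<W>. x \<in> U"
        have "x \<in> topspace X" using x(2) \<W>oc by (auto simp: open_cover_def)
        moreover have "x \<in> R (W z)" if "z \<in> grid_index (Suc n) N" "v \<in> cell z {..<Suc n}" for z
          using x(1)[OF hW[OF that]] R W[OF that(1)] by blast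
        ultimately show ?thesis by blast
      qed
    qed
    then obtain F U where FU': "continuous_map (top_of_set (grid_skeleton (Suc n) N n)) X F \<and>
        (\<forall>t\<in>grid_boundary (Suc n) N. F t = F0 t) \<and>
        (\<forall>z\<in>grid_index (Suc n) N. U z \<in> \<U> \<and> (\<forall>t\<in>cell z {..<Suc n} \<inter> grid_skeleton (Suc n) N n. F
            t \<in> U z))"
      by blast
    then have F: "continuous_map (top_of_set (grid_skeleton (Suc n) N n)) X F"
      and FF0: "\<And>t. t \<in> grid_boundary (Suc n) N \<Longrightarrow> F t = F0 t"
      and FU: "\<And>z. z \<in> grid_index (Suc n) N \<Longrightarrow> U z \<in> \<U>"
        "\<And>z t. z \<in> grid_index (Suc n) N \<Longrightarrow> t \<in> cell z {..<Suc n} \<Longrightarrow> t \<in> grid_skeleton (Suc n) N n \<Longrightarrow>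
            F t \<in> U z"
      by simp_all
    have Fx: "F t = x0" if "t \<in> grid_box (Suc n) N" "i < n" "t i = 0 \<or> t i = real N" for t i
    proof -
      have "t \<in> C" using that by (auto simp: C_def grid_boundary_def intro!: exI[of _ i])
      then show ?thesis using FF0 F0(2) bd by simp
    qed
    have level: "spanier_related n X \<U> x0 (\<lambda>t. F (slice n N (real j) t)) (\<lambda>t. F (slice n N (real
        (Suc j)) t))" if "j < N" for j
      by (rule spanier_related_level[OF n x0 F FU Fx that])
    have slice_bd: "slice n N (real j) t \<in> grid_boundary (Suc n) N" if "t \<in> cube n" "j = 0 \<or> j =
        N" for j t
      using that N by (auto simp: grid_boundary_def grid_box_def slice_def cube_def mult_left_le
          less_Suc_eq)
    have s0: "F (slice n N (real 0) t) = f t" if t: "t \<in> cube n" for t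
    proof -
      have "slice n N (real 0) t \<in> C0" using slice_bd[OF t, of 0] by (simp add: C0_def slice_def)
      moreover have "base (slice n N (real 0) t) = t" using t N
          by (auto simp: base_def slice_def cube_def fun_eq_iff)
      ultimately show ?thesis using FF0 F0(3) bd by simp
    qed
    have sN: "F (slice n N (real N) t) = x0" if t: "t \<in> cube n" for t
    proof -
      have "slice n N (real N) t \<in> C" using slice_bd[OF t, of N] by (simp add: C_def slice_def)
      then show ?thesis using FF0 F0(2) bd by simp
    qed
    have "spanier_related n X \<U> x0 f (\<lambda>t. F (slice n N (real j) t))" if "j \<le> N" for j
      using that
    proof (induction j)
      case 0
      show ?case
        by (rule spanier_related_homotopic[OF n x0 sph_homotopic_eq_on_cube[OF f(1)]]) (simp add:
            s0[simplified])
    next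
      case (Suc j)
      then have "spanier_related n X \<U> x0 f (\<lambda>t. F (slice n N (real j) t))" "j < N" by simp_all
      then show ?case by (rule spanier_related_trans[OF n x0 _ level])
    qed
    from this[of N] have 1: "spanier_related n X \<U> x0 f (\<lambda>t. F (slice n N (real N) t))" by simp
    moreover have "(\<lambda>t. F (slice n N (real N) t), \<lambda>_. x0) \<in> sph_homotopic n X x0"
      using 1 sN by (intro sph_homotopic_eq_on_cube) (auto simp: spanier_related_def)
    ultimately have "spanier_related n X \<U> x0 f (\<lambda>_. x0)"
      using spanier_related_homotopic[OF n x0] spanier_related_trans[OF n x0] by blast
    moreover have "inv\<^bsub>homotopy_group n X x0\<^esub> (sph_class n X x0 (\<lambda>_. x0)) =
        \<one>\<^bsub>homotopy_group n X x0\<^esub>"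
      using monoid.inv_one[OF group.is_monoid[OF group_homotopy_group[OF n x0]]]
          by (simp add: one_homotopy_group)
    ultimately show ?thesis
      using group.is_monoid[OF group_homotopy_group[OF n x0]] Ac f(2)
      by (simp add: spanier_related_def monoid.r_one)
  qed
  then show "A \<in> spanier_group n X x0" by (simp add: spanier_group_def)
qed

theorem theorem1p1:
  fixes X :: "'a topology" and x0 :: 'a and n :: nat
  assumes "n \<ge> 1"
    and "path_connected_space X"
    and "x0 \<in> topspace X"
    and "paracompact_space X"
    and "Hausdorff_space X"
    and "LC (n - 1) X"
  shows "spanier_group n X x0 =
         kernel (homotopy_group n X x0) (shape_group n X x0) (shape_hom n X x0)"
  using spanier_group_subset_kernel[OF assms(1,3)] kernel_subset_spanier_group[OF assms(1,3-6)]
  by (rule subset_antisym)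

end
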